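(* All tie knots are alternating; that is, every tie knot has an alternating knot diagram.
   Context: Tie sequences. The tie moves are $L_i,L_o,R_i,R_o,C_i,C_o$; the letter names a region (left, right, center) and the subscript a direction ($i$ = in, $o$ = out). A tie sequence is a finite list of tie moves followed by the symbol $T$ (tuck) such that: it begins with $L_i$ or $L_o$; no two consecutive moves have the same letter; directions alternate between in and out; it ends with $L_oR_iC_oT$ or $R_oL_iC_oT$. There is no bound on the number of moves. Tie diagrams. In the plane, the passive strand starts at a point $b$ at the bottom, runs up the "straight strand" to a point $x$, then up the left side of the "neck loop", clockwise over its top, and down its right side to a point $a$ just to the right of $x$. The active strand starts at $a$; its first move (an $L$ move) carries it leftward across the passive strand at $x$, closing the neck loop (the first crossing, counted as the topmost crossing of the straight strand). $C$ is the region inside the neck loop; $L$ and $R$ are the regions outside it to the left and right of the straight strand (the active strand never passes above the neck loop). Each further move carries the active strand from its current region to the named region, crossing the passive strand exactly once: across the straight strand between $L$ and $R$, across the left side of the neck loop between $L$ and $C$, across the right side between $R$ and $C$. An in-move means the active strand crosses over, an out-move that it crosses under. Successive crossings on the straight strand are placed lower and lower, and successive crossings on each side of the neck loop are placed higher and higher (farther from the first crossing), so that these moves create no self-crossing of the active strand. Tuck: if the sequence ends with $R_oL_iC_oT$, let $\ell$ be the arc of the active strand in region $R$ between the crossings of the final $R_o$ and final $L_i$. After $C_o$ the active strand leaves $C$ passing over the right side of the neck loop, above all earlier crossings there (crossing $t_1$, an $R_i$ move), then crosses $\ell$ over (crossing $t_2$) and then under (crossing $t_3$), where $t_2$ precedes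 $t_3$ along $\ell$ from $R_o$ to $L_i$, and then runs to $b$ with no further crossings. If the sequence ends with $L_oR_iC_oT$, interchange $L$ and $R$ in this description (so $t_1$ is an $L_i$ move). The resulting closed curve with crossing information is the tie diagram of the sequence. A tie knot is a knot in $\mathbb{R}^3$ equivalent (ambient isotopic) to the one given by the tie diagram of some tie sequence. *)

theory Defs
  imports "HOL-Analysis.Analysis" "HOL-Library.Sublist"
begin

section \<open>Knots in three-dimensional space\<close>

definition knot :: "(real^3) set \<Rightarrow> bool" where
  "knot K \<longleftrightarrow> K homeomorphic sphere (0 :: real^2) 1"

definition ambient_isotopic :: "(real^3) set \<Rightarrow> (real^3) set \<Rightarrow> bool" where
  "ambient_isotopic K K' \<longleftrightarrow>
     (\<exists>H :: real \<times> (real^3) \<Rightarrow> real^3.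
        continuous_on ({0..1} \<times> UNIV) H \<and>
        (\<forall>x. H (0, x) = x) \<and>
        (\<forall>t\<in>{0..1}. \<exists>g. homeomorphism UNIV UNIV (\<lambda>x. H (t, x)) g) \<and>
        (\<lambda>x. H (1, x)) ` K = K')"

section \<open>Knot diagrams\<close>

text \<open>
  A diagram is presented by the cyclic vertex list of a closed polygon in space. Its plane
  curve is the projection along the third axis, the third coordinate tells which strand is on
  top at a crossing, and the knot given by the diagram is the polygon itself.
\<close>

definition curve :: "(real^3) list \<Rightarrow> real \<Rightarrow> real^3" where
  "curve vs s =
     (1 - frac s) *\<^sub>R vs ! nat \<lfloor>s\<rfloor> + frac s *\<^sub>R vs ! (Suc (nat \<lfloor>s\<rfloor>) mod length vs)"

abbreviation params :: "(real^3) list \<Rightarrow> real set" where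
  "params vs \<equiv> {0..<real (length vs)}"

definition knot_of :: "(real^3) list \<Rightarrow> (real^3) set" where
  "knot_of vs = curve vs ` params vs"

definition shadow :: "real^3 \<Rightarrow> real \<times> real" where
  "shadow v = (v $ 1, v $ 2)"

definition meets :: "(real^3) list \<Rightarrow> real \<Rightarrow> real \<Rightarrow> bool" where
  "meets vs s t \<longleftrightarrow>
     s \<in> params vs \<and> t \<in> params vs \<and> s \<noteq> t \<and> shadow (curve vs s) = shadow (curve vs t)"

definition crossing_params :: "(real^3) list \<Rightarrow> real set" where
  "crossing_params vs = {s. \<exists>t. meets vs s t}"

text \<open>
  The last three conditions say that the projection is regular: the only multiple points are
  finitely many double points, none of them at a vertex. Two edges that meet in
  finitely many points, all interior to both, are not parallel, so the double points are
  transversal.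
\<close>

definition knot_diagram :: "(real^3) list \<Rightarrow> bool" where
  "knot_diagram vs \<longleftrightarrow>
     length vs \<ge> 3 \<and>
     inj_on (curve vs) (params vs) \<and>
     finite (crossing_params vs) \<and>
     (\<forall>s t u. meets vs s t \<and> meets vs s u \<longrightarrow> t = u) \<and>
     (\<forall>s\<in>crossing_params vs. s \<notin> \<int>)"

definition over :: "(real^3) list \<Rightarrow> real \<Rightarrow> bool" where
  "over vs s \<longleftrightarrow> (\<exists>t. meets vs s t \<and> curve vs t $ 3 < curve vs s $ 3)"

text \<open>
  Crossing parameters \<open>s < t\<close> are neighbours along the closed curve if no other one lies
  strictly between them or, across the base point, if all of them lie between them.
\<close>

definition alternating_diagram :: "(real^3) list \<Rightarrow> bool" where
  "alternating_diagram vs \<longleftrightarrow>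
     knot_diagram vs \<and>
     (\<forall>s\<in>crossing_params vs. \<forall>t\<in>crossing_params vs.
        s < t \<and> (crossing_params vs \<inter> {s<..<t} = {} \<or> crossing_params vs \<subseteq> {s..t})
        \<longrightarrow> over vs s \<noteq> over vs t)"

definition alternating_knot :: "(real^3) set \<Rightarrow> bool" where
  "alternating_knot K \<longleftrightarrow>
     knot K \<and> (\<exists>vs. alternating_diagram vs \<and> ambient_isotopic K (knot_of vs))"

section \<open>Tie sequences\<close>

datatype region = Left | Right | Center

datatype direction = In | Out

type_synonym tie_move = "region \<times> direction"

text \<open>The list holds the moves only; the final tuck symbol is left implicit.\<close>

definition tie_sequence :: "tie_move list \<Rightarrow> bool" where
  "tie_sequence ms \<longleftrightarrow>
     (\<exists>d ms'. ms = (Left, d) # ms') \<and>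
     successively (\<lambda>m m'. fst m \<noteq> fst m' \<and> snd m \<noteq> snd m') ms \<and>
     (suffix [(Left, Out), (Right, In), (Center, Out)] ms \<or>
      suffix [(Right, Out), (Left, In), (Center, Out)] ms)"

section \<open>Tie diagrams\<close>

text \<open>
  With \<open>n\<close> moves, the passive strand is the polygon at height \<open>0\<close> from \<open>b = (0, -2n)\<close> along
  the straight strand to \<open>(0, 0)\<close>, and around the neck loop with sides on \<open>x = -1\<close> (left)
  and \<open>x = 1\<close> (right), to \<open>a = (1, -2)\<close>. The topmost crossing of the straight strand
  is \<open>(0, -2)\<close>.

  The \<open>k\<close>-th crossing of the active strand (\<open>1 \<le> k \<le> n\<close>, and \<open>k = n + 1\<close> for the first
  crossing of the tuck) is on a horizontal edge at level \<open>-2k\<close> if it is on the straight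
  strand, and at level \<open>2k\<close> if it is on a side of the neck loop. The height of this edge is
  \<open>1\<close> for an in-move and \<open>-1\<close> for an out-move (the first edge starts at \<open>a\<close> at height \<open>0\<close>).
  Between the crossings \<open>k\<close> and \<open>k + 1\<close> the active strand has one vertical edge, in
  column \<open>-(k+3)\<close>, \<open>k + 3\<close> or \<open>0\<close> of its current region; in each region a later arc either
  encloses an earlier one or avoids its levels, so they do not meet.
\<close>

definition point :: "real \<Rightarrow> real \<Rightarrow> real \<Rightarrow> real^3" where
  "point x y z = vector [x, y, z]"

text \<open>The region that the active strand enters by the first crossing of the tuck.\<close>

definition tuck_region :: "tie_move list \<Rightarrow> region" where
  "tuck_region ms = fst (ms ! (length ms - 3))"

text \<open>The region of the active strand after \<open>k\<close> crossings; it starts at \<open>a\<close>, right of the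
  straight strand.\<close>

definition region_after :: "tie_move list \<Rightarrow> nat \<Rightarrow> region" where
  "region_after ms k = (Right # map fst ms @ [tuck_region ms]) ! k"

definition column :: "tie_move list \<Rightarrow> nat \<Rightarrow> real" where
  "column ms k = (case region_after ms k of
     Left \<Rightarrow> - (real k + 3) | Right \<Rightarrow> real k + 3 | Center \<Rightarrow> 0)"

definition level :: "tie_move list \<Rightarrow> nat \<Rightarrow> real" where
  "level ms k =
     (if Center \<in> {region_after ms (k - 1), region_after ms k} then 2 * real k else - 2 * real k)"

definition height :: "tie_move list \<Rightarrow> nat \<Rightarrow> real" where
  "height ms k = (case (map snd ms @ [In]) ! (k - 1) of In \<Rightarrow> 1 | Out \<Rightarrow> - 1)"

definition passive_strand :: "tie_move list \<Rightarrow> (real^3) list" where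
  "passive_strand ms = (let n = real (length ms) in
     [point 0 (- 2 * n) 0, point 0 0 0, point (- 1) 0 0,
      point (- 1) (2 * n + 4) 0, point 1 (2 * n + 4) 0, point 1 (- 2) 0])"

definition active_strand :: "tie_move list \<Rightarrow> (real^3) list" where
  "active_strand ms = concat (map (\<lambda>k.
     [point (column ms k) (level ms k) (height ms k),
      point (column ms k) (level ms (Suc k)) (height ms (Suc k))]) [1..<Suc (length ms)])"

text \<open>
  The arc crossed twice by the tuck runs down the column of index \<open>n - 2\<close>, at distance
  \<open>n + 1\<close> from the straight strand, to the level \<open>-(2n-2)\<close>, and then at height at most \<open>1\<close>
  along this level to the straight strand. The tuck passes over its vertical part at level
  \<open>-(2n-3)\<close> and height \<open>2\<close>, and under its horizontal part in column \<open>2\<close> or \<open>-2\<close> at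
  height \<open>0\<close>, and then closes up to \<open>b\<close>.
\<close>

definition tuck_strand :: "tie_move list \<Rightarrow> (real^3) list" where
  "tuck_strand ms = (let n = real (length ms); e = (if tuck_region ms = Left then - 1 else 1) in
     [point (e * (n + 4)) (2 * n + 2) 1,
      point (e * (n + 4)) (- (2 * n - 3)) 2,
      point (e * 3) (- (2 * n - 3)) 2,
      point (e * 2) (- (2 * n - 3)) 0,
      point (e * 2) (- 2 * n) 0])"

definition tie_diagram :: "tie_move list \<Rightarrow> (real^3) list" where
  "tie_diagram ms = passive_strand ms @ active_strand ms @ tuck_strand ms"

definition tie_knot :: "(real^3) set \<Rightarrow> bool" where
  "tie_knot K \<longleftrightarrow>
     knot K \<and> (\<exists>ms. tie_sequence ms \<and> ambient_isotopic K (knot_of (tie_diagram ms)))"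

end

theory Submission
  imports Defs
begin

text \<open>
  The letters of a tie sequence form a walk on the triangle \<open>L, R, C\<close>. Without the tuck, along
  each of the three strands of the passive part, and where these strands meet each other or the
  active strand, the number of moves between consecutive crossings is forced by the walk
  to be odd. Since directions alternate, a tie diagram that is closed up right after
  a move into \<open>L\<close> or \<open>R\<close>, by an arc to \<open>b\<close> that crosses nothing, is alternating.

  The tuck is undone by Reidemeister moves. The tail from the crossing \<open>t\<^sub>3\<close> over \<open>b\<close> to the crossing
  of the last \<open>L\<close> or \<open>R\<close> move passes under \<open>\<ell>\<close> twice. After that bigon is removed, the active
  strand between its crossings \<open>n - 3\<close> and \<open>n\<close> lies under everything it meets. If the move \<open>n - 2\<close> comes
  from the side opposite to the tuck, this arc can be pulled straight to the crossing \<open>n\<close>, and the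
  sequence ends with the moves \<open>n - 3\<close>, \<open>n\<close> and \<open>t\<^sub>1\<close>. If it comes from the center, the arc can be
  retracted into the center; then the strand after crossing \<open>n - 4\<close> lies over everything and can
  be pulled out of the loop, so that the sequence ends with the move \<open>n - 4\<close>. The remaining case \<open>n = 3\<close>
  gives the unknot.

  Each of these isotopies is a composition of moves that change a single coordinate of some
  vertices of a polygon. Such a move extends to space when no two points of the polygon on a
  common line parallel to the coordinate axis change their order.
\<close>

section \<open>Ambient isotopies along a coordinate axis\<close>

text \<open>The bigon can be removed because crossing \<open>n - 1\<close> is the lowest one on the
  straight strand, so between t3 and this crossing the tail through b meets nothing. What remains of
  the arc has the crossings \<open>n - 2\<close> and \<open>n\<close>, both out-moves, and t2, where
  the tuck is on top; so it lies under everything. Directions still alternate in the shortened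
  sequences: \<open>n - 3\<close>, \<open>n\<close>, t1 are in, out, in, and a sequence cut after
  \<open>n - 4\<close> only loses its end. The obstacle is that \<open>ambient_isotopic\<close> asks
  for homeomorphisms of all of space at every time. A change of one coordinate that keeps the order
  on each line parallel to its axis extends to a function increasing on all these lines, and linear
  interpolation between the identity and this function passes through homeomorphisms only. To verify
  the order, edges are replaced by their bounding boxes and the whole early part of the active
  strand by a single box. Each move is then a matter of linear arithmetic in the real parameter
  \<open>n\<close>, however long the sequence is.\<close>

lemma ambient_isotopic_trans:
  assumes "ambient_isotopic K K'" "ambient_isotopic K' K''"
  shows "ambient_isotopic K K''"
proof -
  obtain H1 :: "real \<times> (real^3) \<Rightarrow> real^3" where H1: "continuous_on ({0..1} \<times> UNIV) H1" "\<And>x. H1 (0, x) = x"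
    "\<And>t. t \<in> {0..1} \<Longrightarrow> \<exists>g. homeomorphism UNIV UNIV (\<lambda>x. H1 (t, x)) g"
    "(\<lambda>x. H1 (1, x)) ` K = K'"
    using assms(1) unfolding ambient_isotopic_def by blast
  obtain H2 :: "real \<times> (real^3) \<Rightarrow> real^3" where H2: "continuous_on ({0..1} \<times> UNIV) H2" "\<And>x. H2 (0, x) = x"
    "\<And>t. t \<in> {0..1} \<Longrightarrow> \<exists>g. homeomorphism UNIV UNIV (\<lambda>x. H2 (t, x)) g"
    "(\<lambda>x. H2 (1, x)) ` K' = K''"
    using assms(2) unfolding ambient_isotopic_def by blast
  define H where "H = (\<lambda>z :: real \<times> (real^3).
    if fst z \<le> 1/2 then H1 (2 * fst z, snd z) else H2 (2 * fst z - 1, H1 (1, snd z)))"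
  have U: "{0..1 :: real} \<times> UNIV = {0..1/2} \<times> (UNIV :: (real^3) set) \<union> {1/2..1} \<times> UNIV"
    by (auto simp: field_simps)
  have closed: "closed ({0..1/2 :: real} \<times> (UNIV :: (real^3) set))" "closed ({1/2..1 :: real} \<times> (UNIV :: (real^3) set))"
    by (auto intro: closed_Times)
  have "continuous_on ({0..1} \<times> UNIV) H"
    unfolding H_def U
  proof (rule continuous_on_cases[OF closed])
    show "continuous_on ({0..1/2} \<times> UNIV) (\<lambda>z. H1 (2 * fst z, snd z :: real^3))"
      by (rule continuous_on_compose2[OF H1(1)]) (auto intro!: continuous_intros)
    show "\<forall>z. z \<in> {0..1/2} \<times> UNIV \<and> \<not> fst z \<le> 1/2 \<or> z \<in> {1/2..1} \<times> UNIV \<and> fst z \<le> 1/2 \<longrightarrow>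
        H1 (2 * fst z, snd z) = H2 (2 * fst z - 1, H1 (1, snd z))"
    proof (intro allI impI)
      fix z :: "real \<times> (real^3)"
      assume "z \<in> {0..1/2} \<times> UNIV \<and> \<not> fst z \<le> 1/2 \<or> z \<in> {1/2..1} \<times> UNIV \<and> fst z \<le> 1/2"
      then have "fst z = 1/2"
        by (auto simp: mem_Times_iff)
      then show "H1 (2 * fst z, snd z) = H2 (2 * fst z - 1, H1 (1, snd z))"
        unfolding \<open>fst z = 1/2\<close> by (simp add: H2(2))
    qed
    have c: "continuous_on UNIV (\<lambda>x. H1 (1, x))"
      by (rule continuous_on_compose2[OF H1(1)]) (auto intro!: continuous_intros)
    have c': "continuous_on A (\<lambda>z :: real \<times> (real^3). H1 (1, snd z))" for A
      by (rule continuous_on_compose2[OF c]) (auto intro!: continuous_intros)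
    show "continuous_on ({1/2..1} \<times> UNIV) (\<lambda>z. H2 (2 * fst z - 1, H1 (1, snd z :: real^3)))"
      by (rule continuous_on_compose2[OF H2(1)])
        (intro continuous_intros c', auto)
  qed
  moreover have "\<forall>x. H (0, x) = x"
    by (simp add: H_def H1(2))
  moreover have "\<exists>g. homeomorphism UNIV UNIV (\<lambda>x. H (t, x)) g" if t: "t \<in> {0..1}" for t
  proof (cases "t \<le> 1/2")
    case True
    then show ?thesis
      using H1(3)[of "2 * t"] t by (simp add: H_def)
  next
    case False
    obtain g1 where g1: "homeomorphism UNIV UNIV (\<lambda>x. H1 (1, x)) g1"
      using H1(3)[of 1] by auto
    obtain g2 where g2: "homeomorphism UNIV UNIV (\<lambda>x. H2 (2 * t - 1, x)) g2"
      using H2(3)[of "2 * t - 1"] False t by auto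
    show ?thesis
      using homeomorphism_compose[OF g1 g2] False by (auto simp: H_def o_def)
  qed
  moreover have "(\<lambda>x. H (1, x)) ` K = K''"
    using H1(4) H2(4) by (force simp: H_def)
  ultimately show ?thesis
    unfolding ambient_isotopic_def by blast
qed

text \<open>Conjugating an isotopy by the involution gives the other one. With a reflection for
  \<open>r\<close>, tucks to the left and to the right need one set of coordinates.\<close>

lemma ambient_isotopic_involution:
  fixes r :: "real^3 \<Rightarrow> real^3"
  assumes "linear r" "\<And>x. r (r x) = x" "ambient_isotopic (r ` K) (r ` K')"
  shows "ambient_isotopic K K'"
proof -
  obtain H :: "real \<times> (real^3) \<Rightarrow> real^3" where H: "continuous_on ({0..1} \<times> UNIV) H" "\<And>x. H (0, x) = x"
    "\<And>t. t \<in> {0..1} \<Longrightarrow> \<exists>g. homeomorphism UNIV UNIV (\<lambda>x. H (t, x)) g"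
    "(\<lambda>x. H (1, x)) ` (r ` K) = r ` K'"
    using assms(3) unfolding ambient_isotopic_def by blast
  have c: "continuous_on S r" for S
    using assms(1) by (simp add: linear_continuous_on linear_conv_bounded_linear)
  have "homeomorphism UNIV UNIV r r"
    using assms(2) c by (auto simp: homeomorphism_def image_def) metis+
  define H' where "H' = (\<lambda>z. r (H (fst z, r (snd z))))"
  have "continuous_on ({0..1} \<times> UNIV) H'"
    unfolding H'_def
    by (rule continuous_on_compose2[OF c[of UNIV]], rule continuous_on_compose2[OF H(1)])
      (auto intro!: continuous_intros continuous_on_compose2[OF c[of UNIV]])
  moreover have "\<forall>x. H' (0, x) = x"
    by (simp add: H'_def H(2) assms(2))
  moreover have "\<exists>g. homeomorphism UNIV UNIV (\<lambda>x. H' (t, x)) g" if t: "t \<in> {0..1}" for t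
  proof -
    obtain g where g: "homeomorphism UNIV UNIV (\<lambda>x. H (t, x)) g"
      using H(3)[OF t] by blast
    show ?thesis
      using homeomorphism_compose[OF homeomorphism_compose[OF \<open>homeomorphism UNIV UNIV r r\<close> g]
          \<open>homeomorphism UNIV UNIV r r\<close>]
      by (auto simp: H'_def o_def)
  qed
  moreover have "(\<lambda>x. H' (1, x)) ` K = K'"
  proof -
    have "(\<lambda>x. H' (1, x)) ` K = r ` ((\<lambda>x. H (1, x)) ` (r ` K))"
      by (auto simp: H'_def)
    also have "\<dots> = r ` (r ` K')"
      using H(4) by simp
    also have "\<dots> = K'"
      by (simp add: image_image assms(2))
    finally show ?thesis .
  qed
  ultimately show ?thesis
    unfolding ambient_isotopic_def by blast
qed

text \<open>Growth at a rate of at least \<open>\<mu>\<close> along every line in direction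
  \<open>j\<close>, which \<open>F\<close> maps into itself, makes \<open>F\<close> injective there
  and, by the intermediate value theorem, onto. Continuity of the inverse comes from invariance of
  domain.\<close>

lemma line_homeomorphism:
  fixes F :: "real^3 \<Rightarrow> real^3"
  assumes F: "continuous_on UNIV F" "\<And>x i. i \<noteq> j \<Longrightarrow> F x $ i = x $ i"
    and \<mu>: "\<mu> > 0"
    and mono: "\<And>x y. (\<And>i. i \<noteq> j \<Longrightarrow> x $ i = y $ i) \<Longrightarrow> x $ j \<le> y $ j \<Longrightarrow>
      \<mu> * (y $ j - x $ j) \<le> F y $ j - F x $ j"
  shows "\<exists>g. homeomorphism UNIV UNIV F g"
proof -
  have "inj F"
  proof (rule injI)
    fix x y assume eq: "F x = F y"
    then have other: "\<And>i. i \<noteq> j \<Longrightarrow> x $ i = y $ i"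
      using F(2) by metis
    have "\<mu> * (y $ j - x $ j) \<le> 0" if "x $ j \<le> y $ j"
      using mono[OF other that] eq by simp
    moreover have "\<mu> * (x $ j - y $ j) \<le> 0" if "y $ j \<le> x $ j"
      using mono[of y x] other that eq by simp
    ultimately have "x $ j = y $ j"
      using \<mu> by (cases "x $ j \<le> y $ j") (auto simp: mult_le_0_iff)
    with other show "x = y"
      by (metis vec_eq_iff)
  qed
  have "range F = UNIV"
  proof safe
    fix y :: "real^3"
    define l where "l = (\<lambda>r :: real. \<chi> i. if i = j then r else y $ i)"
    have l: "l r $ j = r" "i \<noteq> j \<Longrightarrow> l r $ i = y $ i" for r i
      by (simp_all add: l_def)
    have "continuous_on UNIV l"
      unfolding l_def
    proof (rule continuous_on_vec_lambda)
      show "continuous_on UNIV (\<lambda>r. if i = j then r else y $ i)" for i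
        by (cases "i = j") auto
    qed
    then have "continuous_on UNIV (\<lambda>r. F (l r))"
      using continuous_on_compose2[OF F(1)] by auto
    then have c: "continuous_on A (\<lambda>r. F (l r) $ j)" for A
      by (intro continuous_intros) (auto intro: continuous_on_subset)
    \<comment> \<open>Growth at rate \<mu> over the length \<open>R\<close> outweighs both
      \<open>F (l 0) $ j\<close> and the target \<open>y $ j\<close>, on either side of
      \<open>0\<close>.\<close>
    define R where "R = (\<bar>y $ j\<bar> + \<bar>F (l 0) $ j\<bar>) / \<mu>"
    have R: "R \<ge> 0" "\<mu> * R = \<bar>y $ j\<bar> + \<bar>F (l 0) $ j\<bar>"
      using \<mu> by (auto simp: R_def)
    have "\<mu> * R \<le> F (l R) $ j - F (l 0) $ j" "\<mu> * R \<le> F (l 0) $ j - F (l (-R)) $ j"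
      using mono[of "l 0" "l R"] mono[of "l (-R)" "l 0"] R(1) l by auto
    then have "F (l (-R)) $ j \<le> y $ j" "y $ j \<le> F (l R) $ j"
      using R(2) by auto
    then obtain r where "F (l r) $ j = y $ j"
      using IVT'[of "\<lambda>r. F (l r) $ j" "-R" "y $ j" R] R(1) c by auto
    then have "F (l r) = y"
      using F(2) l by (metis vec_eq_iff)
    then show "y \<in> range F"
      by blast
  qed auto
  then show ?thesis
    by (metis F(1) \<open>inj F\<close> invariance_of_domain_homeomorphism open_UNIV order_refl)
qed

text \<open>The extension is the one of McShane for Lipschitz functions. The asymmetric gauge \<open>q\<close>
  bounds increments from above, and by a negative number for decrements of the \<open>j\<close>-th
  coordinate, so that the extension increases along the lines in direction \<open>j\<close>.\<close>

lemma shear_extension: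
  fixes G :: "((real^3) \<times> (real^3)) set"
  assumes "G \<noteq> {}"
    and other: "\<And>p p' i. (p, p') \<in> G \<Longrightarrow> i \<noteq> j \<Longrightarrow> p' $ i = p $ i"
    and N: "N \<ge> 1"
    and bound: "\<And>p p' r r'. (p, p') \<in> G \<Longrightarrow> (r, r') \<in> G \<Longrightarrow>
      r' $ j - p' $ j \<le> N * (\<Sum>i\<in>-{j}. \<bar>r $ i - p $ i\<bar>) + max (N * (r $ j - p $ j)) ((r $ j - p $ j) / N)"
  shows "ambient_isotopic (fst ` G) (snd ` G)"
proof -
  define q where "q = (\<lambda>d :: real^3. N * (\<Sum>i\<in>-{j}. \<bar>d $ i\<bar>) + max (N * d $ j) (d $ j / N))"
  have q_add: "q (d + e) \<le> q d + q e" for d e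
  proof -
    have "(\<Sum>i\<in>-{j}. \<bar>(d + e) $ i\<bar>) \<le> (\<Sum>i\<in>-{j}. \<bar>d $ i\<bar> + \<bar>e $ i\<bar>)"
      by (intro sum_mono) (auto simp: abs_triangle_ineq)
    also have "\<dots> = (\<Sum>i\<in>-{j}. \<bar>d $ i\<bar>) + (\<Sum>i\<in>-{j}. \<bar>e $ i\<bar>)"
      by (rule sum.distrib)
    finally have "N * (\<Sum>i\<in>-{j}. \<bar>(d + e) $ i\<bar>)
        \<le> N * ((\<Sum>i\<in>-{j}. \<bar>d $ i\<bar>) + (\<Sum>i\<in>-{j}. \<bar>e $ i\<bar>))"
      using N by (intro mult_left_mono) auto
    then show ?thesis
      by (simp add: q_def distrib_left add_divide_distrib)
  qed
  have q0: "q 0 = 0"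
    by (simp add: q_def)
  have bd: "r' $ j - p' $ j \<le> q (r - p)" if "(p, p') \<in> G" "(r, r') \<in> G" for p p' r r'
    using bound[OF that] by (simp add: q_def)
  \<comment> \<open>The infimum takes the prescribed values because, by \<open>bd\<close>, the bound
    coming from one pair of \<open>G\<close> never undercuts the value prescribed by
    another.\<close>
  define \<Phi> where "\<Phi> = (\<lambda>x. INF z\<in>G. snd z $ j + q (x - fst z))"
  have bdd: "bdd_below ((\<lambda>z. snd z $ j + q (x - fst z)) ` G)" for x
  proof -
    obtain k k' where k: "(k, k') \<in> G"
      using assms(1) by auto
    have "k' $ j - q (k - x) \<le> snd z $ j + q (x - fst z)" if "z \<in> G" for z
      using bd[of "fst z" "snd z" k k'] k that q_add[of "k - x" "x - fst z"] by auto
    then show ?thesis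
      by (auto intro!: bdd_belowI)
  qed
  have \<Phi>_G: "\<Phi> p = p' $ j" if "(p, p') \<in> G" for p p'
  proof (rule antisym)
    show "\<Phi> p \<le> p' $ j"
      unfolding \<Phi>_def using that q0 by (intro cINF_lower2[OF bdd, of "(p, p')"]) auto
    show "p' $ j \<le> \<Phi> p"
      unfolding \<Phi>_def using that bd assms(1) by (intro cINF_greatest) (force simp: algebra_simps)+
  qed
  have \<Phi>_q: "\<Phi> y \<le> \<Phi> x + q (y - x)" for x y
  proof -
    have "\<Phi> y - q (y - x) \<le> snd z $ j + q (x - fst z)" if "z \<in> G" for z
    proof -
      have "\<Phi> y \<le> snd z $ j + q (y - fst z)"
        unfolding \<Phi>_def using that by (intro cINF_lower bdd)
      then show ?thesis
        using q_add[of "y - x" "x - fst z"] by simp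
    qed
    then have "\<Phi> y - q (y - x) \<le> \<Phi> x"
      using assms(1) by (subst (2) \<Phi>_def) (intro cINF_greatest, auto)
    then show ?thesis
      by simp
  qed
  define C where "C = N * real (card (-{j})) + N + 1 / N"
  have q_norm: "q d \<le> C * norm d" for d
  proof -
    have "N * (\<Sum>i\<in>-{j}. \<bar>d $ i\<bar>) \<le> N * (\<Sum>i\<in>-{j}. norm d)"
      using N by (intro mult_left_mono sum_mono component_le_norm_cart) auto
    moreover have "N * d $ j \<le> N * norm d" "d $ j / N \<le> 1 / N * norm d"
      using N component_le_norm_cart[of d j] by (auto intro: divide_right_mono)
    moreover have "0 \<le> N * norm d" "0 \<le> 1 / N * norm d"
      using N by auto
    ultimately show ?thesis
      unfolding q_def C_def by (simp add: algebra_simps)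
  qed
  have "C \<ge> 0"
    using N by (simp add: C_def)
  have "dist (\<Phi> x) (\<Phi> y) \<le> C * dist x y" for x y
    using \<Phi>_q[of x y] \<Phi>_q[of y x] q_norm[of "x - y"] q_norm[of "y - x"]
    by (auto simp: dist_norm norm_minus_commute abs_le_iff)
  then have "C-lipschitz_on UNIV \<Phi>"
    using \<open>C \<ge> 0\<close> by (auto intro: lipschitz_onI)
  then have cont: "continuous_on A \<Phi>" for A
    using lipschitz_on_continuous_on continuous_on_subset by blast
  have \<Phi>_mono: "(y $ j - x $ j) / N \<le> \<Phi> y - \<Phi> x"
    if "\<And>i. i \<noteq> j \<Longrightarrow> x $ i = y $ i" "x $ j \<le> y $ j" for x y
  proof -
    \<comment> \<open>On a decrement the flatter branch of the maximum in \<open>q\<close> wins, and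
      it is negative. This yields the lower slope \<open>1 / N\<close> of \<open>\<Phi>\<close>
      along the lines.\<close>
    have "N * (x $ j - y $ j) \<le> (x $ j - y $ j) / N"
    proof -
      have "(y $ j - x $ j) / N \<le> (y $ j - x $ j)"
        using N that(2) by (simp add: divide_le_eq mult_right_le_one_le mult_le_cancel_left1)
      also have "\<dots> \<le> N * (y $ j - x $ j)"
        using N that(2) by (simp add: mult_le_cancel_right1)
      finally show ?thesis
        by (simp add: algebra_simps diff_divide_distrib)
    qed
    then have "q (x - y) = (x $ j - y $ j) / N"
      using that(1) by (simp add: q_def)
    then show ?thesis
      using \<Phi>_q[of x y] by (simp add: diff_divide_distrib)
  qed
  \<comment> \<open>The identity and \<open>\<Phi>\<close> both have slope at least
    \<open>1 / N\<close> in direction \<open>j\<close>, hence so has each of their convex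
    combinations, and \<open>line_homeomorphism\<close> applies at every time.\<close>
  define H where "H = (\<lambda>z :: real \<times> (real^3). \<chi> i. if i = j then (1 - fst z) * snd z $ j + fst z * \<Phi> (snd z) else snd z $ i)"
  have cH: "continuous_on A H" for A
    unfolding H_def
  proof (rule continuous_on_vec_lambda)
    fix i
    show "continuous_on A (\<lambda>z :: real \<times> (real^3). if i = j then (1 - fst z) * snd z $ j + fst z * \<Phi> (snd z) else snd z $ i)"
      by (cases "i = j") (auto intro!: continuous_intros continuous_on_compose2[OF cont[of UNIV]])
  qed
  moreover have "\<forall>x. H (0, x) = x"
    by (simp add: H_def vec_eq_iff)
  moreover have "\<exists>g. homeomorphism UNIV UNIV (\<lambda>x. H (t, x)) g" if t: "t \<in> {0..1}" for t
  proof (rule line_homeomorphism[where j = j and \<mu> = "1 / N"])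
    show "continuous_on UNIV (\<lambda>x. H (t, x))"
      by (rule continuous_on_compose2[OF cH[of UNIV]]) (auto intro!: continuous_intros)
    fix x y :: "real^3"
    assume xy: "\<And>i. i \<noteq> j \<Longrightarrow> x $ i = y $ i" "x $ j \<le> y $ j"
    have "(y $ j - x $ j) / N \<le> y $ j - x $ j"
      using N xy(2) by (simp add: divide_le_eq mult_le_cancel_left1)
    then have "(1 - t) * ((y $ j - x $ j) / N) + t * ((y $ j - x $ j) / N)
        \<le> (1 - t) * (y $ j - x $ j) + t * (\<Phi> y - \<Phi> x)"
      using t \<Phi>_mono[OF xy] by (intro add_mono mult_left_mono) auto
    then have "(y $ j - x $ j) / N \<le> (1 - t) * (y $ j - x $ j) + t * (\<Phi> y - \<Phi> x)"
      by (simp only: distrib_right[symmetric]) simp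
    then show "1 / N * (y $ j - x $ j) \<le> H (t, y) $ j - H (t, x) $ j"
      by (simp add: H_def algebra_simps add_divide_distrib diff_divide_distrib)
  qed (use N in \<open>auto simp: H_def\<close>)
  moreover have "(\<lambda>x. H (1, x)) ` (fst ` G) = snd ` G"
  proof -
    have "H (1, p) = p'" if "(p, p') \<in> G" for p p'
      using \<Phi>_G[OF that] other[OF that] by (auto simp: H_def vec_eq_iff)
    then show ?thesis
      by (force simp: image_image)
  qed
  ultimately show ?thesis
    unfolding ambient_isotopic_def by blast
qed

section \<open>Piecewise linear moves: the order condition implies the Lipschitz condition\<close>

lemma linear_functional_inner:
  fixes f :: "'a::euclidean_space \<Rightarrow> real"
  assumes "linear f"
  shows "\<exists>a. \<forall>x. f x = a \<bullet> x"
proof (intro exI allI)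
  show "f x = adjoint f 1 \<bullet> x" for x
    using adjoint_works[OF assms, of x 1] by (simp add: inner_commute)
qed

text \<open>On the cells of \<open>P\<close> where no \<open>d $ i\<close> changes sign the two sides are linear,
  so that the inequality needs to be checked at finitely many points only.\<close>

lemma polytope_increment_bound:
  fixes d :: "'a::euclidean_space \<Rightarrow> real^3" and D :: "'a \<Rightarrow> real"
  assumes P: "polytope P" and lin: "linear d" "linear D"
    and order: "\<And>x. x \<in> P \<Longrightarrow> (\<And>i. i \<noteq> j \<Longrightarrow> d x $ i = 0) \<Longrightarrow>
      (d x $ j < 0 \<longrightarrow> D x < 0) \<and> (d x $ j = 0 \<longrightarrow> D x = 0)"
  shows "\<forall>\<^sub>F N in at_top. \<forall>x\<in>P.
    D x \<le> N * (\<Sum>i\<in>-{j}. \<bar>d x $ i\<bar>) + max (N * d x $ j) (d x $ j / N)"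
proof -
  define \<Psi> where "\<Psi> = (\<lambda>N x. N * (\<Sum>i\<in>-{j}. \<bar>d x $ i\<bar>) + max (N * d x $ j) (d x $ j / N))"
  define c where "c = (\<lambda>\<sigma> :: 3 \<Rightarrow> bool. \<lambda>i. if \<sigma> i then 1 else -1 :: real)"
  have ind: "linear (\<lambda>x. d x $ i)" for i
    using linear_compose[OF lin(1), of "\<lambda>v. v $ i"] by (simp add: o_def linear_iff)
  \<comment> \<open>At a single point a large \<open>N\<close> suffices: either another coordinate
    of \<open>d v\<close> is nonzero and the sum dominates, or \<open>order\<close> gives the signs
    and \<open>N\<close> only has to exceed a quotient of \<open>D v\<close> and
    \<open>d v $ j\<close> or its inverse.\<close>
  have vertex: "\<forall>\<^sub>F N in at_top. D v \<le> \<Psi> N v" if v: "v \<in> P" for v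
  proof -
    define S where "S = (\<Sum>i\<in>-{j}. \<bar>d v $ i\<bar>)"
    have "S \<ge> 0"
      by (auto simp: S_def sum_nonneg)
    show ?thesis
    proof (cases "S = 0")
      case False
      with \<open>S \<ge> 0\<close> have "S > 0" by simp
      show ?thesis
        using eventually_ge_at_top[of "max 1 ((\<bar>D v\<bar> + \<bar>d v $ j\<bar>) / S)"]
      proof eventually_elim
        case (elim N)
        then have N: "N \<ge> 1" "\<bar>D v\<bar> + \<bar>d v $ j\<bar> \<le> N * S"
          using \<open>S > 0\<close> by (auto simp: field_simps)
        have "\<bar>d v $ j / N\<bar> \<le> \<bar>d v $ j\<bar>"
          using N by (simp add: abs_div divide_le_eq mult_le_cancel_left1)
        then show ?case
          using N(2) unfolding \<Psi>_def S_def by linarith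
      qed
    next
      case True
      then have "d v $ i = 0" if "i \<noteq> j" for i
        using that by (auto simp: S_def sum_nonneg_eq_0_iff)
      then have o: "(d v $ j < 0 \<longrightarrow> D v < 0) \<and> (d v $ j = 0 \<longrightarrow> D v = 0)"
        using order[OF v] by blast
      have \<Psi>: "\<Psi> N v = max (N * d v $ j) (d v $ j / N)" for N
        using True by (simp add: \<Psi>_def S_def)
      show ?thesis
        using eventually_ge_at_top[of "max 1 (max (D v / d v $ j) (d v $ j / D v))"]
      proof eventually_elim
        case (elim N)
        consider "d v $ j > 0" | "d v $ j = 0" | "d v $ j < 0" by linarith
        then show ?case
        proof cases
          case 1
          then have "D v \<le> N * d v $ j"
            using elim by (auto simp: field_simps)
          then show ?thesis
            by (simp add: \<Psi>)
        next
          case 2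
          then show ?thesis
            using o by (simp add: \<Psi>)
        next
          case 3
          then have "D v < 0"
            using o by simp
          then have "D v \<le> d v $ j / N"
            using elim 3 by (auto simp: field_simps)
          then show ?thesis
            by (simp add: \<Psi>)
        qed
      qed
    qed
  qed
  have cell: "\<forall>\<^sub>F N in at_top. \<forall>x\<in>P. (\<forall>i. c \<sigma> i * d x $ i \<ge> 0) \<longrightarrow> D x \<le> \<Psi> N x" for \<sigma>
  proof -
    \<comment> \<open>On this cell the absolute values and the maximum are linear. It is again a
      polytope, so the inequality at its finitely many generating points spreads to their convex
      hull.\<close>
    define Q where "Q = P \<inter> (\<Inter>i. {x. c \<sigma> i * d x $ i \<ge> 0})"
    have "polyhedron {x. c \<sigma> i * d x $ i \<ge> 0}" for i
    proof -
      have "linear (\<lambda>x. c \<sigma> i * d x $ i)"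
        using linear_compose_scale_right[OF ind[of i], of "c \<sigma> i"] by simp
      then have "\<exists>a. \<forall>x. c \<sigma> i * d x $ i = a \<bullet> x"
        by (rule linear_functional_inner)
      then obtain a where a: "\<And>x. c \<sigma> i * d x $ i = a \<bullet> x"
        by blast
      then show ?thesis
        using polyhedron_halfspace_ge[of 0 a] unfolding a by simp
    qed
    then have "polyhedron (\<Inter>i. {x. c \<sigma> i * d x $ i \<ge> 0})"
      by (intro polyhedron_Inter) auto
    then have "polytope Q"
      unfolding Q_def using P by (rule polytope_Int_polyhedron[rotated])
    then obtain V where V: "finite V" "Q = convex hull V"
      unfolding polytope_def by blast
    have "V \<subseteq> Q"
      using hull_subset[of V convex] V(2) by simp
    then have "\<forall>v\<in>V. \<forall>\<^sub>F N in at_top. D v \<le> \<Psi> N v"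
      using vertex by (simp add: Q_def subset_iff)
    with V(1) have "\<forall>\<^sub>F N in at_top. \<forall>v\<in>V. D v \<le> \<Psi> N v"
      by (rule eventually_ball_finite)
    then show ?thesis
      using eventually_ge_at_top[of 1]
    proof eventually_elim
      case (elim N)
      \<comment> \<open>The slope of the branch of the maximum that is active in the cell:
        \<open>N\<close> where \<open>d x $ j\<close> is nonnegative, \<open>1 / N\<close> where it
        is nonpositive.\<close>
      define e where "e = (if \<sigma> j then N else 1 / N)"
      define L where "L = (\<lambda>x. N * (\<Sum>i\<in>-{j}. c \<sigma> i * d x $ i) + e * d x $ j - D x)"
      have L: "L x = \<Psi> N x - D x" if "x \<in> Q" for x
      proof -
        have i: "\<bar>d x $ i\<bar> = c \<sigma> i * d x $ i" for i
        proof -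
          have "c \<sigma> i * d x $ i \<ge> 0"
            using that by (simp add: Q_def)
          then show ?thesis
            by (simp add: c_def split: if_splits)
        qed
        have "N * d x $ j \<ge> d x $ j / N" if "d x $ j \<ge> 0"
        proof -
          have "d x $ j / N \<le> d x $ j" "d x $ j \<le> N * d x $ j"
            using elim(2) that by (auto simp: divide_le_eq mult_le_cancel_left1 mult_le_cancel_right1)
          then show ?thesis by simp
        qed
        moreover have "N * d x $ j \<le> d x $ j / N" if "d x $ j \<le> 0"
        proof -
          have "d x $ j / N \<ge> d x $ j" "d x $ j \<ge> N * d x $ j"
            using elim(2) that by (auto simp: le_divide_eq mult_le_cancel_left2 mult_le_cancel_right2)
          then show ?thesis by simp
        qed
        moreover have "(\<sigma> j \<longrightarrow> d x $ j \<ge> 0) \<and> (\<not> \<sigma> j \<longrightarrow> d x $ j \<le> 0)"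
          using i[of j] by (auto simp: c_def)
        ultimately show ?thesis
          by (auto simp: L_def e_def \<Psi>_def i)
      qed
      have "linear L"
        unfolding L_def using ind lin(2)
        by (auto intro!: linear_compose_sub linear_compose_add linear_compose_sum
            linear_compose_scale_right[where 'b = real, unfolded real_scaleR_def])
      then obtain a where a: "\<And>x. L x = a \<bullet> x"
        using linear_functional_inner[of L] by blast
      have "V \<subseteq> {x. a \<bullet> x \<ge> 0}"
        using elim(1) L \<open>V \<subseteq> Q\<close> a by (force simp: subset_iff)
      then have "Q \<subseteq> {x. a \<bullet> x \<ge> 0}"
        unfolding V(2) by (intro hull_minimal convex_halfspace_ge)
      then show ?case
        using L a by (force simp: Q_def)
    qed
  qed
  have "\<forall>\<^sub>F N in at_top. \<forall>\<sigma>\<in>UNIV. \<forall>x\<in>P. (\<forall>i. c \<sigma> i * d x $ i \<ge> 0) \<longrightarrow> D x \<le> \<Psi> N x"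
    by (intro eventually_ball_finite ballI cell finite_class.finite_UNIV)
  then show ?thesis
  proof eventually_elim
    case (elim N)
    show ?case
    proof
      fix x assume "x \<in> P"
      have "\<forall>i. c (\<lambda>i. d x $ i \<ge> 0) i * d x $ i \<ge> 0"
        by (auto simp: c_def)
      then show "D x \<le> N * (\<Sum>i\<in>-{j}. \<bar>d x $ i\<bar>) + max (N * d x $ j) (d x $ j / N)"
        using elim \<open>x \<in> P\<close> unfolding \<Psi>_def by blast
    qed
  qed
qed

text \<open>That the pieces are polytopes gives a constant \<open>N\<close> for each pair of pieces;
  that there are finitely many gives a common one.\<close>

definition polygonal :: "'a::euclidean_space set \<Rightarrow> bool" where
  "polygonal S \<longleftrightarrow> (\<exists>F. finite F \<and> (\<forall>P\<in>F. polytope P) \<and> S = \<Union>F)"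

lemma polygonal_Un: "polygonal S \<Longrightarrow> polygonal T \<Longrightarrow> polygonal (S \<union> T)"
  unfolding polygonal_def by (metis Union_Un_distrib Un_iff finite_UnI)

lemma polygonal_segment: "polygonal (closed_segment a b)"
  unfolding polygonal_def
  by (rule exI[of _ "{closed_segment a b}"]) (auto simp: segment_convex_hull intro: polytope_convex_hull)

lemma polygonal_linear_image:
  assumes "linear f" "polygonal S"
  shows "polygonal (f ` S)"
proof -
  obtain F where F: "finite F" "\<forall>P\<in>F. polytope P" "S = \<Union>F"
    using assms(2) unfolding polygonal_def by blast
  show ?thesis
    unfolding polygonal_def
    by (rule exI[of _ "(`) f ` F"]) (use F in \<open>auto intro: polytope_linear_image[OF assms(1)]\<close>)
qed

text \<open>\<open>G\<close> is the graph of the move. The differences of two source points and of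
  their targets are linear on each product of two pieces of \<open>G\<close>, so
  \<open>polytope_increment_bound\<close> turns the order condition into the Lipschitz condition of
  \<open>shear_extension\<close>. The reversed order is covered by exchanging the two
  points.\<close>

lemma coordinate_move:
  fixes G :: "((real^3) \<times> (real^3)) set"
  assumes G: "polygonal G" "G \<noteq> {}"
    and other: "\<And>p p' i. (p, p') \<in> G \<Longrightarrow> i \<noteq> j \<Longrightarrow> p' $ i = p $ i"
    and order: "\<And>p p' r r'. (p, p') \<in> G \<Longrightarrow> (r, r') \<in> G \<Longrightarrow> (\<And>i. i \<noteq> j \<Longrightarrow> p $ i = r $ i) \<Longrightarrow>
      (r $ j < p $ j \<longrightarrow> r' $ j < p' $ j) \<and> (r $ j = p $ j \<longrightarrow> r' $ j = p' $ j)"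
  shows "ambient_isotopic (fst ` G) (snd ` G)"
proof -
  obtain F where F: "finite F" "\<forall>P\<in>F. polytope P" "G = \<Union>F"
    using G unfolding polygonal_def by blast
  define d where "d = (\<lambda>x :: ((real^3) \<times> (real^3)) \<times> ((real^3) \<times> (real^3)). fst (snd x) - fst (fst x))"
  define D where "D = (\<lambda>x :: ((real^3) \<times> (real^3)) \<times> ((real^3) \<times> (real^3)). snd (snd x) $ j - snd (fst x) $ j)"
  have "linear d" "linear D"
    by (auto simp: d_def D_def linear_iff algebra_simps)
  have "\<forall>\<^sub>F N in at_top. \<forall>x\<in>P \<times> Q.
      D x \<le> N * (\<Sum>i\<in>-{j}. \<bar>d x $ i\<bar>) + max (N * d x $ j) (d x $ j / N)"
    if "P \<in> F" "Q \<in> F" for P Q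
  proof (rule polytope_increment_bound)
    show "polytope (P \<times> Q)"
      using F(2) that by (intro polytope_Times) auto
    fix x assume x: "x \<in> P \<times> Q" and "\<And>i. i \<noteq> j \<Longrightarrow> d x $ i = 0"
    then show "(d x $ j < 0 \<longrightarrow> D x < 0) \<and> (d x $ j = 0 \<longrightarrow> D x = 0)"
      using order[of "fst (fst x)" "snd (fst x)" "fst (snd x)" "snd (snd x)"] that F(3)
      by (auto simp: d_def D_def) blast+
  qed fact+
  then have "\<forall>\<^sub>F N in at_top. \<forall>P\<in>F. \<forall>Q\<in>F. \<forall>x\<in>P \<times> Q.
      D x \<le> N * (\<Sum>i\<in>-{j}. \<bar>d x $ i\<bar>) + max (N * d x $ j) (d x $ j / N)"
    using F(1) by (intro eventually_ball_finite[OF F(1)] ballI) blast+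
  then have "\<forall>\<^sub>F N in at_top. N \<ge> 1 \<and> (\<forall>P\<in>F. \<forall>Q\<in>F. \<forall>x\<in>P \<times> Q.
      D x \<le> N * (\<Sum>i\<in>-{j}. \<bar>d x $ i\<bar>) + max (N * d x $ j) (d x $ j / N))"
    using eventually_ge_at_top by (rule eventually_conj[rotated])
  then obtain N where N: "N \<ge> 1" "\<And>P Q x. P \<in> F \<Longrightarrow> Q \<in> F \<Longrightarrow> x \<in> P \<times> Q \<Longrightarrow>
      D x \<le> N * (\<Sum>i\<in>-{j}. \<bar>d x $ i\<bar>) + max (N * d x $ j) (d x $ j / N)"
    using eventually_happens'[OF trivial_limit_at_top_linorder] by blast
  show ?thesis
  proof (rule shear_extension[OF G(2) other N(1)])
    fix p p' r r' assume "(p, p') \<in> G" "(r, r') \<in> G"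
    then obtain P Q where "P \<in> F" "Q \<in> F" "((p, p'), (r, r')) \<in> P \<times> Q"
      using F(3) by auto
    from N(2)[OF this] show "r' $ j - p' $ j
        \<le> N * (\<Sum>i\<in>-{j}. \<bar>r $ i - p $ i\<bar>) + max (N * (r $ j - p $ j)) ((r $ j - p $ j) / N)"
      by (simp add: d_def D_def)
  qed
qed

section \<open>Polygonal lines and functionals that increase along them\<close>

fun polyline :: "'a::real_vector list \<Rightarrow> 'a set" where
  "polyline (x # y # zs) = closed_segment x y \<union> polyline (y # zs)"
| "polyline _ = {}"

lemma polygonal_polyline: "polygonal (polyline zs)"
proof (induction zs rule: polyline.induct)
  case (1 x y zs)
  then show ?case
    by (simp add: polygonal_Un polygonal_segment)
qed (auto simp: polygonal_def intro: exI[of _ "{}"])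

lemma polyline_linear_image: "linear f \<Longrightarrow> f ` polyline zs = polyline (map f zs)"
  by (induction zs rule: polyline.induct) (auto simp: image_Un closed_segment_linear_image)

lemma polyline_subset_convex: "convex C \<Longrightarrow> set zs \<subseteq> C \<Longrightarrow> polyline zs \<subseteq> C"
  by (induction zs rule: polyline.induct) (auto dest: closed_segment_subset)

lemma polyline_append:
  "polyline (xs @ y # zs) = polyline (xs @ [y]) \<union> polyline (y # zs)"
proof (induction xs)
  case (Cons x xs)
  then show ?case
    by (cases xs) auto
qed auto

lemma linear_closed_segment_less:
  fixes f :: "'a::real_vector \<Rightarrow> real"
  assumes "linear f" "z \<in> closed_segment x y" "f x < f y"
  shows "f x \<le> f z \<and> f z \<le> f y \<and> (f z = f x \<longrightarrow> z = x) \<and> (f z = f y \<longrightarrow> z = y)"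
proof -
  obtain u where u: "0 \<le> u" "u \<le> 1" "z = (1 - u) *\<^sub>R x + u *\<^sub>R y"
    using assms(2) by (auto simp: in_segment)
  have "f z = (1 - u) * f x + u * f y"
    unfolding u(3) using assms(1) by (simp add: linear_add linear_cmul)
  then have "f z = f x + u * (f y - f x)" "f z = f y - (1 - u) * (f y - f x)"
    by (simp_all add: algebra_simps)
  moreover have "u * (f y - f x) \<ge> 0" "(1 - u) * (f y - f x) \<ge> 0"
    using u assms(3) by auto
  moreover have "u = 0" if "u * (f y - f x) = 0"
    using that assms(3) by simp
  moreover have "u = 1" if "(1 - u) * (f y - f x) = 0"
    using that assms(3) by simp
  ultimately show ?thesis
    using u(3) by auto
qed

lemma polyline_monotone_start:
  fixes f :: "'a::real_vector \<Rightarrow> real"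
  assumes "linear f" "sorted_wrt (\<lambda>x y. f x < f y) (x # zs)" "z \<in> polyline (x # zs)"
  shows "f x \<le> f z \<and> (f z = f x \<longrightarrow> z = x)"
  using assms(2,3)
proof (induction zs arbitrary: x)
  case (Cons y zs)
  then have "f x < f y"
    by simp
  show ?case
  proof (cases "z \<in> closed_segment x y")
    case True
    then show ?thesis
      using linear_closed_segment_less[OF assms(1) True \<open>f x < f y\<close>] by simp
  next
    case False
    then show ?thesis
      using Cons.IH[of y] Cons.prems \<open>f x < f y\<close> by auto
  qed
qed auto

text \<open>Each segment meets a level set of \<open>f\<close> at most once, and later segments lie
  above earlier ones. In use, \<open>f\<close> ignores the coordinate that is moved, so that no line
  in that direction meets the moving arc twice.\<close>

lemma polyline_monotone_inj:
  fixes f :: "'a::real_vector \<Rightarrow> real"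
  assumes "linear f" "sorted_wrt (\<lambda>x y. f x < f y) zs"
  shows "inj_on f (polyline zs)"
  using assms(2)
proof (induction zs rule: polyline.induct)
  case (1 x y zs)
  have xy: "f x < f y"
    using 1 by simp
  have "f v = f w \<longrightarrow> v = w" if "v \<in> closed_segment x y" "w \<in> closed_segment x y" for v w
  proof -
    obtain s t where st: "v = (1 - s) *\<^sub>R x + s *\<^sub>R y" "w = (1 - t) *\<^sub>R x + t *\<^sub>R y"
      using \<open>v \<in> _\<close> \<open>w \<in> _\<close> by (auto simp: in_segment)
    have "f v = (1 - s) * f x + s * f y" "f w = (1 - t) * f x + t * f y"
      unfolding st using assms(1) by (simp_all add: linear_add linear_cmul)
    then have "f v - f w = (s - t) * (f y - f x)"
      by (simp add: algebra_simps)
    then have "s = t" if "f v = f w"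
      using xy that by simp
    then show ?thesis
      by (auto simp only: st)
  qed
  note segment = this
  have cross: "v = w" if "v \<in> closed_segment x y" "w \<in> polyline (y # zs)" "f v = f w" for v w
  proof -
    have "f y \<le> f w" "f w = f y \<longrightarrow> w = y"
      using polyline_monotone_start[OF assms(1) _ that(2)] 1(2) by auto
    then show ?thesis
      using linear_closed_segment_less[OF assms(1) that(1) xy] that(3) by auto
  qed
  have rest: "inj_on f (polyline (y # zs))"
    using 1 by simp
  show ?case
  proof (rule inj_onI)
    fix v w
    assume "v \<in> polyline (x # y # zs)" "w \<in> polyline (x # y # zs)" and eq: "f v = f w"
    then have "v \<in> closed_segment x y \<or> v \<in> polyline (y # zs)"
      "w \<in> closed_segment x y \<or> w \<in> polyline (y # zs)"
      by auto
    then show "v = w"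
      using segment[of v w] cross[of v w] cross[of w v] inj_onD[OF rest eq] eq by metis
  qed
qed auto

text \<open>Two points of the moving arc on one line in direction \<open>j\<close> have the same
  value of \<open>f\<close>, hence coincide, so the arc imposes no order condition on itself. Only
  the fixed set has to stay on one side, and only of points that really move.\<close>

lemma strand_move:
  fixes ps :: "((real^3) \<times> (real^3)) list" and f :: "real^3"
  assumes U: "polygonal U"
    and ps: "length ps \<ge> 2"
    and other: "\<And>p p' i. (p, p') \<in> set ps \<Longrightarrow> i \<noteq> j \<Longrightarrow> p' $ i = p $ i"
    and f: "f $ j = 0" "sorted_wrt (<) (map (\<lambda>z. f \<bullet> fst z) ps)"
    and free: "\<And>p p' u. (p, p') \<in> polyline ps \<Longrightarrow> p \<noteq> p' \<Longrightarrow> u \<in> U \<Longrightarrow>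
      (\<And>i. i \<noteq> j \<Longrightarrow> u $ i = p $ i) \<Longrightarrow>
      u $ j < p $ j \<and> u $ j < p' $ j \<or> p $ j < u $ j \<and> p' $ j < u $ j"
  shows "ambient_isotopic (U \<union> polyline (map fst ps)) (U \<union> polyline (map snd ps))"
proof -
  define G where "G = (\<lambda>u. (u, u)) ` U \<union> polyline ps"
  have lin: "linear (\<lambda>u :: real^3. (u, u))"
    by (auto simp: linear_iff)
  have "polyline ps \<noteq> {}"
    using ps by (cases ps rule: polyline.cases) auto
  then have "G \<noteq> {}"
    by (simp add: G_def)
  have "polygonal G"
    unfolding G_def by (intro polygonal_Un polygonal_linear_image[OF lin] U polygonal_polyline)
  have "polyline ps \<subseteq> {z. \<forall>i. i \<noteq> j \<longrightarrow> snd z $ i = fst z $ i}"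
    using other by (intro polyline_subset_convex) (auto simp: convex_def)
  then have other': "p' $ i = p $ i" if "(p, p') \<in> polyline ps" "i \<noteq> j" for p p' i
    using that by auto
  have inj: "inj_on (\<lambda>z. f \<bullet> fst z) (polyline ps)"
  proof (rule polyline_monotone_inj)
    show "linear (\<lambda>z :: (real^3) \<times> (real^3). f \<bullet> fst z)"
      by (auto simp: linear_iff inner_add_right)
  qed (use f(2) in \<open>simp add: sorted_wrt_map\<close>)
  have "ambient_isotopic (fst ` G) (snd ` G)"
  proof (rule coordinate_move[OF \<open>polygonal G\<close> \<open>G \<noteq> {}\<close>, where j = j])
    show "p' $ i = p $ i" if "(p, p') \<in> G" "i \<noteq> j" for p p' i
      using that other' by (auto simp: G_def)
    fix p p' r r'
    assume G: "(p, p') \<in> G" "(r, r') \<in> G" and same: "\<And>i. i \<noteq> j \<Longrightarrow> p $ i = r $ i"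
    have pU: "p = p' \<and> p \<in> U" if "(p, p') \<notin> polyline ps"
      using G(1) that by (auto simp: G_def)
    have rU: "r = r' \<and> r \<in> U" if "(r, r') \<notin> polyline ps"
      using G(2) that by (auto simp: G_def)
    show "(r $ j < p $ j \<longrightarrow> r' $ j < p' $ j) \<and> (r $ j = p $ j \<longrightarrow> r' $ j = p' $ j)"
    proof (cases "(p, p') \<in> polyline ps")
      case p: True
      show ?thesis
      proof (cases "(r, r') \<in> polyline ps")
        case True
        have "f $ i * p $ i = f $ i * r $ i" for i
          using same f(1) by (cases "i = j") auto
        then have "f \<bullet> p = f \<bullet> r"
          by (simp only: inner_vec_def inner_real_def)
        then have "(p, p') = (r, r')"
          using inj_onD[OF inj _ p True] by simp
        then show ?thesis
          by simp
      next
        case False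
        then show ?thesis
          using free[OF p, of r] rU same[symmetric] by (cases "p = p'") auto
      qed
    next
      case False
      note p = pU[OF this]
      show ?thesis
      proof (cases "(r, r') \<in> polyline ps")
        case True
        then show ?thesis
          using free[OF True, of p] p same by (cases "r = r'") auto
      next
        case False
        then show ?thesis
          using p rU by simp
      qed
    qed
  qed
  moreover have "fst ` G = U \<union> polyline (map fst ps)" "snd ` G = U \<union> polyline (map snd ps)"
    unfolding G_def image_Un
    by (simp_all add: image_image polyline_linear_image[OF linear_fst] polyline_linear_image[OF linear_snd])
  ultimately show ?thesis
    by simp
qed

section \<open>Moving part of a polygon along an axis\<close>

text \<open>A coordinate of a point of the segment from \<open>a\<close> to \<open>b\<close>; the flags exclude the ends of the
  segment, where a moved edge is attached to the rest.\<close>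

definition btw :: "bool \<Rightarrow> bool \<Rightarrow> real \<Rightarrow> real \<Rightarrow> real \<Rightarrow> bool" where
  "btw l r a b x \<longleftrightarrow> (\<exists>t\<ge>0. t \<le> 1 \<and> (l \<longrightarrow> t \<noteq> 0) \<and> (r \<longrightarrow> t \<noteq> 1) \<and> x = (1 - t) * a + t * b)"

text \<open>Every coordinate has its own parameter, so this is a box and not a segment. What is lost
  is the coupling of the coordinates; what remains are linear inequalities.\<close>

definition in_box :: "bool \<Rightarrow> bool \<Rightarrow> real^3 \<Rightarrow> real^3 \<Rightarrow> real^3 \<Rightarrow> bool" where
  "in_box l r a b u \<longleftrightarrow>
     btw l r (a $ 1) (b $ 1) (u $ 1) \<and> btw l r (a $ 2) (b $ 2) (u $ 2) \<and> btw l r (a $ 3) (b $ 3) (u $ 3)"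

fun boxes :: "(real^3) list \<Rightarrow> real^3 \<Rightarrow> bool" where
  "boxes (x # y # zs) u \<longleftrightarrow> in_box False False x y u \<or> boxes (y # zs) u"
| "boxes _ u \<longleftrightarrow> False"

text \<open>Source \<open>p\<close> and target \<open>p'\<close> are confined independently of each
  other. The ends of the whole arc are excluded because there the arc touches the resting part, and
  the strict inequalities asked of a move would fail.\<close>

fun moving_boxes :: "bool \<Rightarrow> ((real^3) \<times> (real^3)) list \<Rightarrow> real^3 \<Rightarrow> real^3 \<Rightarrow> bool" where
  "moving_boxes l (a # b # zs) p p' \<longleftrightarrow>
     in_box l (zs = []) (fst a) (fst b) p \<and> in_box l (zs = []) (snd a) (snd b) p' \<or>
     moving_boxes False (b # zs) p p'"
| "moving_boxes _ _ p p' \<longleftrightarrow> False"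

lemma btw_less:
  assumes "a < b"
  shows "btw l r a b x \<longleftrightarrow> a \<le> x \<and> x \<le> b \<and> (l \<longrightarrow> a < x) \<and> (r \<longrightarrow> x < b)"
proof
  assume "btw l r a b x"
  then obtain t where t: "0 \<le> t" "t \<le> 1" "l \<longrightarrow> t \<noteq> 0" "r \<longrightarrow> t \<noteq> 1" "x = (1 - t) * a + t * b"
    unfolding btw_def by blast
  have x: "x - a = t * (b - a)" "b - x = (1 - t) * (b - a)"
    using t(5) by (simp_all add: algebra_simps)
  have "x - a \<ge> 0" "b - x \<ge> 0" "l \<longrightarrow> x - a > 0" "r \<longrightarrow> b - x > 0"
    unfolding x using t assms by auto
  then show "a \<le> x \<and> x \<le> b \<and> (l \<longrightarrow> a < x) \<and> (r \<longrightarrow> x < b)"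
    by auto
next
  assume x: "a \<le> x \<and> x \<le> b \<and> (l \<longrightarrow> a < x) \<and> (r \<longrightarrow> x < b)"
  define t where "t = (x - a) / (b - a)"
  have t: "t * (b - a) = x - a"
    using assms by (simp add: t_def)
  show "btw l r a b x"
    unfolding btw_def
  proof (intro exI[of _ t] conjI)
    show "x = (1 - t) * a + t * b"
      using t by (simp add: algebra_simps)
  qed (use x assms in \<open>auto simp: t_def field_simps\<close>)
qed

lemma btw_greater:
  assumes "b < a"
  shows "btw l r a b x \<longleftrightarrow> b \<le> x \<and> x \<le> a \<and> (l \<longrightarrow> x < a) \<and> (r \<longrightarrow> b < x)"
proof -
  have "btw l r a b x \<longleftrightarrow> btw r l b a x"
    unfolding btw_def by (intro iffI; elim exE conjE; intro exI[of _ "1 - _"]; auto simp: algebra_simps)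
  then show ?thesis
    using btw_less[OF assms, of r l x] by blast
qed

lemma btw_same: "btw l r a a x \<longleftrightarrow> x = a"
  unfolding btw_def by (auto simp: algebra_simps intro: exI[of _ "1/2"])

lemma boxI:
  assumes "0 \<le> t" "t \<le> 1" "l \<longrightarrow> t \<noteq> 0" "r \<longrightarrow> t \<noteq> 1" "u = (1 - t) *\<^sub>R a + t *\<^sub>R b"
  shows "in_box l r a b u"
  unfolding in_box_def btw_def using assms by auto

lemma polyline_boxes: "u \<in> polyline zs \<Longrightarrow> boxes zs u"
  by (induction zs rule: polyline.induct) (auto simp: in_segment intro: boxI)

lemma polyline_moving_boxes:
  "(p, p') \<in> polyline zs \<Longrightarrow> p \<noteq> p' \<Longrightarrow> (l \<longrightarrow> fst (hd zs) = snd (hd zs)) \<Longrightarrow>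
    fst (last zs) = snd (last zs) \<Longrightarrow> moving_boxes l zs p p'"
proof (induction zs arbitrary: l rule: polyline.induct)
  case (1 a b zs)
  show ?case
  proof (cases "(p, p') \<in> closed_segment a b")
    case True
    then obtain t where t: "0 \<le> t" "t \<le> 1" "(p, p') = (1 - t) *\<^sub>R a + t *\<^sub>R b"
      by (auto simp: in_segment)
    then have p: "p = (1 - t) *\<^sub>R fst a + t *\<^sub>R fst b" "p' = (1 - t) *\<^sub>R snd a + t *\<^sub>R snd b"
      by (auto simp: prod_eq_iff)
    \<comment> \<open>At \<open>t = 0\<close> of the first edge and at \<open>t = 1\<close> of the
      last one, source and target agree, against \<open>p \<noteq> p'\<close>.\<close>
    have "l \<longrightarrow> t \<noteq> 0" "zs = [] \<longrightarrow> t \<noteq> 1"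
      using 1(3-5) unfolding p by auto
    then show ?thesis
      using boxI[OF t(1,2) _ _ p(1)] boxI[OF t(1,2) _ _ p(2)] by simp
  next
    case False
    then have "moving_boxes False (b # zs) p p'"
      using 1 by (intro 1(1)) auto
    then show ?thesis
      by simp
  qed
qed auto

text \<open>The rest of the polyline joins the fixed set. As all points enter through
  \<open>Q\<close> and through boxes, \<open>free\<close> speaks about coordinates only.\<close>

lemma polyline_move:
  fixes ps :: "((real^3) \<times> (real^3)) list" and f :: "real^3"
  assumes U: "polygonal U" "\<And>u. u \<in> U \<Longrightarrow> Q u"
    and ends: "fst (hd ps) = snd (hd ps)" "fst (last ps) = snd (last ps)"
    and ps: "length ps \<ge> 2"
    and other: "\<forall>(p, p') \<in> set ps. \<forall>i. i \<noteq> j \<longrightarrow> p' $ i = p $ i"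
    and f: "f $ j = 0" "sorted_wrt (<) (map (\<lambda>z. f \<bullet> fst z) ps)"
    and free: "\<And>p p' u. moving_boxes True ps p p' \<Longrightarrow>
      Q u \<or> boxes (xs @ [fst (hd ps)]) u \<or> boxes (fst (last ps) # ys) u \<Longrightarrow>
      (\<forall>i. i \<noteq> j \<longrightarrow> u $ i = p $ i) \<Longrightarrow>
      u $ j < p $ j \<and> u $ j < p' $ j \<or> p $ j < u $ j \<and> p' $ j < u $ j"
  shows "ambient_isotopic (U \<union> polyline (xs @ map fst ps @ ys)) (U \<union> polyline (xs @ map snd ps @ ys))"
proof -
  define V where "V = U \<union> polyline (xs @ [fst (hd ps)]) \<union> polyline (fst (last ps) # ys)"
  have split: "polyline (xs @ map g ps @ ys) =
      polyline (xs @ [g (hd ps)]) \<union> polyline (map g ps) \<union> polyline (g (last ps) # ys)"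
    for g :: "(real^3) \<times> (real^3) \<Rightarrow> real^3"
  proof -
    have "ps \<noteq> []"
      using ps by auto
    then have 1: "map g ps = g (hd ps) # map g (tl ps)" and 2: "map g ps = map g (butlast ps) @ [g (last ps)]"
      by (cases ps, simp_all) (cases ps rule: rev_cases, simp_all)
    have "polyline (xs @ map g ps @ ys) = polyline (xs @ [g (hd ps)]) \<union> polyline (map g ps @ ys)"
      using polyline_append[of xs "g (hd ps)" "map g (tl ps) @ ys"] 1 by (metis append_Cons)
    moreover have "polyline (map g ps @ ys) = polyline (map g ps) \<union> polyline (g (last ps) # ys)"
      using polyline_append[of "map g (butlast ps)" "g (last ps)" ys] 2 by (metis append_assoc append_Cons append_Nil)
    ultimately show ?thesis
      by (simp only: Un_assoc)
  qed
  have "ambient_isotopic (V \<union> polyline (map fst ps)) (V \<union> polyline (map snd ps))"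
  proof (rule strand_move[OF _ ps _ f])
    show "polygonal V"
      unfolding V_def by (intro polygonal_Un U polygonal_polyline)
    show "p' $ i = p $ i" if "(p, p') \<in> set ps" "i \<noteq> j" for p p' i
      using other that by auto
    fix p p' u
    assume p: "(p, p') \<in> polyline ps" "p \<noteq> p'" and u: "u \<in> V" and same: "\<And>i. i \<noteq> j \<Longrightarrow> u $ i = p $ i"
    have "Q u \<or> boxes (xs @ [fst (hd ps)]) u \<or> boxes (fst (last ps) # ys) u"
      using u U(2) polyline_boxes unfolding V_def by blast
    moreover have "moving_boxes True ps p p'"
      using p ends by (intro polyline_moving_boxes) auto
    ultimately show "u $ j < p $ j \<and> u $ j < p' $ j \<or> p $ j < u $ j \<and> p' $ j < u $ j"
      using free same by blast
  qed
  then show ?thesis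
    unfolding split V_def using ends by (simp add: Un_ac)
qed

lemma point_nth [simp]: "point x y z $ 1 = x" "point x y z $ 2 = y" "point x y z $ 3 = z"
  by (simp_all add: point_def)

lemma point_eq_iff: "point x y z = point x' y' z' \<longleftrightarrow> x = x' \<and> y = y' \<and> z = z'"
  by (auto simp: vec_eq_iff forall_3)

lemma inner_point: "point x y z \<bullet> p = x * p $ 1 + y * p $ 2 + z * p $ 3"
  by (simp add: inner_vec_def sum_3)

lemmas move_simps = in_box_def btw_same btw_less btw_greater point_eq_iff forall_3 inner_point

text \<open>The form for concrete vertex lists: the moving arc consists of the \<open>k\<close>
  vertices from index \<open>i\<close> on, its two ends at rest, and \<open>j\<close> is the
  coordinate that changes. For numerals the conditions simplify to linear inequalities.\<close>

lemma polyline_slide: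
  assumes U: "polygonal U" "U \<subseteq> Collect Q"
    and vs: "take i vs' = take i vs" "drop (i + k) vs' = drop (i + k) vs" "length vs' = length vs"
    and ends: "vs' ! i = vs ! i" "vs' ! (i + k - 1) = vs ! (i + k - 1)"
    and k: "k \<ge> 2" "i + k \<le> length vs"
    and other: "\<forall>(p, p') \<in> set (zip vs vs'). \<forall>i. i \<noteq> j \<longrightarrow> p' $ i = p $ i"
    and f: "f $ j = 0" "sorted_wrt (<) (map (\<lambda>p. f \<bullet> p) (take k (drop i vs)))"
    and free: "\<And>p p' u. moving_boxes True (take k (drop i (zip vs vs'))) p p' \<Longrightarrow>
      Q u \<or> boxes (take (Suc i) vs) u \<or> boxes (drop (i + k - 1) vs) u \<Longrightarrow>
      (\<forall>i. i \<noteq> j \<longrightarrow> u $ i = p $ i) \<Longrightarrow>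
      u $ j < p $ j \<and> u $ j < p' $ j \<or> p $ j < u $ j \<and> p' $ j < u $ j"
  shows "ambient_isotopic (U \<union> polyline vs) (U \<union> polyline vs')"
proof -
  define ps where "ps = take k (drop i (zip vs vs'))"
  have len: "length ps = k"
    using k vs(3) by (simp add: ps_def)
  have nth: "ps ! m = (vs ! (i + m), vs' ! (i + m))" if "m < k" for m
    using that k vs(3) by (simp add: ps_def)
  have fst: "map fst ps = take k (drop i vs)" and snd: "map snd ps = take k (drop i vs')"
    using k vs(3) by (simp_all add: ps_def take_zip drop_zip)
  have "ps \<noteq> []"
    using len k by auto
  have hd: "hd ps = (vs ! i, vs ! i)" and last: "last ps = (vs ! (i + k - 1), vs ! (i + k - 1))"
    using nth[of 0] nth[of "k - 1"] len k ends \<open>ps \<noteq> []\<close> by (auto simp: hd_conv_nth last_conv_nth)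
  have "take i ws @ take k (drop i ws) @ drop (i + k) ws = ws" for ws :: "(real^3) list"
    using append_take_drop_id[of k "drop i ws"] by (simp add: add.commute)
  then have "vs = take i vs @ map fst ps @ drop (i + k) vs" "vs' = take i vs @ map snd ps @ drop (i + k) vs"
    using vs(1,2) by (simp_all add: fst snd) metis
  moreover have "ambient_isotopic (U \<union> polyline (take i vs @ map fst ps @ drop (i + k) vs))
      (U \<union> polyline (take i vs @ map snd ps @ drop (i + k) vs))"
  proof (rule polyline_move[OF U(1), where Q = Q and j = j and f = f])
    show "\<forall>(p, p')\<in>set ps. \<forall>i. i \<noteq> j \<longrightarrow> p' $ i = p $ i"
      using other by (auto simp: ps_def dest!: in_set_takeD in_set_dropD)
    show "sorted_wrt (<) (map (\<lambda>z. f \<bullet> fst z) ps)"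
      using f(2) by (simp flip: fst add: o_def)
    fix p p' u
    have 1: "take i vs @ [fst (hd ps)] = take (Suc i) vs"
      using k by (simp add: hd take_Suc_conv_app_nth)
    have 2: "fst (last ps) # drop (i + k) vs = drop (i + k - 1) vs"
      using k Cons_nth_drop_Suc[of "i + k - 1" vs] by (simp add: last)
    assume "moving_boxes True ps p p'" "Q u \<or> boxes (take i vs @ [fst (hd ps)]) u \<or> boxes (fst (last ps) # drop (i + k) vs) u"
      "\<forall>i. i \<noteq> j \<longrightarrow> u $ i = p $ i"
    then show "u $ j < p $ j \<and> u $ j < p' $ j \<or> p $ j < u $ j \<and> p' $ j < u $ j"
      unfolding 1 2 unfolding ps_def by (rule free)
  qed (use k U(2) in \<open>auto simp: hd last len f\<close>)
  ultimately show ?thesis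
    by metis
qed

lemma ambient_isotopic_refl: "ambient_isotopic K K"
  unfolding ambient_isotopic_def
  by (rule exI[of _ snd]) (auto intro!: continuous_intros exI[of _ "\<lambda>x. x"] homeomorphism_ident)

lemmas [trans] = ambient_isotopic_trans

text \<open>The point set does not change, since the dropped vertex is on the segment between its
  neighbours. This shortens the lists once an arc has been made straight.\<close>

lemma polyline_remove:
  fixes U :: "(real^3) set"
  assumes "take (Suc i) vs @ drop (i + 2) vs = vs'" "i + 2 < length vs" "0 \<le> t" "t \<le> 1"
    "vs ! (i + 1) = (1 - t) *\<^sub>R vs ! i + t *\<^sub>R vs ! (i + 2)"
  shows "ambient_isotopic (U \<union> polyline vs) (U \<union> polyline vs')"
proof -
  let ?x = "vs ! i" and ?m = "vs ! (i + 1)" and ?y = "vs ! (i + 2)"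
  define zs where "zs = drop (i + 3) vs"
  have "vs = take i vs @ drop i vs"
    by simp
  also have "drop i vs = ?x # ?m # ?y # zs"
    using assms(2) by (simp add: zs_def flip: Cons_nth_drop_Suc add_Suc_right) (simp add: numeral_eq_Suc Cons_nth_drop_Suc)
  finally have vs: "vs = take i vs @ ?x # ?m # ?y # zs" .
  have vs': "vs' = take i vs @ ?x # ?y # zs"
    using assms(1,2) Cons_nth_drop_Suc[of "i + 2" vs] by (simp add: zs_def take_Suc_conv_app_nth numeral_eq_Suc)
  have "?m \<in> closed_segment ?x ?y"
    unfolding in_segment using assms(3-5) by blast
  then have "closed_segment ?x ?m \<union> closed_segment ?m ?y = closed_segment ?x ?y"
    by (rule Un_closed_segment)
  then have "polyline (?x # ?m # ?y # zs) = polyline (?x # ?y # zs)"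
    by auto
  then have "polyline vs = polyline vs'"
    by (subst vs, subst vs') (metis polyline_append)
  then show ?thesis
    by (simp add: ambient_isotopic_refl)
qed

section \<open>Undoing the tuck\<close>

text \<open>
  All coordinates are those of a tie diagram tucked to the right, up to a reflection. The set \<open>U\<close> is the
  passive strand with the active strand up to the vertex \<open>?A\<close> after the crossing \<open>n - 3\<close>
  (\<open>n - 4\<close> if the move \<open>n - 2\<close> comes from the center), and \<open>l\<close> is the level of \<open>?A\<close>. First the
  edge at level \<open>-(2n - 2)\<close> is moved below \<open>b\<close>. Then the heights are made strictly monotone along the arcs to
  be straightened, so that a change of another coordinate cannot make such an arc meet itself.
\<close>

definition outer :: "real \<Rightarrow> real \<Rightarrow> real^3 \<Rightarrow> bool" where
  "outer n l u \<longleftrightarrow>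
     u $ 3 = 0 \<and> - 1 \<le> u $ 1 \<and> u $ 1 \<le> 1 \<and> - 2 * n \<le> u $ 2 \<and> u $ 2 \<le> 2 * n + 4 \<and>
       (u $ 1 = 1 \<or> u $ 1 = - 1 \<or> u $ 2 \<le> 0 \<or> u $ 2 = 2 * n + 4) \<and> (u $ 1 = 0 \<or> - 2 \<le> u $ 2) \<or>
     - 1 \<le> u $ 3 \<and> u $ 3 \<le> 1 \<and> - n < u $ 1 \<and> u $ 1 \<le> n \<and> - (2 * n - 6) \<le> u $ 2 \<and> u $ 2 \<le> 2 * n - 6 \<or>
     u = point (- n) l 1"

text \<open>The three parts hold the passive strand, the active strand up to its column after
  crossing \<open>n - 4\<close>, and the end vertex of the latter. This vertex alone reaches the
  face \<open>s * u $ 1 = n - 1\<close> of the box; \<open>s\<close> is the side on which the walk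
  is then, independent of the side of the tuck.\<close>

definition outer_center :: "real \<Rightarrow> real \<Rightarrow> real \<Rightarrow> real^3 \<Rightarrow> bool" where
  "outer_center n l s u \<longleftrightarrow>
     u $ 3 = 0 \<and> - 1 \<le> u $ 1 \<and> u $ 1 \<le> 1 \<and> - 2 * n \<le> u $ 2 \<and> u $ 2 \<le> 2 * n + 4 \<and>
       (u $ 1 = 1 \<or> u $ 1 = - 1 \<or> u $ 2 \<le> 0 \<or> u $ 2 = 2 * n + 4) \<and> (u $ 1 = 0 \<or> - 2 \<le> u $ 2) \<or>
     - 1 \<le> u $ 3 \<and> u $ 3 \<le> 1 \<and> - (n - 1) \<le> u $ 1 \<and> u $ 1 \<le> n - 1 \<and> s * u $ 1 < n - 1 \<and>
       - (2 * n - 8) \<le> u $ 2 \<and> u $ 2 \<le> 2 * n - 8 \<or>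
     u = point (s * (n - 1)) l (- 1)"

text \<open>After the bigon at b is gone, the arc from crossing \<open>n - 3\<close> to crossing
  \<open>n\<close> passes below all the rest, so that it can be swept into the column
  \<open>-n\<close>. The tuck then has a free way out to its own column \<open>n + 4\<close>. Its
  closing edge at the level of b is below all crossings and meets nothing.\<close>

lemma untuck_side:
  assumes n: "n \<ge> 4" "- (2 * n - 6) \<le> l" "l \<le> 2 * n - 6"
    and U: "polygonal U" "U \<subseteq> Collect (outer n l)"
  shows "ambient_isotopic
    (U \<union> polyline [point (-n) l 1,
      point (-n) (-(2 * n - 4)) (-1),
      point (n + 1) (-(2 * n - 4)) (-1),
      point (n + 1) (-(2 * n - 2)) 1,
      point (-(n + 2)) (-(2 * n - 2)) 1,
      point (-(n + 2)) (2 * n) (-1),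
      point 0 (2 * n) (-1),
      point 0 (2 * n + 2) 1,
      point (n + 4) (2 * n + 2) 1,
      point (n + 4) (-(2 * n - 3)) 2,
      point 3 (-(2 * n - 3)) 2,
      point 2 (-(2 * n - 3)) 0,
      point 2 (-2 * n) 0,
      point 0 (-2 * n) 0])
    (U \<union> polyline [point (-n) l 1,
      point (-n) (2 * n) (-5/6),
      point 0 (2 * n) (-1),
      point 0 (2 * n + 2) 1,
      point (n + 4) (2 * n + 2) 1,
      point (n + 4) (-2 * n) (1/5),
      point 0 (-2 * n) 0])"
proof -
  let ?A = "point (-n) l 1"
  let ?B = "point (-n) (-(2 * n - 4)) (-1)"
  let ?C = "point (n + 1) (-(2 * n - 4)) (-1)"
  let ?D = "point (n + 1) (-(2 * n - 2)) 1"
  let ?F = "point (-(n + 2)) (-(2 * n - 2)) 1"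
  let ?G = "point (-(n + 2)) (2 * n) (-1)"
  let ?H = "point 0 (2 * n) (-1)"
  let ?I = "point 0 (2 * n + 2) 1"
  let ?T1 = "point (n + 4) (2 * n + 2) 1"
  let ?T2 = "point (n + 4) (-(2 * n - 3)) 2"
  let ?T3 = "point 3 (-(2 * n - 3)) 2"
  let ?T4 = "point 2 (-(2 * n - 3)) 0"
  let ?T5 = "point 2 (-2 * n) 0"
  let ?E = "point 0 (-2 * n) 0"
  let ?D1 = "point (n + 1) (-(2 * n + 2)) 1"
  let ?F1 = "point (-(n + 2)) (-(2 * n + 2)) 1"
  let ?B1 = "point (-n) (-(2 * n - 4)) (-1/6)"
  let ?C1 = "point (n + 1) (-(2 * n - 4)) (-1/3)"
  let ?D2 = "point (n + 1) (-(2 * n + 2)) (-1/2)"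
  let ?F2 = "point (-(n + 2)) (-(2 * n + 2)) (-2/3)"
  let ?G1 = "point (-(n + 2)) (2 * n) (-5/6)"
  let ?S2 = "point (n + 4) (-(2 * n - 3)) (4/5)"
  let ?S3 = "point 3 (-(2 * n - 3)) (3/5)"
  let ?S4 = "point 2 (-(2 * n - 3)) (2/5)"
  let ?S5 = "point 2 (-2 * n) (1/5)"
  let ?C2 = "point (-n) (-(2 * n - 4)) (-1/3)"
  let ?D3 = "point (-n) (-(2 * n + 2)) (-1/2)"
  let ?F3 = "point (-n) (-(2 * n + 2)) (-2/3)"
  let ?G2 = "point (-n) (2 * n) (-5/6)"
  let ?R3 = "point (n + 4) (-(2 * n - 3)) (3/5)"
  let ?R4 = "point (n + 4) (-(2 * n - 3)) (2/5)"
  let ?R5 = "point (n + 4) (-2 * n) (1/5)"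
  \<comment> \<open>Levels proportional to heights: from \<open>?A\<close> to \<open>?G2\<close> the
    height falls by \<open>11/6\<close>, of which \<open>7/6\<close> are passed at
    \<open>?B3\<close>, so that the vertices become collinear.\<close>
  let ?B3 = "point (-n) (l + 7/11 * (2 * n - l)) (-1/6)"
  let ?C3 = "point (-n) (l + 8/11 * (2 * n - l)) (-1/3)"
  let ?D4 = "point (-n) (l + 9/11 * (2 * n - l)) (-1/2)"
  let ?F4 = "point (-n) (l + 10/11 * (2 * n - l)) (-2/3)"
  let ?Q2 = "point (n + 4) (2 * n + 2 - 1/4 * (4 * n + 2)) (4/5)"
  let ?Q3 = "point (n + 4) (2 * n + 2 - 2/4 * (4 * n + 2)) (3/5)"
  let ?Q4 = "point (n + 4) (2 * n + 2 - 3/4 * (4 * n + 2)) (2/5)"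
  \<comment> \<open>The bigon disappears here: the edge from \<open>?D\<close> to \<open>?F\<close>,
    which carries crossing \<open>n - 1\<close> and t3, sinks past b in two moves, one for each
    end.\<close>
  have "ambient_isotopic (U \<union> polyline [?A, ?B, ?C, ?D, ?F, ?G, ?H, ?I, ?T1, ?T2, ?T3, ?T4, ?T5, ?E]) (U \<union> polyline [?A, ?B, ?C, ?D1, ?F, ?G, ?H, ?I, ?T1, ?T2, ?T3, ?T4, ?T5, ?E])"
    by (rule polyline_slide[where i = 2 and k = 3 and j = 2 and f = "point (-1) 0 1", OF U];
        insert n; simp add: move_simps outer_def vec_eq_iff;
        (elim disjE conjE; (linarith | rule disjI1, rule conjI; linarith | rule disjI2, rule conjI; linarith))?)
  also have "ambient_isotopic \<dots> (U \<union> polyline [?A, ?B, ?C, ?D1, ?F1, ?G, ?H, ?I, ?T1, ?T2, ?T3, ?T4, ?T5, ?E])"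
    by (rule polyline_slide[where i = 3 and k = 3 and j = 2 and f = "point (-1) 0 (-1)", OF U];
        insert n; simp add: move_simps outer_def vec_eq_iff;
        (elim disjE conjE; (linarith | rule disjI1, rule conjI; linarith | rule disjI2, rule conjI; linarith))?)
  \<comment> \<open>No horizontal functional increases along the whole spiral, so the heights are
    changed piece by piece, each piece with its own \<open>f\<close>.\<close>
  also have "ambient_isotopic \<dots> (U \<union> polyline [?A, ?B1, ?C1, ?D1, ?F1, ?G, ?H, ?I, ?T1, ?T2, ?T3, ?T4, ?T5, ?E])"
    by (rule polyline_slide[where i = 0 and k = 4 and j = 3 and f = "point 1 (-1) 0", OF U];
        insert n; simp add: move_simps outer_def vec_eq_iff;
        (elim disjE conjE; (linarith | rule disjI1, rule conjI; linarith | rule disjI2, rule conjI; linarith))?)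
  also have "ambient_isotopic \<dots> (U \<union> polyline [?A, ?B1, ?C1, ?D2, ?F1, ?G, ?H, ?I, ?T1, ?T2, ?T3, ?T4, ?T5, ?E])"
    by (rule polyline_slide[where i = 2 and k = 3 and j = 3 and f = "point (-1) (-1) 0", OF U];
        insert n; simp add: move_simps outer_def vec_eq_iff;
        (elim disjE conjE; (linarith | rule disjI1, rule conjI; linarith | rule disjI2, rule conjI; linarith))?)
  also have "ambient_isotopic \<dots> (U \<union> polyline [?A, ?B1, ?C1, ?D2, ?F2, ?G, ?H, ?I, ?T1, ?T2, ?T3, ?T4, ?T5, ?E])"
    by (rule polyline_slide[where i = 3 and k = 3 and j = 3 and f = "point (-1) 1 0", OF U];
        insert n; simp add: move_simps outer_def vec_eq_iff;
        (elim disjE conjE; (linarith | rule disjI1, rule conjI; linarith | rule disjI2, rule conjI; linarith))?)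
  also have "ambient_isotopic \<dots> (U \<union> polyline [?A, ?B1, ?C1, ?D2, ?F2, ?G1, ?H, ?I, ?T1, ?T2, ?T3, ?T4, ?T5, ?E])"
    by (rule polyline_slide[where i = 4 and k = 3 and j = 3 and f = "point 1 1 0", OF U];
        insert n; simp add: move_simps outer_def vec_eq_iff;
        (elim disjE conjE; (linarith | rule disjI1, rule conjI; linarith | rule disjI2, rule conjI; linarith))?)
  also have "ambient_isotopic \<dots> (U \<union> polyline [?A, ?B1, ?C1, ?D2, ?F2, ?G1, ?H, ?I, ?T1, ?S2, ?S3, ?S4, ?S5, ?E])"
    by (rule polyline_slide[where i = 8 and k = 6 and j = 3 and f = "point (-1) (-1) 0", OF U];
        insert n; simp add: move_simps outer_def vec_eq_iff;
        (elim disjE conjE; (linarith | rule disjI1, rule conjI; linarith | rule disjI2, rule conjI; linarith))?)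
  \<comment> \<open>From here on the falling height serves as \<open>f\<close> in every
    move.\<close>
  also have "ambient_isotopic \<dots> (U \<union> polyline [?A, ?B1, ?C2, ?D3, ?F3, ?G2, ?H, ?I, ?T1, ?S2, ?S3, ?S4, ?S5, ?E])"
    by (rule polyline_slide[where i = 1 and k = 6 and j = 1 and f = "point 0 0 (-1)", OF U];
        insert n; simp add: move_simps outer_def vec_eq_iff;
        (elim disjE conjE; (linarith | rule disjI1, rule conjI; linarith | rule disjI2, rule conjI; linarith))?)
  also have "ambient_isotopic \<dots> (U \<union> polyline [?A, ?B1, ?C2, ?D3, ?F3, ?G2, ?H, ?I, ?T1, ?S2, ?R3, ?R4, ?R5, ?E])"
    by (rule polyline_slide[where i = 9 and k = 5 and j = 1 and f = "point 0 0 (-1)", OF U];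
        insert n; simp add: move_simps outer_def vec_eq_iff;
        (elim disjE conjE; (linarith | rule disjI1, rule conjI; linarith | rule disjI2, rule conjI; linarith))?)
  also have "ambient_isotopic \<dots> (U \<union> polyline [?A, ?B3, ?C3, ?D4, ?F4, ?G2, ?H, ?I, ?T1, ?S2, ?R3, ?R4, ?R5, ?E])"
    by (rule polyline_slide[where i = 0 and k = 6 and j = 2 and f = "point 0 0 (-1)", OF U];
        insert n; simp add: move_simps outer_def vec_eq_iff;
        (elim disjE conjE; (linarith | rule disjI1, rule conjI; linarith | rule disjI2, rule conjI; linarith))?)
  also have "ambient_isotopic \<dots> (U \<union> polyline [?A, ?B3, ?C3, ?D4, ?F4, ?G2, ?H, ?I, ?T1, ?Q2, ?Q3, ?Q4, ?R5, ?E])"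
    by (rule polyline_slide[where i = 8 and k = 5 and j = 2 and f = "point 0 0 (-1)", OF U];
        insert n; simp add: move_simps outer_def vec_eq_iff;
        (elim disjE conjE; (linarith | rule disjI1, rule conjI; linarith | rule disjI2, rule conjI; linarith))?)
  also have "ambient_isotopic \<dots> (U \<union> polyline [?A, ?C3, ?D4, ?F4, ?G2, ?H, ?I, ?T1, ?Q2, ?Q3, ?Q4, ?R5, ?E])"
    by (rule polyline_remove[where i = 0 and t = "7/8"]) (simp_all add: vec_eq_iff forall_3 field_simps)
  also have "ambient_isotopic \<dots> (U \<union> polyline [?A, ?D4, ?F4, ?G2, ?H, ?I, ?T1, ?Q2, ?Q3, ?Q4, ?R5, ?E])"
    by (rule polyline_remove[where i = 0 and t = "8/9"]) (simp_all add: vec_eq_iff forall_3 field_simps)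
  also have "ambient_isotopic \<dots> (U \<union> polyline [?A, ?F4, ?G2, ?H, ?I, ?T1, ?Q2, ?Q3, ?Q4, ?R5, ?E])"
    by (rule polyline_remove[where i = 0 and t = "9/10"]) (simp_all add: vec_eq_iff forall_3 field_simps)
  also have "ambient_isotopic \<dots> (U \<union> polyline [?A, ?G2, ?H, ?I, ?T1, ?Q2, ?Q3, ?Q4, ?R5, ?E])"
    by (rule polyline_remove[where i = 0 and t = "10/11"]) (simp_all add: vec_eq_iff forall_3 field_simps)
  also have "ambient_isotopic \<dots> (U \<union> polyline [?A, ?G2, ?H, ?I, ?T1, ?Q3, ?Q4, ?R5, ?E])"
    by (rule polyline_remove[where i = 4 and t = "1/2"]) (simp_all add: vec_eq_iff forall_3 field_simps)
  also have "ambient_isotopic \<dots> (U \<union> polyline [?A, ?G2, ?H, ?I, ?T1, ?Q4, ?R5, ?E])"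
    by (rule polyline_remove[where i = 4 and t = "2/3"]) (simp_all add: vec_eq_iff forall_3 field_simps)
  also have "ambient_isotopic \<dots> (U \<union> polyline [?A, ?G2, ?H, ?I, ?T1, ?R5, ?E])"
    by (rule polyline_remove[where i = 4 and t = "3/4"]) (simp_all add: vec_eq_iff forall_3 field_simps)
  finally show ?thesis
    by simp
qed

text \<open>Once the bigon is gone, the arc after crossing \<open>n - 3\<close> starts and ends in
  the center and is below everything else, so it shrinks to a straight edge inside the neck
  loop.\<close>

lemma untuck_center_under:
  assumes n: "n \<ge> 5" "- (2 * n - 8) \<le> l" "l \<le> 2 * n - 8" and s: "s = 1 \<or> s = - 1"
    and U: "polygonal U" "U \<subseteq> Collect (outer_center n l s)"
  shows "ambient_isotopic
    (U \<union> polyline [point (s * (n - 1)) l (-1),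
      point (s * (n - 1)) (2 * n - 6) 1,
      point 0 (2 * n - 6) 1,
      point 0 (2 * n - 4) (-1),
      point (n + 1) (2 * n - 4) (-1),
      point (n + 1) (-(2 * n - 2)) 1,
      point (-(n + 2)) (-(2 * n - 2)) 1,
      point (-(n + 2)) (2 * n) (-1),
      point 0 (2 * n) (-1),
      point 0 (2 * n + 2) 1,
      point (n + 4) (2 * n + 2) 1,
      point (n + 4) (-(2 * n - 3)) 2,
      point 3 (-(2 * n - 3)) 2,
      point 2 (-(2 * n - 3)) 0,
      point 2 (-2 * n) 0,
      point 0 (-2 * n) 0])
    (U \<union> polyline [point (s * (n - 1)) l (-1),
      point (s * (n - 1)) (2 * n - 6) 1,
      point 0 (2 * n - 6) 1,
      point 0 (2 * n + 2) 1,
      point (n + 4) (2 * n + 2) 1,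
      point (n + 4) (-(2 * n - 3)) 2,
      point 3 (-(2 * n - 3)) 2,
      point 2 (-(2 * n - 3)) 0,
      point 2 (-2 * n) 0,
      point 0 (-2 * n) 0])"
proof -
  let ?A = "point (s * (n - 1)) l (-1)"
  let ?Q = "point (s * (n - 1)) (2 * n - 6) 1"
  let ?R = "point 0 (2 * n - 6) 1"
  let ?S = "point 0 (2 * n - 4) (-1)"
  let ?C = "point (n + 1) (2 * n - 4) (-1)"
  let ?D = "point (n + 1) (-(2 * n - 2)) 1"
  let ?F = "point (-(n + 2)) (-(2 * n - 2)) 1"
  let ?G = "point (-(n + 2)) (2 * n) (-1)"
  let ?H = "point 0 (2 * n) (-1)"
  let ?I = "point 0 (2 * n + 2) 1"
  let ?T1 = "point (n + 4) (2 * n + 2) 1"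
  let ?T2 = "point (n + 4) (-(2 * n - 3)) 2"
  let ?T3 = "point 3 (-(2 * n - 3)) 2"
  let ?T4 = "point 2 (-(2 * n - 3)) 0"
  let ?T5 = "point 2 (-2 * n) 0"
  let ?E = "point 0 (-2 * n) 0"
  let ?D1 = "point (n + 1) (-(2 * n + 2)) 1"
  let ?F1 = "point (-(n + 2)) (-(2 * n + 2)) 1"
  let ?S1 = "point 0 (2 * n - 4) (-2)"
  let ?C1 = "point (n + 1) (2 * n - 4) (-11/5)"
  let ?D2 = "point (n + 1) (-(2 * n + 2)) (-12/5)"
  let ?F2 = "point (-(n + 2)) (-(2 * n + 2)) (-13/5)"
  let ?G1 = "point (-(n + 2)) (2 * n) (-14/5)"
  let ?H1 = "point 0 (2 * n) (-3)"
  let ?C2 = "point (1/2) (2 * n - 4) (-11/5)"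
  let ?D3 = "point (1/2) (-(2 * n + 2)) (-12/5)"
  let ?F3 = "point (-1/2) (-(2 * n + 2)) (-13/5)"
  let ?G2 = "point (-1/2) (2 * n) (-14/5)"
  let ?C3 = "point (1/2) (2 * n - 16/5) (-11/5)"
  let ?D4 = "point (1/2) (2 * n - 12/5) (-12/5)"
  let ?F4 = "point (-1/2) (2 * n - 8/5) (-13/5)"
  let ?G3 = "point (-1/2) (2 * n - 4/5) (-14/5)"
  let ?C4 = "point 0 (2 * n - 16/5) (-11/5)"
  let ?D5 = "point 0 (2 * n - 12/5) (-12/5)"
  let ?F5 = "point 0 (2 * n - 8/5) (-13/5)"
  let ?G4 = "point 0 (2 * n - 4/5) (-14/5)"
  let ?S2 = "point 0 (2 * n - 4) 1"
  let ?C5 = "point 0 (2 * n - 16/5) 1"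
  let ?D6 = "point 0 (2 * n - 12/5) 1"
  let ?F6 = "point 0 (2 * n - 8/5) 1"
  let ?G5 = "point 0 (2 * n - 4/5) 1"
  let ?H2 = "point 0 (2 * n) 1"
  have "ambient_isotopic (U \<union> polyline [?A, ?Q, ?R, ?S, ?C, ?D, ?F, ?G, ?H, ?I, ?T1, ?T2, ?T3, ?T4, ?T5, ?E]) (U \<union> polyline [?A, ?Q, ?R, ?S, ?C, ?D1, ?F, ?G, ?H, ?I, ?T1, ?T2, ?T3, ?T4, ?T5, ?E])"
    by (rule polyline_slide[where i = 4 and k = 3 and j = 2 and f = "point (-1) 0 1", OF U];
        insert n; rule disjE[OF s]; simp add: move_simps outer_center_def vec_eq_iff;
        (elim disjE conjE; (linarith | rule disjI1, rule conjI; linarith | rule disjI2, rule conjI; linarith))?)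
  also have "ambient_isotopic \<dots> (U \<union> polyline [?A, ?Q, ?R, ?S, ?C, ?D1, ?F1, ?G, ?H, ?I, ?T1, ?T2, ?T3, ?T4, ?T5, ?E])"
    by (rule polyline_slide[where i = 5 and k = 3 and j = 2 and f = "point (-1) 0 (-1)", OF U];
        insert n; rule disjE[OF s]; simp add: move_simps outer_center_def vec_eq_iff;
        (elim disjE conjE; (linarith | rule disjI1, rule conjI; linarith | rule disjI2, rule conjI; linarith))?)
  \<comment> \<open>Heights from \<open>-2\<close> to \<open>-3\<close> are below the whole box of
    the early strand, which the shrinking arc has to pass.\<close>
  also have "ambient_isotopic \<dots> (U \<union> polyline [?A, ?Q, ?R, ?S1, ?C, ?D1, ?F1, ?G, ?H, ?I, ?T1, ?T2, ?T3, ?T4, ?T5, ?E])"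
    by (rule polyline_slide[where i = 2 and k = 3 and j = 3 and f = "point 1 1 0", OF U];
        insert n; rule disjE[OF s]; simp add: move_simps outer_center_def vec_eq_iff;
        (elim disjE conjE; (linarith | rule disjI1, rule conjI; linarith | rule disjI2, rule conjI; linarith))?)
  also have "ambient_isotopic \<dots> (U \<union> polyline [?A, ?Q, ?R, ?S1, ?C1, ?D1, ?F1, ?G, ?H, ?I, ?T1, ?T2, ?T3, ?T4, ?T5, ?E])"
    by (rule polyline_slide[where i = 3 and k = 3 and j = 3 and f = "point 1 (-1) 0", OF U];
        insert n; rule disjE[OF s]; simp add: move_simps outer_center_def vec_eq_iff;
        (elim disjE conjE; (linarith | rule disjI1, rule conjI; linarith | rule disjI2, rule conjI; linarith))?)
  also have "ambient_isotopic \<dots> (U \<union> polyline [?A, ?Q, ?R, ?S1, ?C1, ?D2, ?F1, ?G, ?H, ?I, ?T1, ?T2, ?T3, ?T4, ?T5, ?E])"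
    by (rule polyline_slide[where i = 4 and k = 3 and j = 3 and f = "point (-1) (-1) 0", OF U];
        insert n; rule disjE[OF s]; simp add: move_simps outer_center_def vec_eq_iff;
        (elim disjE conjE; (linarith | rule disjI1, rule conjI; linarith | rule disjI2, rule conjI; linarith))?)
  also have "ambient_isotopic \<dots> (U \<union> polyline [?A, ?Q, ?R, ?S1, ?C1, ?D2, ?F2, ?G, ?H, ?I, ?T1, ?T2, ?T3, ?T4, ?T5, ?E])"
    by (rule polyline_slide[where i = 5 and k = 3 and j = 3 and f = "point (-1) 1 0", OF U];
        insert n; rule disjE[OF s]; simp add: move_simps outer_center_def vec_eq_iff;
        (elim disjE conjE; (linarith | rule disjI1, rule conjI; linarith | rule disjI2, rule conjI; linarith))?)
  also have "ambient_isotopic \<dots> (U \<union> polyline [?A, ?Q, ?R, ?S1, ?C1, ?D2, ?F2, ?G1, ?H1, ?I, ?T1, ?T2, ?T3, ?T4, ?T5, ?E])"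
    by (rule polyline_slide[where i = 6 and k = 4 and j = 3 and f = "point 1 1 0", OF U];
        insert n; rule disjE[OF s]; simp add: move_simps outer_center_def vec_eq_iff;
        (elim disjE conjE; (linarith | rule disjI1, rule conjI; linarith | rule disjI2, rule conjI; linarith))?)
  \<comment> \<open>Columns \<open>1/2\<close> and \<open>-1/2\<close> instead of \<open>0\<close>:
    at this stage, in the plane of column \<open>0\<close>, the last edge of the arc would lie in
    the bounding box of the resting edge from \<open>?H1\<close> to \<open>?I\<close>. That plane is
    open to the arc only when its levels are below \<open>2 * n\<close>.\<close>
  also have "ambient_isotopic \<dots> (U \<union> polyline [?A, ?Q, ?R, ?S1, ?C2, ?D3, ?F3, ?G2, ?H1, ?I, ?T1, ?T2, ?T3, ?T4, ?T5, ?E])"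
    by (rule polyline_slide[where i = 3 and k = 6 and j = 1 and f = "point 0 0 (-1)", OF U];
        insert n; rule disjE[OF s]; simp add: move_simps outer_center_def vec_eq_iff;
        (elim disjE conjE; (linarith | rule disjI1, rule conjI; linarith | rule disjI2, rule conjI; linarith))?)
  also have "ambient_isotopic \<dots> (U \<union> polyline [?A, ?Q, ?R, ?S1, ?C3, ?D4, ?F4, ?G3, ?H1, ?I, ?T1, ?T2, ?T3, ?T4, ?T5, ?E])"
    by (rule polyline_slide[where i = 3 and k = 6 and j = 2 and f = "point 0 0 (-1)", OF U];
        insert n; rule disjE[OF s]; simp add: move_simps outer_center_def vec_eq_iff;
        (elim disjE conjE; (linarith | rule disjI1, rule conjI; linarith | rule disjI2, rule conjI; linarith))?)
  also have "ambient_isotopic \<dots> (U \<union> polyline [?A, ?Q, ?R, ?S1, ?C4, ?D5, ?F5, ?G4, ?H1, ?I, ?T1, ?T2, ?T3, ?T4, ?T5, ?E])"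
    by (rule polyline_slide[where i = 3 and k = 6 and j = 1 and f = "point 0 0 (-1)", OF U];
        insert n; rule disjE[OF s]; simp add: move_simps outer_center_def vec_eq_iff;
        (elim disjE conjE; (linarith | rule disjI1, rule conjI; linarith | rule disjI2, rule conjI; linarith))?)
  \<comment> \<open>The plane of column \<open>0\<close> contains nothing else between the levels of
    \<open>?R\<close> and \<open>?I\<close>, so the arc can be raised there to height
    \<open>1\<close>.\<close>
  also have "ambient_isotopic \<dots> (U \<union> polyline [?A, ?Q, ?R, ?S2, ?C5, ?D6, ?F6, ?G5, ?H2, ?I, ?T1, ?T2, ?T3, ?T4, ?T5, ?E])"
    by (rule polyline_slide[where i = 2 and k = 8 and j = 3 and f = "point 0 1 0", OF U];
        insert n; rule disjE[OF s]; simp add: move_simps outer_center_def vec_eq_iff;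
        (elim disjE conjE; (linarith | rule disjI1, rule conjI; linarith | rule disjI2, rule conjI; linarith))?)
  also have "ambient_isotopic \<dots> (U \<union> polyline [?A, ?Q, ?R, ?C5, ?D6, ?F6, ?G5, ?H2, ?I, ?T1, ?T2, ?T3, ?T4, ?T5, ?E])"
    by (rule polyline_remove[where i = 2 and t = "5/7"]) (simp_all add: vec_eq_iff forall_3 field_simps)
  also have "ambient_isotopic \<dots> (U \<union> polyline [?A, ?Q, ?R, ?D6, ?F6, ?G5, ?H2, ?I, ?T1, ?T2, ?T3, ?T4, ?T5, ?E])"
    by (rule polyline_remove[where i = 2 and t = "7/9"]) (simp_all add: vec_eq_iff forall_3 field_simps)
  also have "ambient_isotopic \<dots> (U \<union> polyline [?A, ?Q, ?R, ?F6, ?G5, ?H2, ?I, ?T1, ?T2, ?T3, ?T4, ?T5, ?E])"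
    by (rule polyline_remove[where i = 2 and t = "9/11"]) (simp_all add: vec_eq_iff forall_3 field_simps)
  also have "ambient_isotopic \<dots> (U \<union> polyline [?A, ?Q, ?R, ?G5, ?H2, ?I, ?T1, ?T2, ?T3, ?T4, ?T5, ?E])"
    by (rule polyline_remove[where i = 2 and t = "11/13"]) (simp_all add: vec_eq_iff forall_3 field_simps)
  also have "ambient_isotopic \<dots> (U \<union> polyline [?A, ?Q, ?R, ?H2, ?I, ?T1, ?T2, ?T3, ?T4, ?T5, ?E])"
    by (rule polyline_remove[where i = 2 and t = "13/15"]) (simp_all add: vec_eq_iff forall_3 field_simps)
  also have "ambient_isotopic \<dots> (U \<union> polyline [?A, ?Q, ?R, ?I, ?T1, ?T2, ?T3, ?T4, ?T5, ?E])"
    by (rule polyline_remove[where i = 2 and t = "3/4"]) (simp_all add: vec_eq_iff forall_3 field_simps)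
  finally show ?thesis
    by simp
qed

text \<open>Now the active strand after crossing \<open>n - 4\<close> is above everything it meets:
  it makes the in-move \<open>n - 3\<close> and then t1, while t2 and t3 are gone. So it can be
  lifted and laid down along its column as far as the level of b, which takes it out of the neck
  loop.\<close>

lemma untuck_center_over:
  assumes n: "n \<ge> 5" "- (2 * n - 8) \<le> l" "l \<le> 2 * n - 8" and s: "s = 1 \<or> s = - 1"
    and U: "polygonal U" "U \<subseteq> Collect (outer_center n l s)"
  shows "ambient_isotopic
    (U \<union> polyline [point (s * (n - 1)) l (-1),
      point (s * (n - 1)) (2 * n - 6) 1,
      point 0 (2 * n - 6) 1,
      point 0 (2 * n + 2) 1,
      point (n + 4) (2 * n + 2) 1,
      point (n + 4) (-(2 * n - 3)) 2,
      point 3 (-(2 * n - 3)) 2,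
      point 2 (-(2 * n - 3)) 0,
      point 2 (-2 * n) 0,
      point 0 (-2 * n) 0])
    (U \<union> polyline [point (s * (n - 1)) l (-1),
      point (s * (n - 1)) (-2 * n) (23/8),
      point 0 (-2 * n) 0])"
proof -
  \<comment> \<open>The final edge rises from height \<open>-1\<close> to \<open>23/8\<close>, that
    is by 31 steps of \<open>1/8\<close>, while its level falls from \<open>l\<close> to
    \<open>-2 * n\<close>. So \<open>d\<close> is the fall per step, and collinear vertices are at
    multiples of \<open>d\<close> above \<open>-2 * n\<close>.\<close>
  define d where "d = (l + 2 * n) / 31"
  then have "31 * d = l + 2 * n"
    by simp
  then have d: "l = 31 * d - 2 * n" "d > 0"
    using n by linarith+
  let ?A = "point (s * (n - 1)) l (-1)"
  let ?Q = "point (s * (n - 1)) (2 * n - 6) 1"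
  let ?R = "point 0 (2 * n - 6) 1"
  let ?I = "point 0 (2 * n + 2) 1"
  let ?T1 = "point (n + 4) (2 * n + 2) 1"
  let ?T2 = "point (n + 4) (-(2 * n - 3)) 2"
  let ?T3 = "point 3 (-(2 * n - 3)) 2"
  let ?T4 = "point 2 (-(2 * n - 3)) 0"
  let ?T5 = "point 2 (-2 * n) 0"
  let ?E = "point 0 (-2 * n) 0"
  let ?uQ = "point (s * (n - 1)) (2 * n - 6) 2"
  let ?uR = "point 0 (2 * n - 6) (17/8)"
  let ?uI = "point 0 (2 * n + 2) (9/4)"
  let ?uT1 = "point (n + 4) (2 * n + 2) (19/8)"
  let ?uT2 = "point (n + 4) (-(2 * n - 3)) (5/2)"
  let ?uT3 = "point 3 (-(2 * n - 3)) (21/8)"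
  let ?uT4 = "point 2 (-(2 * n - 3)) (11/4)"
  let ?uT5 = "point 2 (-2 * n) (23/8)"
  let ?vR = "point (s * (n - 1)) (2 * n - 6) (17/8)"
  let ?vI = "point (s * (n - 1)) (2 * n + 2) (9/4)"
  let ?vT1 = "point (s * (n - 1)) (2 * n + 2) (19/8)"
  let ?vT2 = "point (s * (n - 1)) (-(2 * n - 3)) (5/2)"
  let ?vT3 = "point (s * (n - 1)) (-(2 * n - 3)) (21/8)"
  let ?vT4 = "point (s * (n - 1)) (-(2 * n - 3)) (11/4)"
  let ?vT5 = "point (s * (n - 1)) (-2 * n) (23/8)"
  let ?wQ = "point (s * (n - 1)) (-2 * n + 7 * d) 2"
  let ?wR = "point (s * (n - 1)) (-2 * n + 6 * d) (17/8)"
  let ?wI = "point (s * (n - 1)) (-2 * n + 5 * d) (9/4)"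
  let ?wT1 = "point (s * (n - 1)) (-2 * n + 4 * d) (19/8)"
  let ?wT2 = "point (s * (n - 1)) (-2 * n + 3 * d) (5/2)"
  let ?wT3 = "point (s * (n - 1)) (-2 * n + 2 * d) (21/8)"
  let ?wT4 = "point (s * (n - 1)) (-2 * n + 1 * d) (11/4)"
  have "ambient_isotopic (U \<union> polyline [?A, ?Q, ?R, ?I, ?T1, ?T2, ?T3, ?T4, ?T5, ?E]) (U \<union> polyline [?A, ?Q, ?R, ?I, ?T1, ?uT2, ?uT3, ?uT4, ?uT5, ?E])"
    by (rule polyline_slide[where i = 4 and k = 6 and j = 3 and f = "point (-1) (-1) 0", OF U];
        insert n; rule disjE[OF s]; simp add: move_simps outer_center_def vec_eq_iff;
        (elim disjE conjE; (linarith | rule disjI1, rule conjI; linarith | rule disjI2, rule conjI; linarith))?)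
  also have "ambient_isotopic \<dots> (U \<union> polyline [?A, ?Q, ?R, ?I, ?uT1, ?uT2, ?uT3, ?uT4, ?uT5, ?E])"
    by (rule polyline_slide[where i = 3 and k = 3 and j = 3 and f = "point 1 (-1) 0", OF U];
        insert n; rule disjE[OF s]; simp add: move_simps outer_center_def vec_eq_iff;
        (elim disjE conjE; (linarith | rule disjI1, rule conjI; linarith | rule disjI2, rule conjI; linarith))?)
  also have "ambient_isotopic \<dots> (U \<union> polyline [?A, ?Q, ?R, ?uI, ?uT1, ?uT2, ?uT3, ?uT4, ?uT5, ?E])"
    by (rule polyline_slide[where i = 2 and k = 3 and j = 3 and f = "point 1 1 0", OF U];
        insert n; rule disjE[OF s]; simp add: move_simps outer_center_def vec_eq_iff;
        (elim disjE conjE; (linarith | rule disjI1, rule conjI; linarith | rule disjI2, rule conjI; linarith))?)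
  also have "ambient_isotopic \<dots> (U \<union> polyline [?A, ?uQ, ?uR, ?uI, ?uT1, ?uT2, ?uT3, ?uT4, ?uT5, ?E])"
    by (rule polyline_slide[where i = 0 and k = 4 and j = 3 and f = "point (-s) 1 0", OF U];
        insert n; rule disjE[OF s]; simp add: move_simps outer_center_def vec_eq_iff;
        (elim disjE conjE; (linarith | rule disjI1, rule conjI; linarith | rule disjI2, rule conjI; linarith))?)
  \<comment> \<open>The height rises by \<open>1/8\<close> from \<open>?uT4\<close> to
    \<open>?uT5\<close> before it falls; the weight of the level in \<open>f\<close> outweighs this
    rise.\<close>
  also have "ambient_isotopic \<dots> (U \<union> polyline [?A, ?uQ, ?uR, ?uI, ?uT1, ?uT2, ?uT3, ?uT4, ?vT5, ?E])"
    by (rule polyline_slide[where i = 7 and k = 3 and j = 1 and f = "point 0 (-3) (-1)", OF U];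
        insert n; rule disjE[OF s]; simp add: move_simps outer_center_def vec_eq_iff;
        (elim disjE conjE; (linarith | rule disjI1, rule conjI; linarith | rule disjI2, rule conjI; linarith))?)
  also have "ambient_isotopic \<dots> (U \<union> polyline [?A, ?uQ, ?vR, ?vI, ?vT1, ?vT2, ?vT3, ?vT4, ?vT5, ?E])"
    by (rule polyline_slide[where i = 1 and k = 8 and j = 1 and f = "point 0 0 1", OF U];
        insert n; rule disjE[OF s]; simp add: move_simps outer_center_def vec_eq_iff;
        (elim disjE conjE; (linarith | rule disjI1, rule conjI; linarith | rule disjI2, rule conjI; linarith))?)
  also have "ambient_isotopic \<dots> (U \<union> polyline [?A, ?wQ, ?wR, ?wI, ?wT1, ?wT2, ?wT3, ?wT4, ?vT5, ?E])"
    by (rule polyline_slide[where i = 0 and k = 9 and j = 2 and f = "point 0 0 1", OF U];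
        insert d n; rule disjE[OF s]; simp add: move_simps outer_center_def vec_eq_iff;
        (elim disjE conjE; (linarith | rule disjI1, rule conjI; linarith | rule disjI2, rule conjI; linarith))?)
  also have "ambient_isotopic \<dots> (U \<union> polyline [?A, ?wR, ?wI, ?wT1, ?wT2, ?wT3, ?wT4, ?vT5, ?E])"
    by (rule polyline_remove[where i = 0 and t = "24/25"]) (simp_all add: vec_eq_iff forall_3 field_simps, use d in linarith)
  also have "ambient_isotopic \<dots> (U \<union> polyline [?A, ?wI, ?wT1, ?wT2, ?wT3, ?wT4, ?vT5, ?E])"
    by (rule polyline_remove[where i = 0 and t = "25/26"]) (simp_all add: vec_eq_iff forall_3 field_simps, use d in linarith)
  also have "ambient_isotopic \<dots> (U \<union> polyline [?A, ?wT1, ?wT2, ?wT3, ?wT4, ?vT5, ?E])"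
    by (rule polyline_remove[where i = 0 and t = "26/27"]) (simp_all add: vec_eq_iff forall_3 field_simps, use d in linarith)
  also have "ambient_isotopic \<dots> (U \<union> polyline [?A, ?wT2, ?wT3, ?wT4, ?vT5, ?E])"
    by (rule polyline_remove[where i = 0 and t = "27/28"]) (simp_all add: vec_eq_iff forall_3 field_simps, use d in linarith)
  also have "ambient_isotopic \<dots> (U \<union> polyline [?A, ?wT3, ?wT4, ?vT5, ?E])"
    by (rule polyline_remove[where i = 0 and t = "28/29"]) (simp_all add: vec_eq_iff forall_3 field_simps, use d in linarith)
  also have "ambient_isotopic \<dots> (U \<union> polyline [?A, ?wT4, ?vT5, ?E])"
    by (rule polyline_remove[where i = 0 and t = "29/30"]) (simp_all add: vec_eq_iff forall_3 field_simps, use d in linarith)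
  also have "ambient_isotopic \<dots> (U \<union> polyline [?A, ?vT5, ?E])"
    by (rule polyline_remove[where i = 0 and t = "30/31"]) (simp_all add: vec_eq_iff forall_3 field_simps, use d in linarith)
  finally show ?thesis
    by simp
qed

text \<open>For \<open>n = 3\<close> no crossing precedes the move \<open>n - 2\<close>, and the arc
  starts at a. The active strand fits into the open strip between the columns \<open>-1\<close> and
  \<open>0\<close>, which the passive strand only meets with its top edge; there it is straightened.
  It is then pulled out under the straight strand, as \<open>closed_tie\<close> expects at least one
  crossing.\<close>

lemma untuck_short:
  shows "ambient_isotopic
    (polyline [point 0 (-6) 0,
      point 0 0 0,
      point 1 0 0,
      point 1 10 0,
      point (-1) 10 0,
      point (-1) (-2) 0,
      point 4 (-2) (-1),
      point 4 (-4) 1,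
      point (-5) (-4) 1,
      point (-5) 6 (-1),
      point 0 6 (-1),
      point 0 8 1,
      point 7 8 1,
      point 7 (-3) 2,
      point 3 (-3) 2,
      point 2 (-3) 0,
      point 2 (-6) 0,
      point 0 (-6) 0])
    (polyline [point 0 (-6) 0,
      point 0 0 0,
      point 1 0 0,
      point 1 10 0,
      point (-1) 10 0,
      point (-1) (-2) 0,
      point 4 (-2) (-1/12),
      point 4 (-6) (-11/12),
      point 0 (-6) 0])"
proof -
  have U: "polygonal ({} :: (real^3) set)" "{} \<subseteq> Collect (\<lambda>u :: real^3. False)"
    by (auto simp: polygonal_def intro: exI[of _ "{}"])
  let ?b0 = "point 0 (-6) 0"
  let ?b1 = "point 0 0 0"
  let ?b2 = "point 1 0 0"
  let ?b3 = "point 1 10 0"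
  let ?b4 = "point (-1) 10 0"
  let ?A = "point (-1) (-2) 0"
  let ?C = "point 4 (-2) (-1)"
  let ?D = "point 4 (-4) 1"
  let ?F = "point (-5) (-4) 1"
  let ?G = "point (-5) 6 (-1)"
  let ?H = "point 0 6 (-1)"
  let ?I = "point 0 8 1"
  let ?T1 = "point 7 8 1"
  let ?T2 = "point 7 (-3) 2"
  let ?T3 = "point 3 (-3) 2"
  let ?T4 = "point 2 (-3) 0"
  let ?T5 = "point 2 (-6) 0"
  let ?E = "point 0 (-6) 0"
  let ?D1 = "point 4 (-8) 1"
  let ?F1 = "point (-5) (-8) 1"
  let ?C1 = "point 4 (-2) (-1/5)"
  let ?D2 = "point 4 (-8) (-2/5)"
  let ?F2 = "point (-5) (-8) (-3/5)"
  let ?G1 = "point (-5) 6 (-4/5)"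
  let ?S1 = "point 7 8 (5/6)"
  let ?S2 = "point 7 (-3) (2/3)"
  let ?S3 = "point 3 (-3) (1/2)"
  let ?S4 = "point 2 (-3) (1/3)"
  let ?S5 = "point 2 (-6) (1/6)"
  let ?C2 = "point (-9/10) (-2) (-1/5)"
  let ?D3 = "point (-8/10) (-8) (-2/5)"
  let ?F3 = "point (-7/10) (-8) (-3/5)"
  let ?G2 = "point (-6/10) 6 (-4/5)"
  let ?H1 = "point (-1/2) 6 (-1)"
  let ?I1 = "point (-1/2) 8 1"
  let ?R1 = "point (-5/12) 8 (5/6)"
  let ?R2 = "point (-4/12) (-3) (2/3)"
  let ?R3 = "point (-3/12) (-3) (1/2)"
  let ?R4 = "point (-2/12) (-3) (1/3)"
  let ?R5 = "point (-1/12) (-6) (1/6)"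
  let ?P1 = "point (-8/10) (-12/5) (-2/5)"
  let ?P2 = "point (-7/10) (-14/5) (-3/5)"
  let ?P3 = "point (-6/10) (-16/5) (-4/5)"
  let ?P4 = "point (-1/2) (-18/5) (-1)"
  let ?P5 = "point (-1/2) (-4) 1"
  let ?P6 = "point (-5/12) (-22/5) (5/6)"
  let ?P7 = "point (-4/12) (-24/5) (2/3)"
  let ?P8 = "point (-3/12) (-26/5) (1/2)"
  let ?P9 = "point (-2/12) (-28/5) (1/3)"
  let ?M0 = "point (-9/10) (-2) (-1/12)"
  let ?M1 = "point (-8/10) (-12/5) (-2/12)"
  let ?M2 = "point (-7/10) (-14/5) (-3/12)"
  let ?M3 = "point (-6/10) (-16/5) (-4/12)"
  let ?M4 = "point (-1/2) (-18/5) (-5/12)"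
  let ?M5 = "point (-1/2) (-4) (-6/12)"
  let ?M6 = "point (-5/12) (-22/5) (-7/12)"
  let ?M7 = "point (-4/12) (-24/5) (-8/12)"
  let ?M8 = "point (-3/12) (-26/5) (-9/12)"
  let ?M9 = "point (-2/12) (-28/5) (-10/12)"
  let ?M10 = "point (-1/12) (-6) (-11/12)"
  let ?L0 = "point 4 (-2) (-1/12)"
  let ?L1 = "point 4 (-12/5) (-2/12)"
  let ?L2 = "point 4 (-14/5) (-3/12)"
  let ?L3 = "point 4 (-16/5) (-4/12)"
  let ?L4 = "point 4 (-18/5) (-5/12)"
  let ?L5 = "point 4 (-4) (-6/12)"
  let ?L6 = "point 4 (-22/5) (-7/12)"
  let ?L7 = "point 4 (-24/5) (-8/12)"
  let ?L8 = "point 4 (-26/5) (-9/12)"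
  let ?L9 = "point 4 (-28/5) (-10/12)"
  let ?L10 = "point 4 (-6) (-11/12)"
  have "ambient_isotopic ({} \<union> polyline [?b0, ?b1, ?b2, ?b3, ?b4, ?A, ?C, ?D, ?F, ?G, ?H, ?I, ?T1, ?T2, ?T3, ?T4, ?T5, ?E]) ({} \<union> polyline [?b0, ?b1, ?b2, ?b3, ?b4, ?A, ?C, ?D1, ?F, ?G, ?H, ?I, ?T1, ?T2, ?T3, ?T4, ?T5, ?E])"
    by (rule polyline_slide[where i = 6 and k = 3 and j = 2 and f = "point (-1) 0 1", OF U];
        simp add: move_simps;
        (elim disjE conjE; (linarith | rule disjI1, rule conjI; linarith | rule disjI2, rule conjI; linarith))?)
  also have "ambient_isotopic \<dots> ({} \<union> polyline [?b0, ?b1, ?b2, ?b3, ?b4, ?A, ?C, ?D1, ?F1, ?G, ?H, ?I, ?T1, ?T2, ?T3, ?T4, ?T5, ?E])"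
    by (rule polyline_slide[where i = 7 and k = 3 and j = 2 and f = "point (-1) 0 (-1)", OF U];
        simp add: move_simps;
        (elim disjE conjE; (linarith | rule disjI1, rule conjI; linarith | rule disjI2, rule conjI; linarith))?)
  also have "ambient_isotopic \<dots> ({} \<union> polyline [?b0, ?b1, ?b2, ?b3, ?b4, ?A, ?C1, ?D1, ?F1, ?G, ?H, ?I, ?T1, ?T2, ?T3, ?T4, ?T5, ?E])"
    by (rule polyline_slide[where i = 5 and k = 3 and j = 3 and f = "point 1 (-1) 0", OF U];
        simp add: move_simps;
        (elim disjE conjE; (linarith | rule disjI1, rule conjI; linarith | rule disjI2, rule conjI; linarith))?)
  also have "ambient_isotopic \<dots> ({} \<union> polyline [?b0, ?b1, ?b2, ?b3, ?b4, ?A, ?C1, ?D2, ?F1, ?G, ?H, ?I, ?T1, ?T2, ?T3, ?T4, ?T5, ?E])"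
    by (rule polyline_slide[where i = 6 and k = 3 and j = 3 and f = "point (-1) (-1) 0", OF U];
        simp add: move_simps;
        (elim disjE conjE; (linarith | rule disjI1, rule conjI; linarith | rule disjI2, rule conjI; linarith))?)
  also have "ambient_isotopic \<dots> ({} \<union> polyline [?b0, ?b1, ?b2, ?b3, ?b4, ?A, ?C1, ?D2, ?F2, ?G, ?H, ?I, ?T1, ?T2, ?T3, ?T4, ?T5, ?E])"
    by (rule polyline_slide[where i = 7 and k = 3 and j = 3 and f = "point (-1) 1 0", OF U];
        simp add: move_simps;
        (elim disjE conjE; (linarith | rule disjI1, rule conjI; linarith | rule disjI2, rule conjI; linarith))?)
  also have "ambient_isotopic \<dots> ({} \<union> polyline [?b0, ?b1, ?b2, ?b3, ?b4, ?A, ?C1, ?D2, ?F2, ?G1, ?H, ?I, ?T1, ?T2, ?T3, ?T4, ?T5, ?E])"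
    by (rule polyline_slide[where i = 8 and k = 3 and j = 3 and f = "point 1 1 0", OF U];
        simp add: move_simps;
        (elim disjE conjE; (linarith | rule disjI1, rule conjI; linarith | rule disjI2, rule conjI; linarith))?)
  also have "ambient_isotopic \<dots> ({} \<union> polyline [?b0, ?b1, ?b2, ?b3, ?b4, ?A, ?C1, ?D2, ?F2, ?G1, ?H, ?I, ?S1, ?T2, ?T3, ?T4, ?T5, ?E])"
    by (rule polyline_slide[where i = 11 and k = 3 and j = 3 and f = "point 1 (-1) 0", OF U];
        simp add: move_simps;
        (elim disjE conjE; (linarith | rule disjI1, rule conjI; linarith | rule disjI2, rule conjI; linarith))?)
  also have "ambient_isotopic \<dots> ({} \<union> polyline [?b0, ?b1, ?b2, ?b3, ?b4, ?A, ?C1, ?D2, ?F2, ?G1, ?H, ?I, ?S1, ?S2, ?S3, ?S4, ?S5, ?E])"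
    by (rule polyline_slide[where i = 12 and k = 6 and j = 3 and f = "point (-1) (-1) 0", OF U];
        simp add: move_simps;
        (elim disjE conjE; (linarith | rule disjI1, rule conjI; linarith | rule disjI2, rule conjI; linarith))?)
  also have "ambient_isotopic \<dots> ({} \<union> polyline [?b0, ?b1, ?b2, ?b3, ?b4, ?A, ?C2, ?D3, ?F3, ?G2, ?H, ?I, ?S1, ?S2, ?S3, ?S4, ?S5, ?E])"
    by (rule polyline_slide[where i = 5 and k = 6 and j = 1 and f = "point 0 0 (-1)", OF U];
        simp add: move_simps;
        (elim disjE conjE; (linarith | rule disjI1, rule conjI; linarith | rule disjI2, rule conjI; linarith))?)
  also have "ambient_isotopic \<dots> ({} \<union> polyline [?b0, ?b1, ?b2, ?b3, ?b4, ?A, ?C2, ?D3, ?F3, ?G2, ?H1, ?I1, ?S1, ?S2, ?S3, ?S4, ?S5, ?E])"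
    by (rule polyline_slide[where i = 9 and k = 4 and j = 1 and f = "point 0 2 (-1)", OF U];
        simp add: move_simps;
        (elim disjE conjE; (linarith | rule disjI1, rule conjI; linarith | rule disjI2, rule conjI; linarith))?)
  also have "ambient_isotopic \<dots> ({} \<union> polyline [?b0, ?b1, ?b2, ?b3, ?b4, ?A, ?C2, ?D3, ?F3, ?G2, ?H1, ?I1, ?R1, ?R2, ?R3, ?R4, ?R5, ?E])"
    by (rule polyline_slide[where i = 11 and k = 7 and j = 1 and f = "point 0 0 (-1)", OF U];
        simp add: move_simps;
        (elim disjE conjE; (linarith | rule disjI1, rule conjI; linarith | rule disjI2, rule conjI; linarith))?)
  \<comment> \<open>\<open>?H1\<close> and \<open>?I1\<close> share a column; the weight
    \<open>1/4\<close> of the height tells them apart without disturbing the order of the other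
    vertices.\<close>
  also have "ambient_isotopic \<dots> ({} \<union> polyline [?b0, ?b1, ?b2, ?b3, ?b4, ?A, ?C2, ?P1, ?P2, ?P3, ?P4, ?P5, ?P6, ?P7, ?P8, ?P9, ?R5, ?E])"
    by (rule polyline_slide[where i = 6 and k = 11 and j = 2 and f = "point 1 0 (1/4)", OF U];
        simp add: move_simps;
        (elim disjE conjE; (linarith | rule disjI1, rule conjI; linarith | rule disjI2, rule conjI; linarith))?)
  also have "ambient_isotopic \<dots> ({} \<union> polyline [?b0, ?b1, ?b2, ?b3, ?b4, ?A, ?M0, ?M1, ?M2, ?M3, ?M4, ?M5, ?M6, ?M7, ?M8, ?M9, ?M10, ?E])"
    by (rule polyline_slide[where i = 5 and k = 13 and j = 3 and f = "point 1 (-1) 0", OF U];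
        simp add: move_simps;
        (elim disjE conjE; (linarith | rule disjI1, rule conjI; linarith | rule disjI2, rule conjI; linarith))?)
  also have "ambient_isotopic \<dots> ({} \<union> polyline [?b0, ?b1, ?b2, ?b3, ?b4, ?A, ?M0, ?M1, ?M2, ?M3, ?M4, ?M5, ?M6, ?M7, ?M8, ?M9, ?L10, ?E])"
    by (rule polyline_slide[where i = 15 and k = 3 and j = 1 and f = "point 0 (-1) 1", OF U];
        simp add: move_simps;
        (elim disjE conjE; (linarith | rule disjI1, rule conjI; linarith | rule disjI2, rule conjI; linarith))?)
  also have "ambient_isotopic \<dots> ({} \<union> polyline [?b0, ?b1, ?b2, ?b3, ?b4, ?A, ?L0, ?L1, ?L2, ?L3, ?L4, ?L5, ?L6, ?L7, ?L8, ?L9, ?L10, ?E])"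
    by (rule polyline_slide[where i = 5 and k = 12 and j = 1 and f = "point 0 0 (-1)", OF U];
        simp add: move_simps;
        (elim disjE conjE; (linarith | rule disjI1, rule conjI; linarith | rule disjI2, rule conjI; linarith))?)
  also have "ambient_isotopic \<dots> ({} \<union> polyline [?b0, ?b1, ?b2, ?b3, ?b4, ?A, ?L0, ?L2, ?L3, ?L4, ?L5, ?L6, ?L7, ?L8, ?L9, ?L10, ?E])"
    by (rule polyline_remove[where i = 6 and t = "1/2"]) (simp_all add: vec_eq_iff forall_3 field_simps)
  also have "ambient_isotopic \<dots> ({} \<union> polyline [?b0, ?b1, ?b2, ?b3, ?b4, ?A, ?L0, ?L3, ?L4, ?L5, ?L6, ?L7, ?L8, ?L9, ?L10, ?E])"
    by (rule polyline_remove[where i = 6 and t = "2/3"]) (simp_all add: vec_eq_iff forall_3 field_simps)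
  also have "ambient_isotopic \<dots> ({} \<union> polyline [?b0, ?b1, ?b2, ?b3, ?b4, ?A, ?L0, ?L4, ?L5, ?L6, ?L7, ?L8, ?L9, ?L10, ?E])"
    by (rule polyline_remove[where i = 6 and t = "3/4"]) (simp_all add: vec_eq_iff forall_3 field_simps)
  also have "ambient_isotopic \<dots> ({} \<union> polyline [?b0, ?b1, ?b2, ?b3, ?b4, ?A, ?L0, ?L5, ?L6, ?L7, ?L8, ?L9, ?L10, ?E])"
    by (rule polyline_remove[where i = 6 and t = "4/5"]) (simp_all add: vec_eq_iff forall_3 field_simps)
  also have "ambient_isotopic \<dots> ({} \<union> polyline [?b0, ?b1, ?b2, ?b3, ?b4, ?A, ?L0, ?L6, ?L7, ?L8, ?L9, ?L10, ?E])"
    by (rule polyline_remove[where i = 6 and t = "5/6"]) (simp_all add: vec_eq_iff forall_3 field_simps)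
  also have "ambient_isotopic \<dots> ({} \<union> polyline [?b0, ?b1, ?b2, ?b3, ?b4, ?A, ?L0, ?L7, ?L8, ?L9, ?L10, ?E])"
    by (rule polyline_remove[where i = 6 and t = "6/7"]) (simp_all add: vec_eq_iff forall_3 field_simps)
  also have "ambient_isotopic \<dots> ({} \<union> polyline [?b0, ?b1, ?b2, ?b3, ?b4, ?A, ?L0, ?L8, ?L9, ?L10, ?E])"
    by (rule polyline_remove[where i = 6 and t = "7/8"]) (simp_all add: vec_eq_iff forall_3 field_simps)
  also have "ambient_isotopic \<dots> ({} \<union> polyline [?b0, ?b1, ?b2, ?b3, ?b4, ?A, ?L0, ?L9, ?L10, ?E])"
    by (rule polyline_remove[where i = 6 and t = "8/9"]) (simp_all add: vec_eq_iff forall_3 field_simps)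
  also have "ambient_isotopic \<dots> ({} \<union> polyline [?b0, ?b1, ?b2, ?b3, ?b4, ?A, ?L0, ?L10, ?E])"
    by (rule polyline_remove[where i = 6 and t = "9/10"]) (simp_all add: vec_eq_iff forall_3 field_simps)
  finally show ?thesis
    by simp
qed

section \<open>Tie diagrams closed without a tuck\<close>

lemma curve_add:
  assumes "i < length vs" "0 \<le> t" "t < 1"
  shows "curve vs (real i + t) = (1 - t) *\<^sub>R vs ! i + t *\<^sub>R vs ! (Suc i mod length vs)"
proof -
  have "\<lfloor>real i + t\<rfloor> = int i"
    using assms by linarith
  then show ?thesis
    by (simp add: curve_def frac_def)
qed

lemma concat_pairs_Suc:
  "concat (map (\<lambda>k. [f k, f' k]) [1..<Suc (Suc n)]) =
    concat (map (\<lambda>k. [f k, f' k]) [1..<Suc n]) @ [f (Suc n), f' (Suc n)]"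
  by simp

lemma length_concat_pairs: "length (concat (map (\<lambda>k. [f k, f' k]) [1..<Suc n])) = 2 * n"
proof (induction n)
  case (Suc n)
  then show ?case
    unfolding concat_pairs_Suc by simp
qed simp

lemma nth_concat_pairs:
  "i < n \<Longrightarrow> concat (map (\<lambda>k. [f k, f' k]) [1..<Suc n]) ! (2 * i) = f (Suc i) \<and>
    concat (map (\<lambda>k. [f k, f' k]) [1..<Suc n]) ! (2 * i + 1) = f' (Suc i)"
proof (induction n)
  case (Suc n)
  define F where "F = (\<lambda>n. concat (map (\<lambda>k. [f k, f' k]) [1..<Suc n]))"
  have F: "F (Suc n) = F n @ [f (Suc n), f' (Suc n)]" "length (F n) = 2 * n"
    unfolding F_def by (rule concat_pairs_Suc, rule length_concat_pairs)
  have "F (Suc n) ! (2 * i) = f (Suc i) \<and> F (Suc n) ! (2 * i + 1) = f' (Suc i)"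
  proof (cases "i = n")
    case True
    then show ?thesis
      using F by (simp add: nth_append)
  next
    case False
    then have "i < n"
      using Suc.prems by simp
    then have "F n ! (2 * i) = f (Suc i) \<and> F n ! (2 * i + 1) = f' (Suc i)"
      unfolding F_def by (rule Suc.IH)
    then show ?thesis
      using \<open>i < n\<close> F by (simp add: nth_append)
  qed
  then show ?case
    unfolding F_def .
qed simp

text \<open>
  After \<open>k\<close> crossings the active strand is in the region \<open>rg k\<close> and runs along the column \<open>cl k\<close>. The crossing \<open>k\<close>
  is on an edge at level \<open>lv k\<close> whose height changes from \<open>g k\<close> to \<open>h k\<close>. The edge with index \<open>Suc m\<close> closes
  up at the point \<open>(0, b)\<close>.
\<close>

locale closed_tie =
  fixes m :: nat and b top :: real and rg :: "nat \<Rightarrow> region" and cl lv g h :: "nat \<Rightarrow> real"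
  assumes m: "m \<ge> 1" and b: "b < 0" and top: "top > 0"
    and rg_0: "rg 0 = Right" and rg_1: "rg 1 = Left" and rg_m: "rg m \<noteq> Center"
    and rg_Suc: "k < m \<Longrightarrow> rg (Suc k) \<noteq> rg k"
    and cl_0: "cl 0 = 1" and cl_end: "cl (Suc m) = 0"
    and cl_center: "1 \<le> k \<Longrightarrow> k \<le> m \<Longrightarrow> rg k = Center \<Longrightarrow> cl k = 0"
    and cl_left: "1 \<le> k \<Longrightarrow> k \<le> m \<Longrightarrow> rg k = Left \<Longrightarrow> cl k < - 1"
    and cl_right: "1 \<le> k \<Longrightarrow> k \<le> m \<Longrightarrow> rg k = Right \<Longrightarrow> 1 < cl k"
    and cl_mono: "j < k \<Longrightarrow> k \<le> m \<Longrightarrow> rg k \<noteq> Center \<Longrightarrow> \<bar>cl j\<bar> < \<bar>cl k\<bar>"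
    and lv_1: "lv 1 = - 2" and lv_end: "lv (Suc m) = b"
    and lv_neg: "1 \<le> k \<Longrightarrow> k \<le> m \<Longrightarrow> Center \<notin> {rg (k - 1), rg k} \<Longrightarrow> lv k < 0"
    and lv_pos: "1 \<le> k \<Longrightarrow> k \<le> m \<Longrightarrow> Center \<in> {rg (k - 1), rg k} \<Longrightarrow> 0 < lv k"
    and lv_extreme: "1 \<le> j \<Longrightarrow> j < k \<Longrightarrow> k \<le> Suc m \<Longrightarrow>
      (0 < lv k \<longrightarrow> lv j < lv k) \<and> (lv k < 0 \<longrightarrow> lv k < lv j)"
    and lv_top: "1 \<le> k \<Longrightarrow> k \<le> m \<Longrightarrow> lv k < top"
    and g_1: "g 1 = 0" and h_end: "h (Suc m) = 0"
    and gh: "1 \<le> k \<Longrightarrow> k \<le> m \<Longrightarrow> 0 \<le> g k * h k"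
    and h_nonzero: "1 \<le> k \<Longrightarrow> k \<le> m \<Longrightarrow> h k \<noteq> 0"
    and h_alternating: "1 \<le> k \<Longrightarrow> k < m \<Longrightarrow> 0 < h (Suc k) \<longleftrightarrow> h k < 0"
begin

definition diagram :: "(real^3) list" where
  "diagram = [point 0 b 0, point 0 0 0, point (- 1) 0 0, point (- 1) top 0, point 1 top 0, point 1 (- 2) 0] @
     concat (map (\<lambda>k. [point (cl k) (lv k) (h k), point (cl k) (lv (Suc k)) (g (Suc k))]) [1..<Suc m])"

lemma length_diagram: "length diagram = 2 * m + 6"
  unfolding diagram_def length_append length_concat_pairs by simp

lemma nth_diagram:
  "diagram ! 0 = point 0 b 0" "diagram ! 1 = point 0 0 0" "diagram ! 2 = point (- 1) 0 0"
  "diagram ! 3 = point (- 1) top 0" "diagram ! 4 = point 1 top 0" "diagram ! 5 = point 1 (- 2) 0"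
  "1 \<le> k \<Longrightarrow> k \<le> m \<Longrightarrow> diagram ! (2 * k + 4) = point (cl k) (lv k) (h k)"
  "1 \<le> k \<Longrightarrow> k \<le> m \<Longrightarrow> diagram ! (2 * k + 5) = point (cl k) (lv (Suc k)) (g (Suc k))"
proof -
  let ?ps = "concat (map (\<lambda>k. [point (cl k) (lv k) (h k), point (cl k) (lv (Suc k)) (g (Suc k))]) [1..<Suc m])"
  have shift: "diagram ! (n + 6) = ?ps ! n" for n
    by (simp add: diagram_def nth_append del: upt_Suc)
  assume "1 \<le> k" "k \<le> m"
  then have k: "k - 1 < m" "2 * k + 4 = 2 * (k - 1) + 6" "2 * k + 5 = (2 * (k - 1) + 1) + 6" "Suc (k - 1) = k"
    by auto
  show "diagram ! (2 * k + 4) = point (cl k) (lv k) (h k)"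
    "diagram ! (2 * k + 5) = point (cl k) (lv (Suc k)) (g (Suc k))"
    unfolding k(2,3) shift
    using nth_concat_pairs[OF k(1), of "\<lambda>k. point (cl k) (lv k) (h k)" "\<lambda>k. point (cl k) (lv (Suc k)) (g (Suc k))"] k(4)
    by (simp_all del: upt_Suc)
qed (simp_all add: diagram_def)

lemma curve_passive:
  assumes "0 \<le> t" "t < 1"
  shows "curve diagram t = point 0 ((1 - t) * b) 0"
    "curve diagram (1 + t) = point (- t) 0 0"
    "curve diagram (2 + t) = point (- 1) (t * top) 0"
    "curve diagram (3 + t) = point (2 * t - 1) top 0"
    "curve diagram (4 + t) = point 1 (top - t * (top + 2)) 0"
proof -
  have "curve diagram (real i + t) = (1 - t) *\<^sub>R diagram ! i + t *\<^sub>R diagram ! Suc i" if "i < 5" for i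
    using curve_add[of i diagram t] assms that m by (simp add: length_diagram)
  from this[of 0] this[of 1] this[of 2] this[of 3] this[of 4]
  show "curve diagram t = point 0 ((1 - t) * b) 0"
    "curve diagram (1 + t) = point (- t) 0 0"
    "curve diagram (2 + t) = point (- 1) (t * top) 0"
    "curve diagram (3 + t) = point (2 * t - 1) top 0"
    "curve diagram (4 + t) = point 1 (top - t * (top + 2)) 0"
    using nth_diagram(1-6) by (simp_all add: vec_eq_iff forall_3 algebra_simps numeral_eq_Suc)
qed

text \<open>The two exceptional edges are absorbed by conventions: the first starts at a, where
  \<open>cl_0\<close>, \<open>lv_1\<close> and \<open>g_1\<close> apply, and the last returns to
  vertex \<open>0\<close> of the list, where \<open>cl_end\<close>, \<open>lv_end\<close> and
  \<open>h_end\<close> do.\<close>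

lemma curve_horizontal:
  assumes "0 \<le> t" "t < 1" "1 \<le> k" "k \<le> Suc m"
  shows "curve diagram (2 * real k + 3 + t) =
    point ((1 - t) * cl (k - 1) + t * cl k) (lv k) ((1 - t) * g k + t * h k)"
proof -
  have 1: "curve diagram (real (2 * k + 3) + t) =
      (1 - t) *\<^sub>R diagram ! (2 * k + 3) + t *\<^sub>R diagram ! (Suc (2 * k + 3) mod length diagram)"
    using assms by (intro curve_add) (auto simp: length_diagram)
  have 2: "diagram ! (2 * k + 3) = point (cl (k - 1)) (lv k) (g k)"
  proof (cases "k = 1")
    case True
    then show ?thesis
      using nth_diagram(6) lv_1 g_1 cl_0 by simp
  next
    case False
    then show ?thesis
      using nth_diagram(8)[of "k - 1"] assms by (cases k) (auto simp: add.commute)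
  qed
  have 3: "diagram ! (Suc (2 * k + 3) mod length diagram) = point (cl k) (lv k) (h k)"
  proof (cases "k = Suc m")
    case True
    then have "Suc (2 * k + 3) = length diagram"
      by (simp add: length_diagram)
    then have "Suc (2 * k + 3) mod length diagram = 0"
      by simp
    then show ?thesis
      using True nth_diagram(1) lv_end h_end cl_end by simp
  next
    case False
    then show ?thesis
      using nth_diagram(7)[of k] assms by (simp add: length_diagram add.commute)
  qed
  show ?thesis
    using 1 unfolding 2 3 by (simp add: vec_eq_iff forall_3 algebra_simps)
qed

lemma curve_vertical:
  assumes "0 \<le> t" "t < 1" "1 \<le> k" "k \<le> m"
  shows "curve diagram (2 * real k + 4 + t) =
    point (cl k) ((1 - t) * lv k + t * lv (Suc k)) ((1 - t) * h k + t * g (Suc k))"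
proof -
  have "curve diagram (real (2 * k + 4) + t) =
      (1 - t) *\<^sub>R diagram ! (2 * k + 4) + t *\<^sub>R diagram ! (2 * k + 5)"
    using assms by (subst curve_add) (auto simp: length_diagram add.commute)
  then show ?thesis
    using nth_diagram(7,8)[of k] assms by (simp add: vec_eq_iff forall_3 algebra_simps)
qed

lemma params_cases:
  assumes s_in: "s \<in> params diagram"
  obtains (1) t i where "0 \<le> t" "t < 1" "i < 5" "s = real i + t"
  | (2) t k where "0 \<le> t" "t < 1" "1 \<le> k" "k \<le> Suc m" "s = 2 * real k + 3 + t"
  | (3) t k where "0 \<le> t" "t < 1" "1 \<le> k" "k \<le> m" "s = 2 * real k + 4 + t"
proof -
  define i where "i = nat \<lfloor>s\<rfloor>"
  define t where "t = s - real i"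
  have s: "0 \<le> s" "s < 2 * real m + 6"
    using s_in by (auto simp: length_diagram)
  then have t: "0 \<le> t" "t < 1" "s = real i + t"
    unfolding t_def i_def by linarith+
  then have i: "i < 2 * m + 6"
    using s by linarith
  consider "i < 5" | "i \<ge> 5" "odd i" | "i \<ge> 5" "even i" by linarith
  then show ?thesis
  proof cases
    case 1
    then show ?thesis
      using t by (intro that(1))
  next
    case 2
    then obtain j where "i = 2 * j + 1" by (auto elim: oddE)
    then show ?thesis
      using 2 t i by (intro that(2)[of t "j - 1"]) (auto simp: of_nat_diff)
  next
    case 3
    then obtain j where "i = 2 * j" by (auto elim: evenE)
    then show ?thesis
      using 3 t i by (intro that(3)[of t "j - 2"]) (auto simp: of_nat_diff)
  qed
qed

text \<open>The crossing \<open>k\<close> is on the straight strand, the left or the right side of the neck loop if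
  \<open>third k\<close> is \<open>Center\<close>, \<open>Right\<close> or \<open>Left\<close>, respectively.\<close>

definition third :: "nat \<Rightarrow> region" where
  "third k = (if Center \<notin> {rg (k - 1), rg k} then Center
     else if Right \<notin> {rg (k - 1), rg k} then Right else Left)"

definition strand :: "nat \<Rightarrow> real" where
  "strand k = (case third k of Center \<Rightarrow> 0 | Right \<Rightarrow> - 1 | Left \<Rightarrow> 1)"

definition active_param :: "nat \<Rightarrow> real" where
  "active_param k = 2 * real k + 3 + (strand k - cl (k - 1)) / (cl k - cl (k - 1))"

text \<open>The three cases are on the edges \<open>0\<close>, \<open>2\<close> and \<open>4\<close>
  of the diagram. The right side is traversed downwards from \<open>top\<close> to
  \<open>-2\<close>, whence the length \<open>top + 2\<close>.\<close>

definition passive_param :: "nat \<Rightarrow> real" where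
  "passive_param k = (case third k of Center \<Rightarrow> 1 - lv k / b | Right \<Rightarrow> 2 + lv k / top
     | Left \<Rightarrow> 4 + (top - lv k) / (top + 2))"

lemma rg_step:
  assumes "1 \<le> k" "k \<le> m"
  shows "rg k \<noteq> rg (k - 1)"
  using rg_Suc[of "k - 1"] assms by auto

lemma third_eq_iff:
  assumes "1 \<le> k" "k \<le> m"
  shows "third k = v \<longleftrightarrow> rg (k - 1) \<noteq> v \<and> rg k \<noteq> v"
  using rg_step[OF assms] by (cases "rg k"; cases "rg (k - 1)"; cases v) (auto simp: third_def)

lemma cl_not_center:
  assumes "k \<le> m" "rg k \<noteq> Center"
  shows "rg k = Left \<and> cl k < - 1 \<or> rg k = Right \<and> 1 \<le> cl k \<and> (k > 0 \<longrightarrow> 1 < cl k)"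
  using cl_left[of k] cl_right[of k] assms cl_0 rg_0 by (cases "k = 0"; cases "rg k") auto

lemma crossing:
  assumes k: "1 \<le> k" "k \<le> m"
  shows "third k = Center \<and> lv k < 0 \<and> (cl (k - 1) < 0 \<and> 0 < cl k \<or> cl k < 0 \<and> 0 < cl (k - 1)) \<or>
    third k = Right \<and> 0 < lv k \<and> (cl (k - 1) < - 1 \<and> cl k = 0 \<or> cl k < - 1 \<and> cl (k - 1) = 0) \<or>
    third k = Left \<and> 0 < lv k \<and> (1 < cl (k - 1) \<and> cl k = 0 \<or> 1 < cl k \<and> cl (k - 1) = 0)"
proof -
  have k': "k - 1 \<le> m"
    using k by simp
  \<comment> \<open>The first move goes from right to left, so a crossing that touches the center
    has a positive index before it: \<open>cl_center\<close> and the strict bound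
    \<open>1 < cl\<close> hold for positive indices only.\<close>
  have "Center \<notin> {rg (k - 1), rg k}" if "k = 1"
    using that rg_0 rg_1 by simp
  then have pos: "k - 1 > 0" if "Center \<in> {rg (k - 1), rg k}"
    using that k by (cases "k = 1") auto
  show ?thesis
  proof (cases "Center \<in> {rg (k - 1), rg k}")
    case False
    then have "third k = Center" "lv k < 0"
      using lv_neg[OF k] by (auto simp: third_def)
    moreover have "cl (k - 1) < 0 \<and> 0 < cl k \<or> cl k < 0 \<and> 0 < cl (k - 1)"
      using cl_not_center[of k] cl_not_center[OF k'] rg_step[OF k] False k by auto
    ultimately show ?thesis
      by blast
  next
    case True
    then have lv: "0 < lv k"
      using lv_pos[OF k] by blast
    have c: "cl k = 0" if "rg k = Center"
      using cl_center[OF k that] .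
    have c': "cl (k - 1) = 0" if "rg (k - 1) = Center"
      using cl_center[of "k - 1"] that pos[OF True] k by auto
    show ?thesis
      using True c c' cl_not_center[of k] cl_not_center[OF k'] rg_step[OF k] k lv pos[OF True]
      by (cases "rg k"; cases "rg (k - 1)") (auto simp: third_def)
  qed
qed

lemma strand_between:
  assumes k: "1 \<le> k" "k \<le> m"
  shows "cl (k - 1) < strand k \<and> strand k < cl k \<or> cl k < strand k \<and> strand k < cl (k - 1)"
  using crossing[OF k] by (auto simp: strand_def)

lemma active_bounds:
  assumes k: "1 \<le> k" "k \<le> m"
  shows "2 * real k + 3 < active_param k" "active_param k < 2 * real k + 4"
  using strand_between[OF k] by (auto simp: active_param_def divide_less_eq zero_less_divide_iff)

lemma lv_below:
  assumes "1 \<le> k" "k \<le> m"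
  shows "b < lv k"
  using lv_extreme[of k "Suc m"] assms lv_end b by simp

lemma passive_bounds:
  assumes k: "1 \<le> k" "k \<le> m"
  shows "third k = Center \<Longrightarrow> 0 < passive_param k \<and> passive_param k < 1"
    "third k = Right \<Longrightarrow> 2 < passive_param k \<and> passive_param k < 3"
    "third k = Left \<Longrightarrow> 4 < passive_param k \<and> passive_param k < 5"
  using crossing[OF k] lv_below[OF k] lv_top[OF k] b top by (auto simp: passive_param_def field_simps)

lemma active_params:
  assumes k: "1 \<le> k" "k \<le> m"
  shows "active_param k \<in> params diagram" "passive_param k \<in> params diagram"
proof -
  show "active_param k \<in> params diagram"
    using active_bounds[OF k] k by (auto simp: length_diagram)
  have "0 < passive_param k \<and> passive_param k < 5"
    using passive_bounds[OF k] by (cases "third k") auto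
  then show "passive_param k \<in> params diagram"
    using m by (auto simp: length_diagram)
qed

text \<open>The height at the crossing is a proper convex combination of \<open>g k\<close> and
  \<open>h k\<close>. By \<open>gh\<close> these do not have opposite signs, so \<open>h k\<close>
  decides which strand is on top.\<close>

lemma curve_active:
  assumes k: "1 \<le> k" "k \<le> m"
  obtains z where "curve diagram (active_param k) = point (strand k) (lv k) z" "0 < z * h k"
proof -
  define t where "t = (strand k - cl (k - 1)) / (cl k - cl (k - 1))"
  have ne: "cl k - cl (k - 1) \<noteq> 0"
    using strand_between[OF k] by auto
  have t: "0 < t" "t < 1" "active_param k = 2 * real k + 3 + t"
    using active_bounds[OF k] by (auto simp: active_param_def t_def)
  have "t * (cl k - cl (k - 1)) = strand k - cl (k - 1)"
    using ne by (simp add: t_def)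
  then have x: "(1 - t) * cl (k - 1) + t * cl k = strand k"
    by (simp add: algebra_simps)
  have "((1 - t) * g k + t * h k) * h k = (1 - t) * (g k * h k) + t * (h k)\<^sup>2"
    by (simp add: algebra_simps power2_eq_square)
  also have "\<dots> > 0"
    using t gh[OF k] h_nonzero[OF k] by (intro add_nonneg_pos) auto
  finally show ?thesis
    using that curve_horizontal[of t k] t k x by simp
qed

lemma curve_passive_crossing:
  assumes k: "1 \<le> k" "k \<le> m"
  shows "curve diagram (passive_param k) = point (strand k) (lv k) 0"
proof (cases "third k")
  case Center
  then show ?thesis
    using curve_passive(1)[of "1 - lv k / b"] passive_bounds(1)[OF k] b
    by (simp add: passive_param_def strand_def)
next
  case Right
  then show ?thesis
    using curve_passive(3)[of "lv k / top"] passive_bounds(2)[OF k] top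
    by (simp add: passive_param_def strand_def)
next
  case Left
  then show ?thesis
    using curve_passive(5)[of "(top - lv k) / (top + 2)"] passive_bounds(3)[OF k] top
    by (simp add: passive_param_def strand_def)
qed

lemma passive_shadow:
  assumes "0 \<le> t" "t < 1" "i < 5" "shadow (curve diagram (real i + t)) = (x, y)" "s = real i + t"
  shows "x = 0 \<and> b \<le> y \<and> y < 0 \<and> s = 1 - y / b \<or> - 1 < x \<and> x \<le> 0 \<and> y = 0 \<and> s = 1 - x \<or>
    x = - 1 \<and> 0 \<le> y \<and> y < top \<and> s = 2 + y / top \<or> - 1 \<le> x \<and> x < 1 \<and> y = top \<and> s = 3 + (x + 1) / 2 \<or>
    x = 1 \<and> - 2 < y \<and> y \<le> top \<and> s = 4 + (top - y) / (top + 2)"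
proof -
  have y0: "(1 - t) * b < 0" "b \<le> (1 - t) * b"
    using assms(1,2) b by (auto simp: mult_less_0_iff mult_le_cancel_right1 mult_le_cancel_right2)
  have y2: "0 \<le> t * top" "t * top < top"
    using assms(1,2) top by auto
  have y4: "0 \<le> t * (top + 2)" "t * (top + 2) < top + 2"
    using assms(1,2) top by auto
  consider "i = 0" | "i = 1" | "i = 2" | "i = 3" | "i = 4"
    using assms(3) by linarith
  then show ?thesis
  proof cases
    case 1
    then have "x = 0" "y = (1 - t) * b" "s = t"
      using assms(4,5) curve_passive(1)[OF assms(1,2)] by (simp_all add: shadow_def)
    moreover have "s = 1 - y / b"
      using calculation b by simp
    ultimately show ?thesis
      using y0 by blast
  next
    case 2
    then show ?thesis
      using assms curve_passive(2)[OF assms(1,2)] by (auto simp: shadow_def)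
  next
    case 3
    then have "x = - 1" "y = t * top" "s = 2 + t"
      using assms(4,5) curve_passive(3)[OF assms(1,2)] by (simp_all add: shadow_def)
    moreover have "s = 2 + y / top"
      using calculation top by simp
    ultimately show ?thesis
      using y2 by blast
  next
    case 4
    then show ?thesis
      using assms curve_passive(4)[OF assms(1,2)] by (auto simp: shadow_def)
  next
    case 5
    then have "x = 1" "y = top - t * (top + 2)" "s = 4 + t"
      using assms(4,5) curve_passive(5)[OF assms(1,2)] by (simp_all add: shadow_def)
    moreover have "s = 4 + (top - y) / (top + 2)"
      using calculation top by simp
    moreover have "- 2 < y" "y \<le> top"
      using y4 calculation by auto
    ultimately show ?thesis
      by blast
  qed
qed

lemma passive_inj:
  assumes "s \<in> params diagram" "t \<in> params diagram" "s < 5" "t < 5"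
    "shadow (curve diagram s) = shadow (curve diagram t)"
  shows "s = t"
proof -
  obtain x y where xy: "shadow (curve diagram s) = (x, y)"
    by (cases "shadow (curve diagram s)")
  obtain i u where s: "0 \<le> u" "u < 1" "i < 5" "s = real i + u"
    using assms(1,3) by (cases rule: params_cases) auto
  obtain j v where t: "0 \<le> v" "v < 1" "j < 5" "t = real j + v"
    using assms(2,4) by (cases rule: params_cases) auto
  have "shadow (curve diagram (real i + u)) = (x, y)" "shadow (curve diagram (real j + v)) = (x, y)"
    using xy assms(5) s(4) t(4) by simp_all
  from passive_shadow[OF s(1-3) this(1) s(4)] passive_shadow[OF t(1-3) this(2) t(4)] top
  show ?thesis
    by (elim disjE conjE; simp)
qed

section \<open>Disjointness of the edges of the active strand\<close>

lemma lv_nonzero: "1 \<le> k \<Longrightarrow> k \<le> Suc m \<Longrightarrow> lv k \<noteq> 0"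
  using crossing[of k] lv_end b by (cases "k = Suc m") auto

lemma lv_inj: "1 \<le> j \<Longrightarrow> j < k \<Longrightarrow> k \<le> Suc m \<Longrightarrow> lv j \<noteq> lv k"
  using lv_extreme[of j k] lv_nonzero[of k] by (cases "0 < lv k") auto

lemma horizontal_x:
  assumes t: "0 \<le> t" "t < 1" and k: "1 \<le> k" "k \<le> Suc m" and x: "x = (1 - t) * cl (k - 1) + t * cl k"
  shows "cl (k - 1) \<le> x \<and> x < cl k \<or> cl k < x \<and> x \<le> cl (k - 1)"
    "t = (x - cl (k - 1)) / (cl k - cl (k - 1))"
proof -
  have ne: "cl (k - 1) < cl k \<or> cl k < cl (k - 1)"
    using strand_between[of k] cl_not_center[of m] cl_end rg_m k by (cases "k = Suc m") auto
  have x': "x - cl (k - 1) = t * (cl k - cl (k - 1))" "cl k - x = (1 - t) * (cl k - cl (k - 1))"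
    unfolding x by (simp_all add: algebra_simps)
  then show "t = (x - cl (k - 1)) / (cl k - cl (k - 1))"
    using ne by auto
  show "cl (k - 1) \<le> x \<and> x < cl k \<or> cl k < x \<and> x \<le> cl (k - 1)"
    using ne
  proof
    assume "cl (k - 1) < cl k"
    then have "0 \<le> x - cl (k - 1)" "0 < cl k - x"
      unfolding x' using t by auto
    then show ?thesis by simp
  next
    assume "cl k < cl (k - 1)"
    then have "x - cl (k - 1) \<le> 0" "cl k - x < 0"
      unfolding x' using t by (auto simp: mult_le_0_iff mult_less_0_iff)
    then show ?thesis by simp
  qed
qed

lemma vertical_y:
  assumes t: "0 \<le> t" "t < 1" and k: "1 \<le> k" "k \<le> m" and y: "y = (1 - t) * lv k + t * lv (Suc k)"
  shows "lv k \<le> y \<and> y < lv (Suc k) \<or> lv (Suc k) < y \<and> y \<le> lv k"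
    "t = (y - lv k) / (lv (Suc k) - lv k)"
proof -
  have ne: "lv k < lv (Suc k) \<or> lv (Suc k) < lv k"
    using lv_inj[of k "Suc k"] k by auto
  have y': "y - lv k = t * (lv (Suc k) - lv k)" "lv (Suc k) - y = (1 - t) * (lv (Suc k) - lv k)"
    unfolding y by (simp_all add: algebra_simps)
  then show "t = (y - lv k) / (lv (Suc k) - lv k)"
    using ne by auto
  show "lv k \<le> y \<and> y < lv (Suc k) \<or> lv (Suc k) < y \<and> y \<le> lv k"
    using ne
  proof
    assume "lv k < lv (Suc k)"
    then have "0 \<le> y - lv k" "0 < lv (Suc k) - y"
      unfolding y' using t by auto
    then show ?thesis by simp
  next
    assume "lv (Suc k) < lv k"
    then have "y - lv k \<le> 0" "lv (Suc k) - y < 0"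
      unfolding y' using t by (auto simp: mult_le_0_iff mult_less_0_iff)
    then show ?thesis by simp
  qed
qed

lemma center_lv:
  assumes "1 \<le> k" "k \<le> m" "rg k = Center"
  shows "k < m" "0 < lv k" "lv k < lv (Suc k)" "lv (Suc k) < top" "cl k = 0"
proof -
  show "k < m"
    using assms rg_m by (cases "k = m") auto
  then have "0 < lv (Suc k)" "lv (Suc k) < top"
    using lv_pos[of "Suc k"] lv_top[of "Suc k"] assms by auto
  then show "0 < lv k" "lv k < lv (Suc k)" "lv (Suc k) < top" "cl k = 0"
    using lv_pos[of k] lv_extreme[of k "Suc k"] cl_center[of k] assms by auto
qed

text \<open>By \<open>cl_mono\<close> equal columns occur only in the center. Between two visits the
  walk leaves the center, so both levels of the earlier visit come before the later visit, whose
  levels are higher.\<close>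

lemma vertical_vertical:
  assumes "0 \<le> t" "t < 1" "1 \<le> j" "j < k" "k \<le> m" "0 \<le> u" "u < 1" "cl j = cl k"
  shows "(1 - t) * lv j + t * lv (Suc j) \<noteq> (1 - u) * lv k + u * lv (Suc k)"
proof -
  have "rg k = Center"
    using cl_mono[of j k] assms by auto
  note k = center_lv[OF _ _ this]
  have "rg j = Center"
    using cl_not_center[of j] k(5) assms by auto
  then have "Suc j < k"
    using rg_Suc[of j] \<open>rg k = Center\<close> assms by (cases "k = Suc j") auto
  then have "lv j < lv k" "lv (Suc j) < lv k"
    using lv_extreme[of j k] lv_extreme[of "Suc j" k] k(2) assms by auto
  then show ?thesis
    using vertical_y(1)[OF assms(1,2) assms(3) _ refl] vertical_y(1)[OF assms(6,7) _ assms(5) refl] k(3) assms by auto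
qed

text \<open>Compared with an earlier edge, a column is either in the center, where its levels are
  higher than all before, or farther out than both ends of the edge. A later edge has a level more
  extreme than both ends of the column. Neighbouring edges share a vertex, but half-open parameters
  count it for one of them only.\<close>

lemma horizontal_vertical:
  assumes t: "0 \<le> t" "t < 1" and j: "1 \<le> j" "j \<le> Suc m" and u: "0 \<le> u" "u < 1" and k: "1 \<le> k" "k \<le> m"
    and x: "(1 - t) * cl (j - 1) + t * cl j = cl k" and y: "lv j = (1 - u) * lv k + u * lv (Suc k)"
  shows False
proof -
  note X = horizontal_x(1)[OF t j x[symmetric]] and Y = vertical_y(1)[OF u k y]
  consider "j = k" | "j = Suc k" | "j < k" | "Suc k < j" by linarith
  then show False
  proof cases
    case 1
    then show False using X by auto
  next
    case 2
    then show False using Y by auto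
  next
    case 3
    show False
    proof (cases "rg k = Center")
      case True
      then show False
        using center_lv[OF k True] lv_extreme[of j k] 3 j k Y by auto
    next
      case False
      then have "\<bar>cl j\<bar> < \<bar>cl k\<bar>" "\<bar>cl (j - 1)\<bar> < \<bar>cl k\<bar>"
        using cl_mono[of j k] cl_mono[of "j - 1" k] 3 k by auto
      then show False
        using X by auto
    qed
  next
    case 4
    then have "(0 < lv j \<longrightarrow> lv k < lv j \<and> lv (Suc k) < lv j) \<and> (lv j < 0 \<longrightarrow> lv j < lv k \<and> lv j < lv (Suc k))"
      using lv_extreme[of k j] lv_extreme[of "Suc k" j] j k by auto
    then show False
      using lv_nonzero[OF j] Y by (cases "0 < lv j") auto
  qed
qed

lemma active_inj:
  assumes "s \<in> params diagram" "t \<in> params diagram" "5 \<le> s" "5 \<le> t"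
    and eq: "shadow (curve diagram s) = shadow (curve diagram t)"
  shows "s = t"
  using assms(1)
proof (cases rule: params_cases)
  case (1 u i)
  then show ?thesis using assms(3) by linarith
next
  case s: (2 u k)
  show ?thesis
    using assms(2)
  proof (cases rule: params_cases)
    case (1 v i)
    then show ?thesis using assms(4) by linarith
  next
    case t: (2 v j)
    have "lv k = lv j" and x: "(1 - u) * cl (k - 1) + u * cl k = (1 - v) * cl (j - 1) + v * cl j"
      using eq curve_horizontal[OF s(1-4)] curve_horizontal[OF t(1-4)] s(5) t(5) by (auto simp: shadow_def)
    then have "k = j"
      using lv_inj[of k j] lv_inj[of j k] s t by (cases k j rule: linorder_cases) auto
    then show ?thesis
      using horizontal_x(2)[OF s(1-4) refl] horizontal_x(2)[OF t(1-4) refl] x s(5) t(5) by simp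
  next
    case t: (3 v j)
    then show ?thesis
      using horizontal_vertical[OF s(1-4) t(1-4)] eq curve_horizontal[OF s(1-4)] curve_vertical[OF t(1-4)] s(5) t(5)
      by (auto simp: shadow_def)
  qed
next
  case s: (3 u k)
  show ?thesis
    using assms(2)
  proof (cases rule: params_cases)
    case (1 v i)
    then show ?thesis using assms(4) by linarith
  next
    case t: (2 v j)
    then show ?thesis
      using horizontal_vertical[OF t(1-4) s(1-4)] eq curve_horizontal[OF t(1-4)] curve_vertical[OF s(1-4)] s(5) t(5)
      by (auto simp: shadow_def)
  next
    case t: (3 v j)
    have "cl k = cl j" and y: "(1 - u) * lv k + u * lv (Suc k) = (1 - v) * lv j + v * lv (Suc j)"
      using eq curve_vertical[OF s(1-4)] curve_vertical[OF t(1-4)] s(5) t(5) by (auto simp: shadow_def)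
    then have "k = j"
      using vertical_vertical[of u k j v] vertical_vertical[of v j k u] s t by (cases k j rule: linorder_cases) auto
    then show ?thesis
      using vertical_y(2)[OF s(1-4) refl] vertical_y(2)[OF t(1-4) refl] y s(5) t(5) by simp
  qed
qed

lemma active_passive:
  assumes "s \<in> params diagram" "t \<in> params diagram" "5 \<le> s" "t < 5"
    and eq: "shadow (curve diagram s) = shadow (curve diagram t)"
  shows "\<exists>k\<in>{1..m}. s = active_param k \<and> t = passive_param k"
proof -
  obtain x y where xy: "shadow (curve diagram s) = (x, y)"
    by (cases "shadow (curve diagram s)")
  obtain i v where t: "0 \<le> v" "v < 1" "i < 5" "t = real i + v"
    using assms(2,4) by (cases rule: params_cases) auto
  note P = passive_shadow[OF t(1-3) _ t(4), of x y]
  have P: "x = 0 \<and> b \<le> y \<and> y < 0 \<and> t = 1 - y / b \<or> - 1 < x \<and> x \<le> 0 \<and> y = 0 \<and> t = 1 - x \<or>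
    x = - 1 \<and> 0 \<le> y \<and> y < top \<and> t = 2 + y / top \<or> - 1 \<le> x \<and> x < 1 \<and> y = top \<and> t = 3 + (x + 1) / 2 \<or>
    x = 1 \<and> - 2 < y \<and> y \<le> top \<and> t = 4 + (top - y) / (top + 2)"
    using P xy eq t(4) by simp
  \<comment> \<open>The right side extends below level \<open>0\<close> to a at level
    \<open>-2\<close>. Negative levels are at most \<open>-2\<close>, so no horizontal edge meets
    this piece above a.\<close>
  have low: "lv k \<le> - 2" if "1 \<le> k" "k \<le> Suc m" "lv k < 0" for k
    using lv_extreme[of 1 k] lv_1 that by (cases "k = 1") auto
  show ?thesis
    using assms(1)
  proof (cases rule: params_cases)
    case (1 u j)
    then show ?thesis using assms(3) by linarith
  next
    case s: (2 u k)
    have x: "x = (1 - u) * cl (k - 1) + u * cl k" and y: "y = lv k"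
      using xy curve_horizontal[OF s(1-4)] s(5) by (auto simp: shadow_def)
    note X = horizontal_x[OF s(1-4) x]
    show ?thesis
    proof (cases "k = Suc m")
      case True
      then have "x \<noteq> 0" "y = b" "b \<le> - 2"
        using X(1) cl_end y lv_end low[of k] b by auto
      then show ?thesis
        using P top by (elim disjE conjE; linarith)
    next
      case False
      then have k: "1 \<le> k" "k \<le> m"
        using s by auto
      have "lv k \<le> - 2 \<or> 0 < lv k"
        using low[of k] lv_nonzero[of k] s(3,4) by linarith
      then have "x = strand k \<and> t = passive_param k"
        using crossing[OF k] P X(1) y lv_top[OF k]
        by (elim disjE conjE; (linarith | simp add: strand_def passive_param_def))
      moreover have "s = active_param k" if "x = strand k"
        using X(2) s(5) that by (simp add: active_param_def)
      ultimately show ?thesis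
        using k by auto
    qed
  next
    case s: (3 u k)
    have x: "x = cl k" and y: "y = (1 - u) * lv k + u * lv (Suc k)"
      using xy curve_vertical[OF s(1-4)] s(5) by (auto simp: shadow_def)
    note Y = vertical_y(1)[OF s(1-4) y]
    show ?thesis
    proof (cases "rg k = Center")
      case True
      note center_lv[OF s(3,4) this]
      then have "x = 0" "0 < y" "y < top"
        using Y x by auto
      then show ?thesis
        using P by (elim disjE conjE; linarith)
    next
      case False
      then have "x < - 1 \<or> 1 < x"
        using cl_not_center[OF s(4) False] s(3) x by auto
      then show ?thesis
        using P by (elim disjE conjE; linarith)
    qed
  qed
qed

lemma meets_iff:
  "meets diagram s t \<longleftrightarrow> (\<exists>k\<in>{1..m}. s = active_param k \<and> t = passive_param k \<or> s = passive_param k \<and> t = active_param k)"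
proof
  assume M: "meets diagram s t"
  then have *: "s \<in> params diagram" "t \<in> params diagram" "s \<noteq> t" "shadow (curve diagram s) = shadow (curve diagram t)"
    unfolding meets_def by auto
  consider "s < 5" "t < 5" | "5 \<le> s" "5 \<le> t" | "5 \<le> s" "t < 5" | "s < 5" "5 \<le> t" by linarith
  then show "\<exists>k\<in>{1..m}. s = active_param k \<and> t = passive_param k \<or> s = passive_param k \<and> t = active_param k"
  proof cases
    case 1
    then show ?thesis using passive_inj * by blast
  next
    case 2
    then show ?thesis using active_inj * by blast
  next
    case 3
    then show ?thesis using active_passive[OF *(1,2)] * by blast
  next
    case 4
    then show ?thesis using active_passive[OF *(2,1)] *(4) by fastforce
  qed
next
  assume "\<exists>k\<in>{1..m}. s = active_param k \<and> t = passive_param k \<or> s = passive_param k \<and> t = active_param k"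
  then obtain k where k: "1 \<le> k" "k \<le> m" and
    st: "s = active_param k \<and> t = passive_param k \<or> s = passive_param k \<and> t = active_param k"
    by auto
  obtain z where "curve diagram (active_param k) = point (strand k) (lv k) z"
    using curve_active[OF k] by metis
  then have "shadow (curve diagram (active_param k)) = shadow (curve diagram (passive_param k))"
    using curve_passive_crossing[OF k] by (simp add: shadow_def)
  moreover have "active_param k \<noteq> passive_param k"
    using active_bounds[OF k] passive_bounds[OF k] k by (cases "third k") auto
  ultimately show "meets diagram s t"
    unfolding meets_def using st active_params[OF k] by metis
qed

lemma param_inj:
  assumes j: "1 \<le> j" "j \<le> m" and k: "1 \<le> k" "k \<le> m"
  shows "active_param j = active_param k \<longleftrightarrow> j = k" "passive_param j = passive_param k \<longleftrightarrow> j = k"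
    "active_param j \<noteq> passive_param k" "passive_param j \<noteq> active_param k"
proof -
  show a: "active_param j = active_param k \<longleftrightarrow> j = k"
  proof
    assume "active_param j = active_param k"
    then have "real j < real k + 1" "real k < real j + 1"
      using active_bounds[OF j] active_bounds[OF k] by linarith+
    then show "j = k"
      by linarith
  qed simp
  show "passive_param j = passive_param k \<longleftrightarrow> j = k"
  proof
    assume "passive_param j = passive_param k"
    then have "lv j = lv k"
      using curve_passive_crossing[OF j] curve_passive_crossing[OF k] by (simp add: point_eq_iff)
    then show "j = k"
      using lv_inj[of j k] lv_inj[of k j] j k by (cases j k rule: linorder_cases) auto
  qed simp
  show "active_param j \<noteq> passive_param k" "passive_param j \<noteq> active_param k"
    using active_bounds[OF k] passive_bounds[OF k] active_bounds[OF j] passive_bounds[OF j] j k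
    by (cases "third k"; cases "third j"; auto)+
qed

lemma crossing_params_eq: "crossing_params diagram = active_param ` {1..m} \<union> passive_param ` {1..m}"
  unfolding crossing_params_def meets_iff by auto

lemma over_active:
  assumes k: "1 \<le> k" "k \<le> m"
  shows "over diagram (active_param k) \<longleftrightarrow> 0 < h k"
proof -
  obtain z where z: "curve diagram (active_param k) = point (strand k) (lv k) z" "0 < z * h k"
    using curve_active[OF k] by metis
  have "meets diagram (active_param k) t \<longleftrightarrow> t = passive_param k" for t
    using k param_inj[OF k] by (auto simp: meets_iff)
  then have "over diagram (active_param k) \<longleftrightarrow> 0 < z"
    unfolding over_def using z(1) curve_passive_crossing[OF k] by simp
  then show ?thesis
    using z(2) by (auto simp: zero_less_mult_iff)
qed

lemma over_passive:
  assumes k: "1 \<le> k" "k \<le> m"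
  shows "over diagram (passive_param k) \<longleftrightarrow> h k < 0"
proof -
  obtain z where z: "curve diagram (active_param k) = point (strand k) (lv k) z" "0 < z * h k"
    using curve_active[OF k] by metis
  have "meets diagram (passive_param k) t \<longleftrightarrow> t = active_param k" for t
    using k param_inj[OF k] by (auto simp: meets_iff)
  then have "over diagram (passive_param k) \<longleftrightarrow> z < 0"
    unfolding over_def using z(1) curve_passive_crossing[OF k] by simp
  then show ?thesis
    using z(2) by (auto simp: zero_less_mult_iff)
qed

lemma param_not_integer:
  assumes "s \<in> crossing_params diagram"
  shows "s \<notin> \<int>"
proof -
  have "s \<notin> \<int>" if "real_of_int i < s" "s < real_of_int i + 1" for i
    using that by (auto elim!: Ints_cases)
  moreover have "\<exists>i. real_of_int i < active_param k \<and> active_param k < real_of_int i + 1" if "1 \<le> k" "k \<le> m" for k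
    using active_bounds[OF that] by (intro exI[of _ "2 * int k + 3"]) auto
  moreover have "\<exists>i. real_of_int i < passive_param k \<and> passive_param k < real_of_int i + 1" if "1 \<le> k" "k \<le> m" for k
    using passive_bounds[OF that]
    by (cases "third k") (auto intro: exI[of _ 0] exI[of _ 2] exI[of _ 4])
  ultimately show ?thesis
    using assms unfolding crossing_params_eq by fastforce
qed

lemma knot_diagram: "knot_diagram diagram"
  unfolding knot_diagram_def
proof (intro conjI allI impI ballI)
  show "3 \<le> length diagram"
    by (simp add: length_diagram)
  show "inj_on (curve diagram) (params diagram)"
  proof (rule inj_onI)
    fix s t
    assume st: "s \<in> params diagram" "t \<in> params diagram" "curve diagram s = curve diagram t"
    show "s = t"
    proof (rule ccontr)
      assume "s \<noteq> t"
      with st have "meets diagram s t"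
        by (simp add: meets_def)
      then obtain k where k: "1 \<le> k" "k \<le> m"
        and "s = active_param k \<and> t = passive_param k \<or> s = passive_param k \<and> t = active_param k"
        unfolding meets_iff by auto
      then have "curve diagram (active_param k) = curve diagram (passive_param k)"
        using st(3) by auto
      moreover obtain z where "curve diagram (active_param k) = point (strand k) (lv k) z" "0 < z * h k"
        using curve_active[OF k] by metis
      ultimately show False
        using curve_passive_crossing[OF k] by (simp add: point_eq_iff)
    qed
  qed
  show "finite (crossing_params diagram)"
    by (simp add: crossing_params_eq)
  show "t = u" if "meets diagram s t \<and> meets diagram s u" for s t u
    using that param_inj unfolding meets_iff by (auto 0 3)
  show "s \<notin> \<int>" if "s \<in> crossing_params diagram" for s
    using that by (rule param_not_integer)
qed

section \<open>Parity of the position of a crossing along the closed curve\<close>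

lemma even_card_touching:
  assumes "i \<le> j" "j \<le> m"
  shows "even (card {k\<in>{i<..j}. third k \<noteq> v}) \<longleftrightarrow> (rg i = v \<longleftrightarrow> rg j = v)"
  using assms
proof (induction j rule: dec_induct)
  case (step j)
  let ?A = "{k\<in>{i<..j}. third k \<noteq> v}"
  \<comment> \<open>A step that touches \<open>v\<close> enters or leaves it, as the walk never
    rests. So being at \<open>v\<close> changes exactly at the steps counted here.\<close>
  have A: "{k\<in>{i<..Suc j}. third k \<noteq> v} = (if third (Suc j) \<noteq> v then insert (Suc j) ?A else ?A)"
    using step.hyps by (auto simp: le_Suc_eq)
  have k: "1 \<le> Suc j" "Suc j \<le> m"
    using step.prems by auto
  show ?case
    unfolding A using step third_eq_iff[OF k, of v] rg_step[OF k] by auto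
qed simp

lemma card_split:
  assumes "finite A"
  shows "card A = card {k\<in>A. P k} + card {k\<in>A. \<not> P k}"
proof -
  have "A = {k\<in>A. P k} \<union> {k\<in>A. \<not> P k}"
    by auto
  then show ?thesis
    using assms by (metis (no_types, lifting) card_Un_disjoint disjoint_iff finite_subset mem_Collect_eq sup_ge1 sup_ge2)
qed

text \<open>Whether a strand is on top at a crossing will be expressed by the parity of this
  position, which reduces alternation to counting.\<close>

definition rank :: "real \<Rightarrow> nat" where
  "rank s = card (crossing_params diagram \<inter> {..<s})"

lemma rank_active:
  assumes k: "1 \<le> k" "k \<le> m"
  shows "rank (active_param k) = m + k - 1"
proof -
  have less: "active_param j < active_param k \<longleftrightarrow> j < k" if "1 \<le> j" "j \<le> m" for j
  proof (cases j k rule: linorder_cases)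
    case less
    then have "real j + 1 \<le> real k" by simp
    then show ?thesis
      using active_bounds[OF k] active_bounds[OF that] less by auto
  next
    case greater
    then have "real k + 1 \<le> real j" by simp
    then show ?thesis
      using active_bounds[OF k] active_bounds[OF that] greater by auto
  qed auto
  have "passive_param j < active_param k" if "1 \<le> j" "j \<le> m" for j
    using passive_bounds[OF that] active_bounds[OF k] k by (cases "third j") auto
  then have "crossing_params diagram \<inter> {..<active_param k} = active_param ` {1..<k} \<union> passive_param ` {1..m}"
    using less k unfolding crossing_params_eq by auto
  moreover have "card (active_param ` {1..<k} \<union> passive_param ` {1..m}) = card (active_param ` {1..<k}) + card (passive_param ` {1..m})"
    using param_inj(3) k by (intro card_Un_disjoint) auto
  moreover have "card (active_param ` {1..<k}) = k - 1" "card (passive_param ` {1..m}) = m"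
    using param_inj(1,2) k by (auto simp: card_image inj_on_def)
  ultimately show ?thesis
    using k by (simp add: rank_def)
qed

text \<open>The passive strand runs up the straight strand, where later crossings are lower, then up
  the left side, where later crossings are higher, and finally down the right side. So the index
  falls along the first and the last of these and rises along the second.\<close>

lemma passive_less:
  assumes j: "1 \<le> j" "j \<le> m" and k: "1 \<le> k" "k \<le> m"
  shows "passive_param j < passive_param k \<longleftrightarrow>
    (case third k of Center \<Rightarrow> third j = Center \<and> k < j
     | Right \<Rightarrow> third j = Center \<or> third j = Right \<and> j < k
     | Left \<Rightarrow> third j = Center \<or> third j = Right \<or> third j = Left \<and> k < j)"
proof (cases "third j = third k")
  case True
  have order: "lv j < lv k \<longleftrightarrow> j < k" if "0 < lv j" "0 < lv k"
    using lv_extreme[of j k] lv_extreme[of k j] that j k by (cases j k rule: linorder_cases) auto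
  have order': "lv j < lv k \<longleftrightarrow> k < j" if "lv j < 0" "lv k < 0"
    using lv_extreme[of j k] lv_extreme[of k j] that j k by (cases j k rule: linorder_cases) auto
  show ?thesis
  proof (cases "third k")
    case Center
    then have "lv j < 0" "lv k < 0"
      using True crossing[OF j] crossing[OF k] by auto
    then show ?thesis
      using Center True b order' by (simp add: passive_param_def divide_less_cancel)
  next
    case Right
    then have "0 < lv j" "0 < lv k"
      using True crossing[OF j] crossing[OF k] by auto
    then show ?thesis
      using Right True top order by (simp add: passive_param_def divide_less_cancel)
  next
    case Left
    then have "0 < lv j" "0 < lv k"
      using True crossing[OF j] crossing[OF k] by auto
    moreover have "passive_param j < passive_param k \<longleftrightarrow> lv k < lv j"
      using Left True top by (simp add: passive_param_def divide_less_cancel)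
    ultimately show ?thesis
      using Left True lv_extreme[of j k] lv_extreme[of k j] j k by (cases j k rule: linorder_cases) auto
  qed
next
  case False
  then show ?thesis
    using passive_bounds[OF j] passive_bounds[OF k] by (cases "third j"; cases "third k") auto
qed

text \<open>Arithmetic for a crossing \<open>k\<close> on the straight strand, the left or the right
  side, in this order, with \<open>l\<close> for \<open>m\<close> and \<open>r\<close> for the rank.
  The other variables are numbers of crossings on these strands up to \<open>k\<close> or after
  it.\<close>

lemma parity_count:
  fixes r l k :: nat
  assumes "k \<le> l"
  shows "r = c \<Longrightarrow> l - k = c + x \<Longrightarrow> even x \<Longrightarrow> even (r + l + k)"
    and "r + 1 = (a + c) + x \<Longrightarrow> k = a + x + y \<Longrightarrow> l - k = c + x' + y' \<Longrightarrow>
      even (a + x) \<noteq> even (x' + y') \<Longrightarrow> even (r + l + k)"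
    and "r = l - y \<Longrightarrow> k = c + y \<Longrightarrow> even c \<Longrightarrow> even (r + l + k)"
proof -
  have l: "l = k + (l - k)"
    using assms by simp
  show "even (r + l + k)" if "r = c" "l - k = c + x" "even x"
  proof -
    have "r + l + k = 2 * (c + k) + x"
      using l unfolding that(1,2) by simp
    then show ?thesis
      using that(3) by simp
  qed
  show "even (r + l + k)"
    if "r + 1 = (a + c) + x" "k = a + x + y" "l - k = c + x' + y'" "even (a + x) \<noteq> even (x' + y')"
  proof -
    have "Suc (r + l + k) = (a + x) + (x' + y') + 2 * (c + k)"
      using l that(1) unfolding that(3) by simp
    then have "odd (Suc (r + l + k))"
      using that(4) by (simp only: even_add) simp
    then show ?thesis
      by simp
  qed
  show "even (r + l + k)" if "r = l - y" "k = c + y" "even c"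
  proof -
    have "l = y + (l - y)"
      using assms that(2) by simp
    then have eq: "r + l + k = 2 * l + c"
      unfolding that(1,2) by simp
    show ?thesis
      unfolding eq using that(3) by simp
  qed
qed

text \<open>Two facts about the walk suffice. It starts at the right, so up to \<open>k\<close> the
  number of steps touching \<open>Left\<close> is even iff it is not at \<open>Left\<close> then. It
  ends outside the center, so after \<open>k\<close> the number of steps touching
  \<open>Center\<close> is even iff it is not at \<open>Center\<close> then. This is where closing
  up outside the neck loop matters.\<close>

lemma rank_passive:
  assumes k: "1 \<le> k" "k \<le> m"
  shows "even (rank (passive_param k) + m + k)"
proof -
  define n where "n = (\<lambda>A v. card {j\<in>A. third j = v})"
  define less where "less = {j\<in>{1..m}. passive_param j < passive_param k}"
  have left_iff: "third j = Left \<longleftrightarrow> third j \<noteq> Center \<and> third j \<noteq> Right" for j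
    by (cases "third j") auto
  have n_split: "card A = n A Center + n A Right + n A Left" if "finite A" for A
  proof -
    have "card A = card {j\<in>A. third j = Center} + card {j\<in>A. third j \<noteq> Center}"
      using that by (rule card_split)
    also have "card {j\<in>A. third j \<noteq> Center} = card {j\<in>{j\<in>A. third j \<noteq> Center}. third j = Right} + card {j\<in>{j\<in>A. third j \<noteq> Center}. third j \<noteq> Right}"
      using that by (intro card_split) auto
    also have "{j\<in>{j\<in>A. third j \<noteq> Center}. third j = Right} = {j\<in>A. third j = Right}"
      by auto
    also have "{j\<in>{j\<in>A. third j \<noteq> Center}. third j \<noteq> Right} = {j\<in>A. third j = Left}"
      unfolding left_iff by auto
    finally show ?thesis
      by (simp add: n_def)
  qed
  have touch: "card {j\<in>A. third j \<noteq> v} = card A - n A v" if "finite A" for A v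
    using card_split[OF that, of "\<lambda>j. third j = v"] by (simp add: n_def)
  let ?A = "{0<..k}" and ?B = "{k<..m}"
  have AB: "n {1..m} v = n ?A v + n ?B v" for v
  proof -
    have "{j\<in>{1..m}. third j = v} = {j\<in>?A. third j = v} \<union> {j\<in>?B. third j = v}"
      using k by auto
    then show ?thesis
      unfolding n_def by (simp add: card_Un_disjoint disjoint_iff)
  qed
  have cA: "k = n ?A Center + n ?A Right + n ?A Left" and cB: "m - k = n ?B Center + n ?B Right + n ?B Left"
    using n_split[of ?A] n_split[of ?B] by simp_all
  have left: "even (n ?A Center + n ?A Right) \<longleftrightarrow> rg k \<noteq> Left"
  proof -
    have "card {j\<in>?A. third j \<noteq> Left} = n ?A Center + n ?A Right"
      using touch[OF finite_greaterThanAtMost, of 0 k Left] n_split[OF finite_greaterThanAtMost, of 0 k] by linarith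
    then show ?thesis
      using even_card_touching[OF _ k(2), of 0 Left] rg_0 by simp
  qed
  have center: "even (n ?B Right + n ?B Left) \<longleftrightarrow> rg k \<noteq> Center"
  proof -
    have "card {j\<in>?B. third j \<noteq> Center} = n ?B Right + n ?B Left"
      using touch[OF finite_greaterThanAtMost, of k m Center] n_split[OF finite_greaterThanAtMost, of k m] by linarith
    then show ?thesis
      using even_card_touching[OF k(2) order_refl, of Center] rg_m by simp
  qed
  have "crossing_params diagram \<inter> {..<passive_param k} = passive_param ` less"
  proof -
    have "\<not> active_param j < passive_param k" if "1 \<le> j" "j \<le> m" for j
      using passive_bounds[OF k] active_bounds[OF that] that by (cases "third k") auto
    then show ?thesis
      unfolding crossing_params_eq less_def by auto
  qed
  moreover have "inj_on passive_param less"
    using param_inj(2) by (auto simp: inj_on_def less_def)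
  ultimately have rank: "rank (passive_param k) = card less"
    by (simp add: rank_def card_image)
  have less_eq: "less = {j\<in>{1..m}. case third k of Center \<Rightarrow> third j = Center \<and> k < j
     | Right \<Rightarrow> third j = Center \<or> third j = Right \<and> j < k
     | Left \<Rightarrow> third j = Center \<or> third j = Right \<or> third j = Left \<and> k < j}"
    unfolding less_def using passive_less[OF _ _ k] by auto
  have rk: "third k = v \<Longrightarrow> rg k \<noteq> v" for v
    using third_eq_iff[OF k] by blast
  show ?thesis
  proof (cases "third k")
    case Center
    then have "less = {j\<in>?B. third j = Center}"
      unfolding less_eq using k by auto
    then have "card less = n ?B Center"
      by (simp add: n_def)
    then show ?thesis
      unfolding rank using cB[unfolded add.assoc] center rk[OF Center] by (intro parity_count(1)[OF k(2)]) auto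
  next
    case Right
    \<comment> \<open>The crossings before \<open>k\<close> on this strand exclude \<open>k\<close>
      itself, whence the \<open>+ 1\<close> below. The move \<open>k\<close> ends in
      \<open>Left\<close> or in \<open>Center\<close>, so that exactly one of the parities in
      \<open>left\<close> and \<open>center\<close> is odd.\<close>
    have "{j\<in>{1..m}. third j = Center \<or> third j = Right \<and> j < k} =
        {j\<in>{1..m}. third j = Center} \<union> ({j\<in>?A. third j = Right} - {k})"
      using k by auto
    moreover have "card ({j\<in>?A. third j = Right} - {k}) = n ?A Right - 1"
      using Right k by (simp add: n_def)
    moreover have "n ?A Right > 0"
      unfolding n_def using Right k by (auto simp: card_gt_0_iff)
    ultimately have "card less + 1 = n {1..m} Center + n ?A Right"
      unfolding less_eq Right using Right by (simp add: card_Un_disjoint disjoint_iff n_def)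
    moreover have "rg k = Left \<or> rg k = Center"
      using rk[OF Right] by (cases "rg k") auto
    ultimately show ?thesis
      unfolding rank using cA cB left center AB[of Center] by (intro parity_count(2)[OF k(2)]) auto
  next
    case Left
    have "less = {1..m} - {j\<in>?A. third j = Left}"
      unfolding less_eq Left region.case left_iff using k by auto
    moreover have "card ({1..m} - {j\<in>?A. third j = Left}) = card {1..m} - card {j\<in>?A. third j = Left}"
      using k by (intro card_Diff_subset) auto
    ultimately have "card less = m - n ?A Left"
      by (simp add: n_def)
    then show ?thesis
      unfolding rank using cA left rk[OF Left] by (intro parity_count(3)[OF k(2)]) auto
  qed
qed

lemma h_sign: "Suc k \<le> m \<Longrightarrow> 0 < h (Suc k) \<longleftrightarrow> (0 < h 1 \<longleftrightarrow> even k)"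
proof (induction k)
  case (Suc k)
  have "h (Suc k) \<noteq> 0"
    using Suc.prems by (intro h_nonzero) auto
  then have "h (Suc k) < 0 \<longleftrightarrow> \<not> 0 < h (Suc k)"
    by linarith
  moreover have "0 < h (Suc (Suc k)) \<longleftrightarrow> h (Suc k) < 0"
    using Suc.prems by (intro h_alternating) auto
  moreover have "0 < h (Suc k) \<longleftrightarrow> (0 < h 1 \<longleftrightarrow> even k)"
    using Suc.prems by (intro Suc.IH) auto
  ultimately show ?case
    by (simp only: even_Suc) blast
qed simp

text \<open>Neighbouring crossings have ranks of different parity, also across the base point, since
  the number of all crossing parameters is even.\<close>

lemma over_iff_rank:
  assumes "s \<in> crossing_params diagram"
  shows "over diagram s \<longleftrightarrow> (even (rank s) \<longleftrightarrow> (0 < h 1 \<longleftrightarrow> even m))"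
proof -
  obtain k where k: "1 \<le> k" "k \<le> m" and s: "s = active_param k \<or> s = passive_param k"
    using assms unfolding crossing_params_eq by auto
  have sign: "0 < h k \<longleftrightarrow> (0 < h 1 \<longleftrightarrow> odd k)"
    using h_sign[of "k - 1"] k by (cases k) auto
  have neg: "h k < 0 \<longleftrightarrow> \<not> 0 < h k"
    using h_nonzero[OF k] by auto
  show ?thesis
    using s
  proof
    assume s: "s = active_param k"
    have "even (rank s) \<longleftrightarrow> odd (m + k)"
      using rank_active[OF k] k s by auto
    then show ?thesis
      using over_active[OF k] sign s by auto
  next
    assume s: "s = passive_param k"
    have "even (rank s) \<longleftrightarrow> even (m + k)"
      using rank_passive[OF k] s by auto
    then show ?thesis
      using over_passive[OF k] sign neg s by auto
  qed
qed

lemma alternating_diagram: "alternating_diagram diagram"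
  unfolding alternating_diagram_def
proof (intro conjI ballI impI)
  show "knot_diagram diagram"
    by (rule knot_diagram)
  let ?C = "crossing_params diagram"
  have fin: "finite ?C"
    by (simp add: crossing_params_eq)
  have card: "card ?C = 2 * m"
  proof -
    have "card ?C = card (active_param ` {1..m}) + card (passive_param ` {1..m})"
      unfolding crossing_params_eq using param_inj(3) by (intro card_Un_disjoint) auto
    moreover have "card (active_param ` {1..m}) = m" "card (passive_param ` {1..m}) = m"
      using param_inj(1,2) by (auto simp: card_image inj_on_def)
    ultimately show ?thesis
      by simp
  qed
  fix s t
  assume s: "s \<in> ?C" and t: "t \<in> ?C" and st: "s < t \<and> (?C \<inter> {s<..<t} = {} \<or> ?C \<subseteq> {s..t})"
  have "even (rank s) \<noteq> even (rank t)"
  proof (cases "?C \<inter> {s<..<t} = {}")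
    case True
    then have "?C \<inter> {..<t} = insert s (?C \<inter> {..<s})"
      using s st by (auto simp: set_eq_iff) (metis linorder_neqE_linordered_idom)
    then have "rank t = Suc (rank s)"
      using fin by (simp add: rank_def)
    then show ?thesis
      by simp
  next
    case False
    then have C: "?C \<subseteq> {s..t}"
      using st by blast
    then have "?C \<inter> {..<s} = {}" "?C \<inter> {..<t} = ?C - {t}"
      using st by (auto simp: subset_iff)
    then have "rank s = 0" "rank t = 2 * m - 1"
      using fin t card by (simp_all add: rank_def)
    then show ?thesis
      using m by simp
  qed
  then show "over diagram s \<noteq> over diagram t"
    using over_iff_rank s t by blast
qed

end

section \<open>The diagram of a tie sequence\<close>

lemma polyline_UN: "polyline zs = (\<Union>i<length zs - 1. closed_segment (zs ! i) (zs ! Suc i))"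
proof (induction zs rule: polyline.induct)
  case (1 x y zs)
  have "{..<length (x # y # zs) - 1} = insert 0 (Suc ` {..<length (y # zs) - 1})"
    by (simp add: lessThan_Suc_eq_insert_0)
  then show ?case
    unfolding polyline.simps 1 by simp
qed auto

text \<open>\<open>curve\<close> runs through half-open edges; the missing end of each is the start
  of the next, and that of the last edge is the head of the list.\<close>

lemma knot_of_eq_polyline:
  assumes "vs \<noteq> []"
  shows "knot_of vs = polyline (vs @ [hd vs])"
proof -
  let ?l = "length vs"
  let ?seg = "\<lambda>i. closed_segment (vs ! i) (vs ! (Suc i mod ?l))"
  have "(vs @ [hd vs]) ! Suc i = vs ! (Suc i mod ?l)" if "i < ?l" for i
    using that assms by (cases "Suc i = ?l") (auto simp: nth_append hd_conv_nth)
  then have poly: "polyline (vs @ [hd vs]) = (\<Union>i<?l. ?seg i)"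
    unfolding polyline_UN by (auto simp: nth_append)
  show ?thesis
    unfolding poly
  proof (intro equalityI subsetI)
    fix x assume "x \<in> knot_of vs"
    then obtain s where s: "0 \<le> s" "s < real ?l" "x = curve vs s"
      by (auto simp: knot_of_def)
    define i t where "i = nat \<lfloor>s\<rfloor>" and "t = s - real i"
    have t: "0 \<le> t" "t < 1" "s = real i + t" "i < ?l"
      using s unfolding t_def i_def by linarith+
    then have "x \<in> ?seg i"
      using s(3) curve_add[of i vs t] by (auto simp: in_segment)
    then show "x \<in> (\<Union>i<?l. ?seg i)"
      using t by blast
  next
    fix x assume "x \<in> (\<Union>i<?l. ?seg i)"
    then obtain i t where t: "i < ?l" "0 \<le> t" "t \<le> 1" "x = (1 - t) *\<^sub>R vs ! i + t *\<^sub>R vs ! (Suc i mod ?l)"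
      by (auto simp: in_segment)
    show "x \<in> knot_of vs"
    proof (cases "t = 1")
      case True
      have j: "Suc i mod ?l < ?l"
        using assms by simp
      have "x = curve vs (real (Suc i mod ?l) + 0)"
        using curve_add[OF j, of 0] t True by simp
      then show ?thesis
        using j unfolding knot_of_def by (intro image_eqI[of _ _ "real (Suc i mod ?l)"]) auto
    next
      case False
      then have "x = curve vs (real i + t)"
        using curve_add[of i vs t] t by simp
      then show ?thesis
        using t False unfolding knot_of_def by (intro image_eqI[of _ _ "real i + t"]) auto
    qed
  qed
qed

text \<open>With \<open>e = -1\<close> this is the mirror image for a tuck to the left, with
  \<open>e = 1\<close> the identity, so that both tucks are treated by the same formulas.\<close>

definition reflect :: "real \<Rightarrow> real^3 \<Rightarrow> real^3" where
  "reflect e v = point (e * v $ 1) (v $ 2) (v $ 3)"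

lemma linear_reflect: "linear (reflect e)"
  by (rule linearI) (auto simp: reflect_def vec_eq_iff forall_3 algebra_simps)

lemma reflect_reflect: "e = 1 \<or> e = - 1 \<Longrightarrow> reflect e (reflect e v) = v"
  by (auto simp: reflect_def vec_eq_iff forall_3)

lemma reflect_point [simp]: "reflect e (point x y z) = point (e * x) y z"
  by (simp add: reflect_def)

definition move_arc :: "tie_move list \<Rightarrow> nat \<Rightarrow> (real^3) list" where
  "move_arc ms k = [point (column ms k) (level ms k) (height ms k),
     point (column ms k) (level ms (Suc k)) (height ms (Suc k))]"

text \<open>\<open>T\<close> is the side of the tuck, with sign \<open>e\<close>, and
  \<open>T'\<close> the other side. As \<open>n = K + 3\<close>, the moves \<open>n - 3\<close> and
  \<open>n - 2\<close> of the untucking lemmas have the indices \<open>K\<close> and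
  \<open>K + 1\<close>; \<open>n\<close> is real since it serves as a coordinate.\<close>

locale tie =
  fixes xs :: "tie_move list" and T T' :: region and e :: real and ms :: "tie_move list" and K :: nat and n :: real
  assumes T: "T = Left \<and> T' = Right \<and> e = - 1 \<or> T = Right \<and> T' = Left \<and> e = 1"
    and ms: "ms = xs @ [(T, Out), (T', In), (Center, Out)]"
    and ts: "tie_sequence ms"
    and K: "K = length xs" and n: "n = real K + 3"
begin

lemma e: "e = 1 \<or> e = - 1" "e * e = 1"
  using T by auto

lemma length_ms: "length ms = K + 3"
  by (simp add: ms K)

lemma region_0: "region_after ms 0 = Right"
  by (simp add: region_after_def)

lemma region_nth: "1 \<le> k \<Longrightarrow> k \<le> K + 3 \<Longrightarrow> region_after ms k = fst (ms ! (k - 1))"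
  using length_ms by (cases k) (auto simp: region_after_def nth_append)

lemma region_1: "region_after ms 1 = Left"
  using ts region_nth[of 1] unfolding tie_sequence_def by auto

lemma region_end: "region_after ms (K + 1) = T" "region_after ms (K + 2) = T'" "region_after ms (K + 3) = Center"
  "region_after ms (K + 4) = T"
proof -
  show "region_after ms (K + 1) = T" "region_after ms (K + 2) = T'" "region_after ms (K + 3) = Center"
    using region_nth[of "K + 1"] region_nth[of "K + 2"] region_nth[of "K + 3"] by (simp_all add: ms K nth_append)
  show "region_after ms (K + 4) = T"
    using length_ms by (simp add: region_after_def tuck_region_def nth_append ms K numeral_eq_Suc)
qed

lemma consecutive: "i + 1 < K + 3 \<Longrightarrow> fst (ms ! i) \<noteq> fst (ms ! (i + 1)) \<and> snd (ms ! i) \<noteq> snd (ms ! (i + 1))"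
  using ts length_ms unfolding tie_sequence_def successively_conv_nth by auto

lemma region_step: "k < K + 3 \<Longrightarrow> region_after ms (Suc k) \<noteq> region_after ms k"
  using region_nth[of k] region_nth[of "Suc k"] consecutive[of "k - 1"] region_0 region_1
  by (cases k) auto

lemma height_nth: "1 \<le> k \<Longrightarrow> k \<le> K + 3 \<Longrightarrow> height ms k = (case snd (ms ! (k - 1)) of In \<Rightarrow> 1 | Out \<Rightarrow> - 1)"
  using length_ms by (auto simp: height_def nth_append)

lemma height_unit: "1 \<le> k \<Longrightarrow> k \<le> K + 3 \<Longrightarrow> height ms k = 1 \<or> height ms k = - 1"
  using height_nth[of k] by (auto split: direction.split)

lemma height_step: "1 \<le> k \<Longrightarrow> k < K + 3 \<Longrightarrow> height ms (Suc k) = - height ms k"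
  using height_nth[of k] height_nth[of "Suc k"] consecutive[of "k - 1"]
  by (cases "snd (ms ! (k - 1))"; cases "snd (ms ! k)") auto

lemma height_end: "height ms (K + 1) = - 1" "height ms (K + 2) = 1" "height ms (K + 3) = - 1" "height ms (K + 4) = 1"
proof -
  show "height ms (K + 1) = - 1" "height ms (K + 2) = 1" "height ms (K + 3) = - 1"
    using height_nth[of "K + 1"] height_nth[of "K + 2"] height_nth[of "K + 3"] by (simp_all add: ms K nth_append)
  show "height ms (K + 4) = 1"
    using length_ms by (simp add: height_def nth_append)
qed

lemma height_K: "1 \<le> K \<Longrightarrow> height ms K = 1"
  using height_step[of K] height_end(1) by simp

lemma region_K: "region_after ms K \<noteq> T"
  using region_step[of K] region_end(1) by auto

lemma column_end: "column ms (K + 1) = e * (n + 1)" "column ms (K + 2) = - e * (n + 2)" "column ms (K + 3) = 0"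
  using region_end T by (auto simp: column_def n)

lemma level_end: "level ms (K + 2) = - (2 * n - 2)" "level ms (K + 3) = 2 * n" "level ms (K + 4) = 2 * n + 2"
  using region_end T by (auto simp: level_def n numeral_eq_Suc)

lemma level_1: "level ms 1 = - 2"
  using region_0 region_1 by (simp add: level_def)

lemma level_abs: "level ms k = 2 * real k \<or> level ms k = - 2 * real k"
  by (simp add: level_def)

lemma column_abs: "\<bar>column ms k\<bar> \<le> real k + 3" "region_after ms k \<noteq> Center \<Longrightarrow> \<bar>column ms k\<bar> = real k + 3"
  by (auto simp: column_def split: region.split)

lemma tuck: "tuck_region ms = T"
  by (simp add: tuck_region_def length_ms) (simp add: ms K nth_append)

lemma tie_diagram_split:
  "tie_diagram ms = passive_strand ms @ concat (map (move_arc ms) [1..<Suc (K + 3)]) @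
    map (reflect e) [point (n + 4) (2 * n + 2) 1, point (n + 4) (- (2 * n - 3)) 2, point 3 (- (2 * n - 3)) 2,
      point 2 (- (2 * n - 3)) 0, point 2 (- 2 * n) 0]"
  using T unfolding tie_diagram_def active_strand_def tuck_strand_def tuck length_ms move_arc_def
  by (auto simp: n Let_def simp del: upt_Suc)

lemma tie_knot_polyline: "knot_of (tie_diagram ms) = polyline (tie_diagram ms @ [point 0 (- 2 * n) 0])"
proof -
  have "hd (tie_diagram ms) = point 0 (- 2 * n) 0" "tie_diagram ms \<noteq> []"
    by (simp_all add: tie_diagram_def passive_strand_def length_ms n)
  then show ?thesis
    using knot_of_eq_polyline by metis
qed

lemma arcs_end:
  "move_arc ms (K + 1) = [point (e * (n + 1)) (level ms (K + 1)) (- 1), point (e * (n + 1)) (- (2 * n - 2)) 1]"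
  "move_arc ms (K + 2) = [point (- e * (n + 2)) (- (2 * n - 2)) 1, point (- e * (n + 2)) (2 * n) (- 1)]"
  "move_arc ms (K + 3) = [point 0 (2 * n) (- 1), point 0 (2 * n + 2) 1]"
  using column_end level_end height_end by (simp_all add: move_arc_def numeral_eq_Suc)

section \<open>Location of the early part of the active strand\<close>

definition inner_box :: "real \<Rightarrow> real \<Rightarrow> (real^3) set" where
  "inner_box a c = {u. \<bar>u $ 1\<bar> \<le> a \<and> \<bar>u $ 2\<bar> \<le> c \<and> \<bar>u $ 3\<bar> \<le> 1}"

lemma convex_inner_box: "convex (inner_box a c)"
proof -
  have "inner_box a c = (\<lambda>u. u $ 1) -` {- a..a} \<inter> (\<lambda>u. u $ 2) -` {- c..c} \<inter> (\<lambda>u. u $ 3) -` {- 1..1}"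
    by (auto simp: inner_box_def abs_le_iff)
  moreover have "convex ((\<lambda>u :: real^3. u $ i) -` S)" if "convex S" for i S
    using that by (intro convex_linear_vimage) (auto simp: linear_iff)
  ultimately show ?thesis
    by (simp add: convex_Int)
qed

lemma early_inner:
  assumes "1 \<le> k" "k \<le> K + 3"
  shows "set (point 1 (- 2) 0 # concat (map (move_arc ms) [1..<k])) \<subseteq> inner_box (real k + 2) (2 * real k)"
proof -
  have "set (move_arc ms i) \<subseteq> inner_box (real k + 2) (2 * real k)" if "1 \<le> i" "i < k" for i
    using column_abs(1)[of i] level_abs[of i] level_abs[of "Suc i"] height_unit[of i] height_unit[of "Suc i"] that assms
    by (auto simp: move_arc_def inner_box_def)
  moreover have "point 1 (- 2) 0 \<in> inner_box (real k + 2) (2 * real k)"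
    using assms by (simp add: inner_box_def)
  ultimately show ?thesis
    by (auto simp: subset_iff)
qed

lemma passive_outer:
  assumes "u \<in> polyline (passive_strand ms)"
  shows "u $ 3 = 0 \<and> - 1 \<le> u $ 1 \<and> u $ 1 \<le> 1 \<and> - 2 * n \<le> u $ 2 \<and> u $ 2 \<le> 2 * n + 4 \<and>
       (u $ 1 = 1 \<or> u $ 1 = - 1 \<or> u $ 2 \<le> 0 \<or> u $ 2 = 2 * n + 4) \<and> (u $ 1 = 0 \<or> - 2 \<le> u $ 2)"
proof -
  have "boxes (passive_strand ms) u" "n \<ge> 3"
    using polyline_boxes[OF assms] by (simp_all add: n)
  then show ?thesis
    by (auto simp: passive_strand_def length_ms move_simps n Let_def)
qed

text \<open>All vertices of the active strand before \<open>A\<close> stay away from the face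
  \<open>\<sigma> * u $ 1 = k + 3\<close> of the box, and this functional increases strictly along
  the edge into \<open>A\<close>. So the face is reached at \<open>A\<close> only, as
  \<open>outer\<close> and \<open>outer_center\<close> require.\<close>

lemma early_strand:
  assumes k: "1 \<le> k" "k \<le> K + 3"
    and u: "u \<in> polyline (passive_strand ms @ concat (map (move_arc ms) [1..<k]) @ [A])"
    and A: "A \<in> inner_box (real k + 3) (2 * real k)" "\<sigma> * A $ 1 = real k + 3" and \<sigma>: "\<sigma> = 1 \<or> \<sigma> = - 1"
  shows "u \<in> polyline (passive_strand ms) \<or> u = A \<or> u \<in> inner_box (real k + 3) (2 * real k) \<and> \<sigma> * u $ 1 < real k + 3"
proof -
  let ?I = "inner_box (real k + 2) (2 * real k)"
  \<comment> \<open>The vertex a in front keeps the list nonempty for \<open>k = 1\<close>; it is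
    where the passive strand is cut off.\<close>
  let ?as = "point 1 (- 2) 0 # concat (map (move_arc ms) [1..<k])"
  have p: "passive_strand ms = butlast (passive_strand ms) @ [point 1 (- 2) 0]"
    by (simp add: passive_strand_def Let_def)
  have "polyline (passive_strand ms @ concat (map (move_arc ms) [1..<k]) @ [A]) =
      polyline (passive_strand ms) \<union> polyline (?as @ [A])"
    using polyline_append[of "butlast (passive_strand ms)" "point 1 (- 2) 0" "concat (map (move_arc ms) [1..<k]) @ [A]"] p
    by (metis append_Cons append_Nil append_assoc)
  moreover have "?as @ [A] = butlast ?as @ last ?as # [A]"
    by (metis append_butlast_last_id append_Cons append_Nil append_assoc list.distinct(1))
  then have "polyline (?as @ [A]) = polyline (butlast ?as @ [last ?as]) \<union> polyline [last ?as, A]"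
    using polyline_append[of "butlast ?as" "last ?as" "[A]"] by simp
  moreover have "butlast ?as @ [last ?as] = ?as"
    by (rule append_butlast_last_id) simp
  moreover have "polyline ?as \<subseteq> ?I"
    using early_inner[OF k] convex_inner_box by (intro polyline_subset_convex) auto
  moreover have "last ?as \<in> ?I"
    using early_inner[OF k] last_in_set[of ?as] by blast
  ultimately have "u \<in> polyline (passive_strand ms) \<or> (\<exists>v\<in>?I. u \<in> closed_segment v A) \<or> u \<in> ?I"
    using u by auto
  moreover have "v \<in> inner_box (real k + 3) (2 * real k) \<and> \<sigma> * v $ 1 < real k + 3" if "v \<in> ?I" for v
    using that \<sigma> by (auto simp: inner_box_def)
  moreover have "u = A \<or> u \<in> inner_box (real k + 3) (2 * real k) \<and> \<sigma> * u $ 1 < real k + 3"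
    if v: "v \<in> inner_box (real k + 3) (2 * real k)" "\<sigma> * v $ 1 < real k + 3" and seg: "u \<in> closed_segment v A" for v
  proof -
    have "linear (\<lambda>u :: real^3. \<sigma> * u $ 1)"
      by (auto simp: linear_iff algebra_simps)
    then have "\<sigma> * u $ 1 \<le> real k + 3 \<and> (\<sigma> * u $ 1 = real k + 3 \<longrightarrow> u = A)"
      using linear_closed_segment_less[OF _ seg, of "\<lambda>u. \<sigma> * u $ 1"] A(2) v(2) by auto
    moreover have "u \<in> inner_box (real k + 3) (2 * real k)"
      using closed_segment_subset[OF v(1) A(1) convex_inner_box] seg by blast
    ultimately show ?thesis
      by auto
  qed
  ultimately show ?thesis
    by blast
qed

lemma region_K_cases: "region_after ms K = T' \<or> region_after ms K = Center \<and> 2 \<le> K"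
proof -
  have "region_after ms K \<noteq> T"
    by (rule region_K)
  moreover have "2 \<le> K" if "region_after ms K = Center"
  proof -
    have "K \<noteq> 0" "K \<noteq> 1"
      using that region_0 region_1 by (metis region.distinct(4) region.distinct(6), metis region.distinct(4) region.distinct(2))
    then show ?thesis
      by simp
  qed
  ultimately show ?thesis
    using T by (cases "region_after ms K") auto
qed

lemma reflect_knot:
  assumes "ambient_isotopic (reflect e ` knot_of vs) (reflect e ` knot_of ws)"
  shows "ambient_isotopic (knot_of vs) (knot_of ws)"
  using ambient_isotopic_involution[OF linear_reflect reflect_reflect[OF e(1)] assms] .

lemma early_box:
  assumes k: "1 \<le> k" "k \<le> K + 3" and A: "A \<in> inner_box (real k + 3) (2 * real k)" "\<sigma> * A $ 1 = real k + 3" "\<sigma> = 1 \<or> \<sigma> = - 1"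
    and w: "w \<in> reflect e ` polyline (passive_strand ms @ concat (map (move_arc ms) [1..<k]) @ [A])"
  shows "w $ 3 = 0 \<and> - 1 \<le> w $ 1 \<and> w $ 1 \<le> 1 \<and> - 2 * n \<le> w $ 2 \<and> w $ 2 \<le> 2 * n + 4 \<and>
       (w $ 1 = 1 \<or> w $ 1 = - 1 \<or> w $ 2 \<le> 0 \<or> w $ 2 = 2 * n + 4) \<and> (w $ 1 = 0 \<or> - 2 \<le> w $ 2) \<or>
     \<bar>w $ 1\<bar> \<le> real k + 3 \<and> \<bar>w $ 2\<bar> \<le> 2 * real k \<and> \<bar>w $ 3\<bar> \<le> 1 \<and> e * \<sigma> * w $ 1 < real k + 3 \<or>
     w = reflect e A"
proof -
  obtain u where u: "u \<in> polyline (passive_strand ms @ concat (map (move_arc ms) [1..<k]) @ [A])" and w: "w = reflect e u"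
    using w by blast
  then show ?thesis
    using early_strand[OF k u A] passive_outer[of u] e(1) unfolding w
    by (auto simp: reflect_def inner_box_def)
qed

section \<open>Untucking: the move n - 2 comes from the side, from the center, or is the first
  move\<close>

lemma untuck_from_side:
  assumes K: "1 \<le> K" and side: "region_after ms K = T'"
  shows "\<exists>vs. alternating_diagram vs \<and> ambient_isotopic (knot_of (tie_diagram ms)) (knot_of vs)"
proof -
  \<comment> \<open>The walk up to move \<open>K\<close>, then the old move \<open>n\<close> as move
    \<open>K + 1\<close> and t1 as move \<open>K + 2\<close>. The remaining values are read off from
    the polygon in which \<open>untuck_side\<close> ends.\<close>
  define rg where "rg = (\<lambda>k. if k \<le> K then region_after ms k else if k = K + 1 then Center else T)"
  define cl where "cl = (\<lambda>k. if k = 0 then 1 else if k \<le> K then column ms k else if k = K + 2 then e * (n + 4) else 0)"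
  define lv where "lv = (\<lambda>k. if k \<le> K then level ms k else if k = K + 1 then 2 * n else if k = K + 2 then 2 * n + 2 else - 2 * n)"
  define g where "g = (\<lambda>k. if k = 1 then 0 else if k \<le> K then height ms k else if k = K + 1 then - 5 / 6 else if k = K + 2 then 1 else 1 / 5)"
  define h where "h = (\<lambda>k. if k \<le> K then height ms k else if k = K + 1 then - 1 else if k = K + 2 then 1 else 0)"
  have side_col: "column ms K = - e * n"
    using side T by (auto simp: column_def n)
  have level_K1: "level ms (K + 1) = - (2 * n - 4)"
    using side region_end(1) T by (auto simp: level_def n)
  interpret ct: closed_tie "K + 2" "- 2 * n" "2 * n + 4" rg cl lv g h
  proof
    show "rg (Suc k) \<noteq> rg k" if "k < K + 2" for k
      using that region_step[of k] side T by (cases "k = K") (auto simp: rg_def)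
    show "\<bar>cl j\<bar> < \<bar>cl k\<bar>" if "j < k" "k \<le> K + 2" "rg k \<noteq> Center" for j k
      using that column_abs(1)[of j] column_abs(2)[of k] e(1) by (auto simp: cl_def rg_def n split: if_splits)
    show "cl k < - 1" if "1 \<le> k" "k \<le> K + 2" "rg k = Left" for k
      using that T by (auto simp: cl_def rg_def n column_def split: if_splits)
    show "1 < cl k" if "1 \<le> k" "k \<le> K + 2" "rg k = Right" for k
      using that T by (auto simp: cl_def rg_def n column_def split: if_splits)
    show "cl k = 0" if "1 \<le> k" "k \<le> K + 2" "rg k = Center" for k
      using that T by (auto simp: cl_def rg_def column_def split: if_splits)
    show "lv k < 0" if "1 \<le> k" "k \<le> K + 2" "Center \<notin> {rg (k - 1), rg k}" for k
      using that by (auto simp: lv_def rg_def level_def split: if_splits)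
    show "0 < lv k" if "1 \<le> k" "k \<le> K + 2" "Center \<in> {rg (k - 1), rg k}" for k
      using that T by (auto simp: lv_def rg_def level_def n split: if_splits)
    show "(0 < lv k \<longrightarrow> lv j < lv k) \<and> (lv k < 0 \<longrightarrow> lv k < lv j)" if "1 \<le> j" "j < k" "k \<le> Suc (K + 2)" for j k
      using that level_abs[of j] level_abs[of k] by (auto simp: lv_def n)
    show "lv k < 2 * n + 4" if "1 \<le> k" "k \<le> K + 2" for k
      using that level_abs[of k] by (auto simp: lv_def n)
    show "0 \<le> g k * h k" if "1 \<le> k" "k \<le> K + 2" for k
      using that by (auto simp: g_def h_def)
    show "h k \<noteq> 0" if "1 \<le> k" "k \<le> K + 2" for k
      using that height_unit[of k] by (auto simp: h_def)
    show "0 < h (Suc k) \<longleftrightarrow> h k < 0" if "1 \<le> k" "k < K + 2" for k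
      using that height_step[of k] height_K by (cases "k = K") (auto simp: h_def)
  qed (use K T side region_0 region_1 level_1 in \<open>auto simp: rg_def cl_def lv_def g_def h_def n\<close>)
  let ?l = "level ms K" and ?pre = "passive_strand ms @ concat (map (move_arc ms) [1..<K])"
  let ?A = "point (- e * n) ?l 1"
  let ?tail = "[point (n + 4) (2 * n + 2) 1, point (n + 4) (- (2 * n - 3)) 2, point 3 (- (2 * n - 3)) 2,
      point 2 (- (2 * n - 3)) 0, point 2 (- 2 * n) 0]"
  define U where "U = reflect e ` polyline (?pre @ [?A])"
  have ee: "e * (e * x) = x" for x
    using e(1) by auto
  have split: "reflect e ` polyline (?pre @ ?A # zs) = U \<union> polyline (point (- n) ?l 1 # map (reflect e) zs)" for zs
    unfolding polyline_append[of ?pre ?A zs] image_Un U_def polyline_linear_image[OF linear_reflect]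
    by (simp add: ee)
  have upt: "[1..<Suc (K + 3)] = [1..<K] @ [K, K + 1, K + 2, K + 3]"
    using K by (simp add: upt_conv_Cons numeral_eq_Suc upt_rec[of 1] flip: upt_add_eq_append[of 1 K])
  have tie: "tie_diagram ms @ [point 0 (- 2 * n) 0] = ?pre @ ?A # [point (- e * n) (- (2 * n - 4)) (- 1),
      point (e * (n + 1)) (- (2 * n - 4)) (- 1), point (e * (n + 1)) (- (2 * n - 2)) 1,
      point (- e * (n + 2)) (- (2 * n - 2)) 1, point (- e * (n + 2)) (2 * n) (- 1),
      point 0 (2 * n) (- 1), point 0 (2 * n + 2) 1] @ map (reflect e) ?tail @ [point 0 (- 2 * n) 0]"
  proof -
    have "move_arc ms K = [?A, point (- e * n) (- (2 * n - 4)) (- 1)]"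
      using side_col level_K1 height_K[OF K] height_end(1) by (simp add: move_arc_def)
    then show ?thesis
      unfolding tie_diagram_split upt using arcs_end level_K1 by simp
  qed
  have "ambient_isotopic (reflect e ` knot_of (tie_diagram ms)) (reflect e ` knot_of ct.diagram)"
  proof -
    have "polygonal U"
      unfolding U_def by (intro polygonal_linear_image linear_reflect polygonal_polyline)
    moreover have "U \<subseteq> Collect (outer n ?l)"
    proof
      fix w assume "w \<in> U"
      then have "w $ 3 = 0 \<and> - 1 \<le> w $ 1 \<and> w $ 1 \<le> 1 \<and> - 2 * n \<le> w $ 2 \<and> w $ 2 \<le> 2 * n + 4 \<and>
       (w $ 1 = 1 \<or> w $ 1 = - 1 \<or> w $ 2 \<le> 0 \<or> w $ 2 = 2 * n + 4) \<and> (w $ 1 = 0 \<or> - 2 \<le> w $ 2) \<or>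
       \<bar>w $ 1\<bar> \<le> real K + 3 \<and> \<bar>w $ 2\<bar> \<le> 2 * real K \<and> \<bar>w $ 3\<bar> \<le> 1 \<and> e * (- e) * w $ 1 < real K + 3 \<or>
       w = reflect e ?A"
        unfolding U_def append_assoc using K e(1) level_abs[of K]
        by (intro early_box) (auto simp: inner_box_def n ee abs_mult)
      then show "w \<in> Collect (outer n ?l)"
        using e(2) by (auto simp: outer_def n ee)
    qed
    moreover have "4 \<le> n" "- (2 * n - 6) \<le> ?l" "?l \<le> 2 * n - 6"
      using K level_abs[of K] by (auto simp: n)
    ultimately have "ambient_isotopic
      (U \<union> polyline (point (- n) ?l 1 # map (reflect e) ([point (- e * n) (- (2 * n - 4)) (- 1),
      point (e * (n + 1)) (- (2 * n - 4)) (- 1), point (e * (n + 1)) (- (2 * n - 2)) 1,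
      point (- e * (n + 2)) (- (2 * n - 2)) 1, point (- e * (n + 2)) (2 * n) (- 1),
      point 0 (2 * n) (- 1), point 0 (2 * n + 2) 1] @ map (reflect e) ?tail @ [point 0 (- 2 * n) 0])))
      (U \<union> polyline (point (- n) ?l 1 # map (reflect e) [point (- e * n) (2 * n) (- 5 / 6), point 0 (2 * n) (- 1),
        point 0 (2 * n + 2) 1, point (e * (n + 4)) (2 * n + 2) 1, point (e * (n + 4)) (- 2 * n) (1 / 5), point 0 (- 2 * n) 0]))"
      using untuck_side[of n ?l U] by (simp add: ee del: polyline.simps)
    moreover have "knot_of ct.diagram = polyline (?pre @ ?A # [point (- e * n) (2 * n) (- 5 / 6), point 0 (2 * n) (- 1),
        point 0 (2 * n + 2) 1, point (e * (n + 4)) (2 * n + 2) 1, point (e * (n + 4)) (- 2 * n) (1 / 5), point 0 (- 2 * n) 0])"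
    proof -
      let ?arc = "\<lambda>k. [point (cl k) (lv k) (h k), point (cl k) (lv (Suc k)) (g (Suc k))]"
      have arcs: "map ?arc [1..<K] = map (move_arc ms) [1..<K]"
        by (rule map_cong) (auto simp: move_arc_def cl_def lv_def h_def g_def)
      have upt: "[1..<Suc (K + 2)] = [1..<K] @ [K, K + 1, K + 2]"
        using K by (simp add: upt_conv_Cons numeral_eq_Suc upt_rec[of 1] flip: upt_add_eq_append[of 1 K])
      have "ct.diagram = ?pre @ ?arc K @ ?arc (K + 1) @ ?arc (K + 2)"
        unfolding ct.diagram_def upt map_append arcs by (simp add: passive_strand_def length_ms n Let_def)
      also have "\<dots> = ?pre @ [?A, point (- e * n) (2 * n) (- 5 / 6), point 0 (2 * n) (- 1),
        point 0 (2 * n + 2) 1, point (e * (n + 4)) (2 * n + 2) 1, point (e * (n + 4)) (- 2 * n) (1 / 5)]"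
        using K side_col height_K by (simp add: cl_def lv_def h_def g_def)
      finally show ?thesis
        using knot_of_eq_polyline[of ct.diagram] by (simp add: passive_strand_def length_ms n Let_def)
    qed
    ultimately show ?thesis
      unfolding tie_knot_polyline tie split by (simp only: split)
  qed
  then show ?thesis
    using ct.alternating_diagram reflect_knot by blast
qed

lemma untuck_from_center:
  assumes K: "2 \<le> K" and center: "region_after ms K = Center"
  shows "\<exists>vs. alternating_diagram vs \<and> ambient_isotopic (knot_of (tie_diagram ms)) (knot_of vs)"
proof -
  \<comment> \<open>\<open>M\<close> is \<open>n - 4\<close>, the last move that remains. It is an
    out-move, and the closing edge leaves its column at the height \<open>23 / 8\<close> with which
    \<open>untuck_center_over\<close> ends.\<close>
  define M where "M = K - 1"
  have M: "1 \<le> M" "K = Suc M" "n = real M + 4"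
    using K by (simp_all add: M_def n of_nat_diff)
  define rg where "rg = region_after ms"
  define cl where "cl = (\<lambda>k. if k = 0 then 1 else if k \<le> M then column ms k else 0)"
  define lv where "lv = (\<lambda>k. if k \<le> M then level ms k else - 2 * n)"
  define g where "g = (\<lambda>k. if k = 1 then 0 else if k \<le> M then height ms k else 23 / 8)"
  define h where "h = (\<lambda>k. if k \<le> M then height ms k else 0)"
  have rg_M: "region_after ms M \<noteq> Center"
    using region_step[of M] center M(2) by auto
  have h_M: "height ms M = - 1"
    using height_step[of M] height_K M by simp
  interpret ct: closed_tie M "- 2 * n" "2 * n + 4" rg cl lv g h
  proof
    show "rg (Suc k) \<noteq> rg k" if "k < M" for k
      using that region_step[of k] M(2) by (auto simp: rg_def)
    show "\<bar>cl j\<bar> < \<bar>cl k\<bar>" if "j < k" "k \<le> M" "rg k \<noteq> Center" for j k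
      using that column_abs(1)[of j] column_abs(2)[of k] by (auto simp: cl_def rg_def split: if_splits)
    show "(0 < lv k \<longrightarrow> lv j < lv k) \<and> (lv k < 0 \<longrightarrow> lv k < lv j)" if "1 \<le> j" "j < k" "k \<le> Suc M" for j k
      using that level_abs[of j] level_abs[of k] by (auto simp: lv_def M(3))
    show "lv k < 2 * n + 4" if "1 \<le> k" "k \<le> M" for k
      using that level_abs[of k] by (auto simp: lv_def M(3))
    show "0 \<le> g k * h k" if "1 \<le> k" "k \<le> M" for k
      using that by (auto simp: g_def h_def)
    show "h k \<noteq> 0" if "1 \<le> k" "k \<le> M" for k
      using that height_unit[of k] M(2) by (auto simp: h_def)
    show "0 < h (Suc k) \<longleftrightarrow> h k < 0" if "1 \<le> k" "k < M" for k
      using that height_step[of k] M(2) by (auto simp: h_def)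
  qed (use M rg_M region_0 region_1 level_1 in \<open>auto simp: rg_def cl_def lv_def g_def h_def column_def level_def\<close>)
  \<comment> \<open>After \<open>M\<close> crossings the walk may be on either side, whatever the
    side of the tuck; \<open>s\<close> below is this side after the reflection.\<close>
  define \<sigma> where "\<sigma> = (if region_after ms M = Left then - 1 else 1 :: real)"
  have \<sigma>: "\<sigma> = 1 \<or> \<sigma> = - 1"
    by (simp add: \<sigma>_def)
  have col: "column ms M = \<sigma> * (n - 1)"
    using rg_M by (cases "region_after ms M") (auto simp: column_def \<sigma>_def M(3))
  define s where "s = e * \<sigma>"
  have s: "s = 1 \<or> s = - 1"
    using \<sigma> e(1) by (auto simp: s_def)
  have lK: "level ms K = 2 * n - 6" "level ms (K + 1) = 2 * n - 4"
    using center M(3) by (simp_all add: level_def M(2))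
  have cK: "column ms K = 0"
    using center by (simp add: column_def)
  let ?l = "level ms M" and ?pre = "passive_strand ms @ concat (map (move_arc ms) [1..<M])"
  let ?A = "point (\<sigma> * (n - 1)) ?l (- 1)"
  let ?tail = "[point (n + 4) (2 * n + 2) 1, point (n + 4) (- (2 * n - 3)) 2, point 3 (- (2 * n - 3)) 2,
      point 2 (- (2 * n - 3)) 0, point 2 (- 2 * n) 0]"
  define U where "U = reflect e ` polyline (?pre @ [?A])"
  have ee: "e * (e * x) = x" for x
    using e(1) by auto
  have es: "e * (\<sigma> * x) = s * x" for x
    by (simp add: s_def)
  have split: "reflect e ` polyline (?pre @ ?A # zs) = U \<union> polyline (point (s * (n - 1)) ?l (- 1) # map (reflect e) zs)" for zs
    unfolding polyline_append[of ?pre ?A zs] image_Un U_def polyline_linear_image[OF linear_reflect]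
    by (simp add: es)
  have upt: "[1..<Suc (K + 3)] = [1..<M] @ [M, K, K + 1, K + 2, K + 3]"
    using M(1,2) by (simp add: upt_conv_Cons numeral_eq_Suc upt_rec[of 1] flip: upt_add_eq_append[of 1 M])
  let ?rest = "[point (\<sigma> * (n - 1)) (2 * n - 6) 1, point 0 (2 * n - 6) 1, point 0 (2 * n - 4) (- 1),
      point (e * (n + 1)) (2 * n - 4) (- 1), point (e * (n + 1)) (- (2 * n - 2)) 1,
      point (- e * (n + 2)) (- (2 * n - 2)) 1, point (- e * (n + 2)) (2 * n) (- 1),
      point 0 (2 * n) (- 1), point 0 (2 * n + 2) 1] @ map (reflect e) ?tail @ [point 0 (- 2 * n) 0]"
  have tie: "tie_diagram ms @ [point 0 (- 2 * n) 0] = ?pre @ ?A # ?rest"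
  proof -
    have "move_arc ms M = [?A, point (\<sigma> * (n - 1)) (2 * n - 6) 1]"
      "move_arc ms K = [point 0 (2 * n - 6) 1, point 0 (2 * n - 4) (- 1)]"
      using col lK cK h_M height_K height_end(1) K M(2) by (simp_all add: move_arc_def)
    then show ?thesis
      unfolding tie_diagram_split upt using arcs_end lK by simp
  qed
  let ?final = "[point (\<sigma> * (n - 1)) (- 2 * n) (23 / 8), point 0 (- 2 * n) 0]"
  have "ambient_isotopic (reflect e ` knot_of (tie_diagram ms)) (reflect e ` knot_of ct.diagram)"
  proof -
    have U: "polygonal U"
      unfolding U_def by (intro polygonal_linear_image linear_reflect polygonal_polyline)
    have box: "U \<subseteq> Collect (outer_center n ?l s)"
    proof
      fix w assume "w \<in> U"
      then have "w $ 3 = 0 \<and> - 1 \<le> w $ 1 \<and> w $ 1 \<le> 1 \<and> - 2 * n \<le> w $ 2 \<and> w $ 2 \<le> 2 * n + 4 \<and>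
       (w $ 1 = 1 \<or> w $ 1 = - 1 \<or> w $ 2 \<le> 0 \<or> w $ 2 = 2 * n + 4) \<and> (w $ 1 = 0 \<or> - 2 \<le> w $ 2) \<or>
       \<bar>w $ 1\<bar> \<le> real M + 3 \<and> \<bar>w $ 2\<bar> \<le> 2 * real M \<and> \<bar>w $ 3\<bar> \<le> 1 \<and> e * \<sigma> * w $ 1 < real M + 3 \<or>
       w = reflect e ?A"
        unfolding U_def append_assoc using M \<sigma> level_abs[of M]
        by (intro early_box) (auto simp: inner_box_def abs_mult)
      then show "w \<in> Collect (outer_center n ?l s)"
        using M(3) by (auto simp: outer_center_def es simp flip: s_def)
    qed
    have l: "5 \<le> n" "- (2 * n - 8) \<le> ?l" "?l \<le> 2 * n - 8"
      using M level_abs[of M] by auto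
    have "ambient_isotopic
      (U \<union> polyline (point (s * (n - 1)) ?l (- 1) # map (reflect e) ?rest))
      (U \<union> polyline (point (s * (n - 1)) ?l (- 1) # map (reflect e) ?final))"
      using ambient_isotopic_trans[OF untuck_center_under[OF l s U box] untuck_center_over[OF l s U box]]
      by (simp add: ee es del: polyline.simps)
    moreover have "knot_of ct.diagram = polyline (?pre @ ?A # ?final)"
    proof -
      let ?arc = "\<lambda>k. [point (cl k) (lv k) (h k), point (cl k) (lv (Suc k)) (g (Suc k))]"
      have arcs: "map ?arc [1..<M] = map (move_arc ms) [1..<M]"
        by (rule map_cong) (auto simp: move_arc_def cl_def lv_def h_def g_def)
      have upt: "[1..<Suc M] = [1..<M] @ [M]"
        using M(1) by simp
      have "ct.diagram = ?pre @ ?arc M"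
        unfolding ct.diagram_def upt map_append arcs by (simp add: passive_strand_def length_ms n Let_def)
      also have "\<dots> = ?pre @ [?A, point (\<sigma> * (n - 1)) (- 2 * n) (23 / 8)]"
        using M(1) col h_M by (simp add: cl_def lv_def h_def g_def)
      finally show ?thesis
        using knot_of_eq_polyline[of ct.diagram] by (simp add: passive_strand_def length_ms n Let_def)
    qed
    ultimately show ?thesis
      unfolding tie_knot_polyline tie by (simp only: split)
  qed
  then show ?thesis
    using ct.alternating_diagram reflect_knot by blast
qed

lemma untuck_shortest:
  assumes K: "K = 0"
  shows "\<exists>vs. alternating_diagram vs \<and> ambient_isotopic (knot_of (tie_diagram ms)) (knot_of vs)"
proof -
  define rg where "rg = (\<lambda>k :: nat. if k = 0 then Right else Left)"
  define cl :: "nat \<Rightarrow> real" where "cl = (\<lambda>k. if k = 0 then 1 else if k = 1 then - 4 else 0)"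
  define lv :: "nat \<Rightarrow> real" where "lv = (\<lambda>k. if k = 1 then - 2 else - 6)"
  define g :: "nat \<Rightarrow> real" where "g = (\<lambda>k. if k = 1 then 0 else - 11 / 12)"
  define h :: "nat \<Rightarrow> real" where "h = (\<lambda>k. if k = 1 then - 1 / 12 else 0)"
  interpret ct: closed_tie 1 "- 6" 10 rg cl lv g h
    by unfold_locales (auto simp: rg_def cl_def lv_def g_def h_def)
  \<comment> \<open>The first move, always to the left, is here also the move \<open>n - 2\<close>
    into the tuck region, so the tuck is on the left.\<close>
  have e: "e = - 1" and n: "n = 3"
    using region_K K region_0 T n by auto
  have "[1..<Suc (K + 3)] = [K + 1, K + 2, K + 3]"
    using K by (simp add: upt_conv_Cons numeral_eq_Suc)
  then have "tie_diagram ms @ [point 0 (- 6) 0] = passive_strand ms @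
      [point (- 4) (- 2) (- 1), point (- 4) (- 4) 1, point 5 (- 4) 1, point 5 6 (- 1),
       point 0 6 (- 1), point 0 8 1, point (- 7) 8 1, point (- 7) (- 3) 2, point (- 3) (- 3) 2,
       point (- 2) (- 3) 0, point (- 2) (- 6) 0, point 0 (- 6) 0]"
    unfolding tie_diagram_split using arcs_end level_1 K by (simp add: e n)
  then have "reflect e ` knot_of (tie_diagram ms) = polyline [point 0 (- 6) 0, point 0 0 0, point 1 0 0,
      point 1 10 0, point (- 1) 10 0, point (- 1) (- 2) 0, point 4 (- 2) (- 1), point 4 (- 4) 1,
      point (- 5) (- 4) 1, point (- 5) 6 (- 1), point 0 6 (- 1), point 0 8 1, point 7 8 1,
      point 7 (- 3) 2, point 3 (- 3) 2, point 2 (- 3) 0, point 2 (- 6) 0, point 0 (- 6) 0]"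
    using tie_knot_polyline
    by (simp add: e n polyline_linear_image[OF linear_reflect] passive_strand_def length_ms K Let_def del: polyline.simps)
  moreover have "reflect e ` knot_of ct.diagram = polyline [point 0 (- 6) 0, point 0 0 0, point 1 0 0,
      point 1 10 0, point (- 1) 10 0, point (- 1) (- 2) 0, point 4 (- 2) (- 1 / 12),
      point 4 (- 6) (- 11 / 12), point 0 (- 6) 0]"
  proof -
    have "ct.diagram = [point 0 (- 6) 0, point 0 0 0, point (- 1) 0 0, point (- 1) 10 0, point 1 10 0,
        point 1 (- 2) 0, point (- 4) (- 2) (- 1 / 12), point (- 4) (- 6) (- 11 / 12)]"
      unfolding ct.diagram_def by (simp add: cl_def lv_def g_def h_def)
    then show ?thesis
      using knot_of_eq_polyline[of ct.diagram]
      by (simp add: e polyline_linear_image[OF linear_reflect] del: polyline.simps)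
  qed
  ultimately have "ambient_isotopic (reflect e ` knot_of (tie_diagram ms)) (reflect e ` knot_of ct.diagram)"
    using untuck_short by (simp only:)
  then show ?thesis
    using ct.alternating_diagram reflect_knot by blast
qed

lemma alternating_diagram_exists:
  "\<exists>vs. alternating_diagram vs \<and> ambient_isotopic (knot_of (tie_diagram ms)) (knot_of vs)"
proof (cases "K = 0")
  case True
  then show ?thesis
    by (rule untuck_shortest)
next
  case False
  then show ?thesis
    using region_K_cases untuck_from_side untuck_from_center by auto
qed

end

theorem theorem15:
  fixes K :: "(real^3) set"
  assumes "tie_knot K"
  shows "alternating_knot K"
proof -
  obtain ms where knot: "knot K" "ambient_isotopic K (knot_of (tie_diagram ms))" and ts: "tie_sequence ms"
    using assms unfolding tie_knot_def by blast
  obtain xs T T' e where "T = Left \<and> T' = Right \<and> e = - 1 \<or> T = Right \<and> T' = Left \<and> e = (1 :: real)"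
    "ms = xs @ [(T, Out), (T', In), (Center, Out)]"
    using ts unfolding tie_sequence_def suffix_def by blast
  then interpret tie xs T T' e ms "length xs" "real (length xs) + 3"
    by unfold_locales (use ts in auto)
  obtain vs where "alternating_diagram vs" "ambient_isotopic (knot_of (tie_diagram ms)) (knot_of vs)"
    using alternating_diagram_exists by blast
  then show ?thesis
    unfolding alternating_knot_def using knot(1) ambient_isotopic_trans[OF knot(2)] by blast
qed

end
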